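(* Let $N\ge2$ and let $\mathbf k=(k_1,\dots,k_N)$ be positive integers. The network degree polynomial is the generating polynomial of balanced $\mathbf k$-factors: $$\Phi_{\mathbf k}(x)=\sum_{a\in\mathfrak E_{\mathbf k}(\mathcal E_N)}w_{\mathbf k}(a)\prod_{(j,i)\in\mathcal E_N}x_{ji}^{a_{ji}}.$$ Consequently, for every loopless directed graph $G$ on $[N]$ with arc set $E(G)$, $$\mathcal D(G,\mathbf k)=\sum_{a\in\mathfrak E_{\mathbf k}(E(G))}w_{\mathbf k}(a).$$
   Context: Let $[N]=\{1,\dots,N\}$ and $\mathcal E_N=\{(j,i):1\le i,j\le N,\ j\ne i\}$, with $(j,i)$ written $j\to i$; $B_i(G)=\{j:j\to i\in E(G)\}$. Here $[z^{\mathbf k}]$ extracts the coefficient of $z_1^{k_1}\cdots z_N^{k_N}$. With variables $x_{ji}$, $(j,i)\in\mathcal E_N$, the network degree polynomial is $\Phi_{\mathbf k}(x)=[z^{\mathbf k}]\prod_{i=1}^N\bigl(\sum_{j\ne i}x_{ji}z_j\bigr)^{k_i}$. A balanced $\mathbf k$-factor supported on $E\subseteq\mathcal E_N$ is $a\in\mathbb Z_{\ge0}^{\mathcal E_N}$ with $a_{ji}=0$ for $(j,i)\notin E$, $\sum_{j\ne i}a_{ji}=k_i$ for all $i$ and $\sum_{i\ne j}a_{ji}=k_j$ for all $j$; the set of these is $\mathfrak E_{\mathbf k}(E)$. The weight is $w_{\mathbf k}(a)=\prod_{i=1}^N\dfrac{k_i!}{\prod_{j\ne i}a_{ji}!}$.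 Algebraic degree. Player $i$ has pure strategies $S_i=\{0,\ldots,k_i\}$ and payoff table $u_i(s,\alpha)$, $s\in S_i$, $\alpha\in\prod_{q\in B_i(G)}S_q$. With $d=\sum_ik_i$ variables $x_{q,t}$ ($1\le t\le k_q$) and $x_{q,0}=1-\sum_{t\ge1}x_{q,t}$, the indifference system is $f_{i,s}(x)=\sum_\alpha(u_i(s,\alpha)-u_i(0,\alpha))\prod_{q\in B_i(G)}x_{q,\alpha_q}=0$ ($1\le i\le N$, $1\le s\le k_i$). $\mathcal D(G,\mathbf k)$ is the number of isolated solutions in $(\mathbb C^* )^d$, counted with multiplicity, for generic coefficients (a nonempty Zariski-open set of payoff tables). It equals $[z^{\mathbf k}]\prod_{i=1}^N\bigl(\sum_{j\in B_i(G)}z_j\bigr)^{k_i}$. *)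

theory Defs
  imports "HOL-Analysis.Analysis" "HOL-Library.Poly_Mapping"
begin

section \<open>Polynomials in several variables\<close>

type_synonym ('v, 'a) mpoly = "('v \<Rightarrow>\<^sub>0 nat) \<Rightarrow>\<^sub>0 'a"

definition Const :: "'a::zero \<Rightarrow> ('v, 'a) mpoly" where
  "Const c = Poly_Mapping.single 0 c"

definition Var :: "'v \<Rightarrow> ('v, 'a::zero_neq_one) mpoly" where
  "Var v = Poly_Mapping.single (Poly_Mapping.single v 1) 1"

definition mcoeff :: "('v, 'a::zero) mpoly \<Rightarrow> ('v \<Rightarrow>\<^sub>0 nat) \<Rightarrow> 'a" where
  "mcoeff p m = Poly_Mapping.lookup p m"

definition meval :: "('v \<Rightarrow> 'a) \<Rightarrow> ('v, 'a::comm_semiring_1) mpoly \<Rightarrow> 'a" where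
  "meval x p = (\<Sum>m\<in>Poly_Mapping.keys p.
     mcoeff p m * (\<Prod>v\<in>Poly_Mapping.keys m. x v ^ Poly_Mapping.lookup m v))"

definition mpolys :: "'v set \<Rightarrow> ('v, 'a::zero) mpoly set" where
  "mpolys V = {p. \<forall>m\<in>Poly_Mapping.keys p. Poly_Mapping.keys m \<subseteq> V}"


section \<open>Arcs and balanced factors\<close>

text \<open>The pair \<open>(j, i)\<close> stands for the arc from \<open>j\<close> to \<open>i\<close>. A loopless directed graph on
  \<open>{1..N}\<close> is given by its arc set \<open>E \<subseteq> arcs N\<close>.\<close>

definition arcs :: "nat \<Rightarrow> (nat \<times> nat) set" where
  "arcs N = {(j, i). j \<in> {1..N} \<and> i \<in> {1..N} \<and> j \<noteq> i}"

definition in_nbrs :: "(nat \<times> nat) set \<Rightarrow> nat \<Rightarrow> nat set" where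
  "in_nbrs E i = {j. (j, i) \<in> E}"

definition balanced_factors ::
    "nat \<Rightarrow> (nat \<Rightarrow> nat) \<Rightarrow> (nat \<times> nat) set \<Rightarrow> (nat \<times> nat \<Rightarrow> nat) set" where
  "balanced_factors N k E = {a \<in> arcs N \<rightarrow>\<^sub>E UNIV.
     (\<forall>e\<in>arcs N - E. a e = 0) \<and>
     (\<forall>i\<in>{1..N}. (\<Sum>j\<in>{1..N} - {i}. a (j, i)) = k i) \<and>
     (\<forall>j\<in>{1..N}. (\<Sum>i\<in>{1..N} - {j}. a (j, i)) = k j)}"

definition factor_weight :: "nat \<Rightarrow> (nat \<Rightarrow> nat) \<Rightarrow> (nat \<times> nat \<Rightarrow> nat) \<Rightarrow> rat" where
  "factor_weight N k a =
     (\<Prod>i\<in>{1..N}. fact (k i) / (\<Prod>j\<in>{1..N} - {i}. fact (a (j, i))))"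


section \<open>The network degree polynomial\<close>

text \<open>The product is a polynomial in the variables \<open>z\<^sub>1, \<dots>, z\<^sub>N\<close> whose coefficients are
  polynomials in the variables \<open>x\<^sub>j\<^sub>i\<close>.\<close>

definition network_degree_poly :: "nat \<Rightarrow> (nat \<Rightarrow> nat) \<Rightarrow> (nat \<times> nat, rat) mpoly" where
  "network_degree_poly N k =
     mcoeff (\<Prod>i\<in>{1..N}. (\<Sum>j\<in>{1..N} - {i}. Const (Var (j, i)) * Var j) ^ k i)
            (\<Sum>i\<in>{1..N}. Poly_Mapping.single i (k i))"


section \<open>Zariski-open sets and intersection multiplicity\<close>

text \<open>Points of the affine space with coordinates indexed by \<open>T\<close> are the extensional functions
  \<open>T \<rightarrow>\<^sub>E UNIV\<close>; a Zariski-open set is the complement of the common zeros of a set of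
  polynomials.\<close>

definition zariski_open :: "'t set \<Rightarrow> ('t \<Rightarrow> complex) set \<Rightarrow> bool" where
  "zariski_open T U \<longleftrightarrow>
     (\<exists>P \<subseteq> mpolys T. U = {u \<in> T \<rightarrow>\<^sub>E UNIV. \<exists>p\<in>P. meval u p \<noteq> 0})"

definition gen_ideal :: "'v set \<Rightarrow> 'i set \<Rightarrow> ('i \<Rightarrow> ('v, complex) mpoly) \<Rightarrow> ('v, complex) mpoly set"
  where "gen_ideal V I f = {\<Sum>i\<in>I. h i * f i | h. \<forall>i\<in>I. h i \<in> mpolys V}"

text \<open>The kernel of the map from the polynomial ring to the quotient of the local ring at \<open>x\<close> by
  the extension of the ideal \<open>J\<close>. When \<open>x\<close> is an isolated zero of \<open>J\<close> that map is onto, so the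
  local quotient, whose dimension is the multiplicity of \<open>x\<close>, is the polynomial ring modulo this
  kernel.\<close>

definition local_kernel ::
    "'v set \<Rightarrow> ('v, complex) mpoly set \<Rightarrow> ('v \<Rightarrow> complex) \<Rightarrow> ('v, complex) mpoly set" where
  "local_kernel V J x = {g \<in> mpolys V. \<exists>h \<in> mpolys V. meval x h \<noteq> 0 \<and> h * g \<in> J}"

text \<open>The dimension of the quotient of the space \<open>A\<close> by its subspace \<open>Q\<close>, as the size of a
  finite family in \<open>A\<close> that is a basis modulo \<open>Q\<close>.\<close>

definition quot_dim :: "('v, complex) mpoly set \<Rightarrow> ('v, complex) mpoly set \<Rightarrow> nat" where
  "quot_dim A Q = (THE m. \<exists>B \<subseteq> A. finite B \<and> card B = m \<and>
     (\<forall>g\<in>A. \<exists>!c. c \<in> B \<rightarrow>\<^sub>E UNIV \<and> g - (\<Sum>b\<in>B. Const (c b) * b) \<in> Q))"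

definition multiplicity_at ::
    "'v set \<Rightarrow> 'i set \<Rightarrow> ('i \<Rightarrow> ('v, complex) mpoly) \<Rightarrow> ('v \<Rightarrow> complex) \<Rightarrow> nat" where
  "multiplicity_at V I f x = quot_dim (mpolys V) (local_kernel V (gen_ideal V I f) x)"


section \<open>The indifference system and the algebraic degree\<close>

text \<open>The pairs \<open>(q, t)\<close> with \<open>1 \<le> t \<le> k\<^sub>q\<close> index both the variables \<open>x\<^sub>q\<^sub>,\<^sub>t\<close> and the equations
  \<open>f\<^sub>i\<^sub>,\<^sub>s\<close>.\<close>

definition slots :: "nat \<Rightarrow> (nat \<Rightarrow> nat) \<Rightarrow> (nat \<times> nat) set" where
  "slots N k = (SIGMA q:{1..N}. {1..k q})"

definition nbr_profiles :: "(nat \<times> nat) set \<Rightarrow> (nat \<Rightarrow> nat) \<Rightarrow> nat \<Rightarrow> (nat \<Rightarrow> nat) set" where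
  "nbr_profiles E k i = (\<Pi>\<^sub>E q\<in>in_nbrs E i. {0..k q})"

text \<open>A payoff table assigns a number \<open>u\<^sub>i(s, \<alpha>)\<close> to every entry \<open>(i, s, \<alpha>)\<close>.\<close>

type_synonym entry = "nat \<times> nat \<times> (nat \<Rightarrow> nat)"

definition entries :: "nat \<Rightarrow> (nat \<times> nat) set \<Rightarrow> (nat \<Rightarrow> nat) \<Rightarrow> entry set" where
  "entries N E k = (SIGMA i:{1..N}. {0..k i} \<times> nbr_profiles E k i)"

definition strat_poly :: "(nat \<Rightarrow> nat) \<Rightarrow> nat \<Rightarrow> nat \<Rightarrow> (nat \<times> nat, complex) mpoly" where
  "strat_poly k q t = (if t = 0 then 1 - (\<Sum>t'\<in>{1..k q}. Var (q, t')) else Var (q, t))"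

definition indiff_poly ::
    "(nat \<times> nat) set \<Rightarrow> (nat \<Rightarrow> nat) \<Rightarrow> (entry \<Rightarrow> complex) \<Rightarrow> nat \<times> nat \<Rightarrow> (nat \<times> nat, complex) mpoly"
  where
  "indiff_poly E k u = (\<lambda>(i, s). \<Sum>\<alpha>\<in>nbr_profiles E k i.
     Const (u (i, s, \<alpha>) - u (i, 0, \<alpha>)) * (\<Prod>q\<in>in_nbrs E i. strat_poly k q (\<alpha> q)))"

definition torus_solutions ::
    "nat \<Rightarrow> (nat \<times> nat) set \<Rightarrow> (nat \<Rightarrow> nat) \<Rightarrow> (entry \<Rightarrow> complex) \<Rightarrow> (nat \<times> nat \<Rightarrow> complex) set" where
  "torus_solutions N E k u = {x \<in> slots N k \<rightarrow>\<^sub>E (UNIV - {0}).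
     \<forall>e\<in>slots N k. meval x (indiff_poly E k u e) = 0}"

text \<open>Isolation refers to the product topology on functions, which on the extensional functions
  over a finite index set is the Euclidean topology.\<close>

definition isolated_solutions ::
    "nat \<Rightarrow> (nat \<times> nat) set \<Rightarrow> (nat \<Rightarrow> nat) \<Rightarrow> (entry \<Rightarrow> complex) \<Rightarrow> (nat \<times> nat \<Rightarrow> complex) set" where
  "isolated_solutions N E k u =
     {x. x isolated_in (torus_solutions N E k u)}"

definition algebraic_degree :: "nat \<Rightarrow> (nat \<times> nat) set \<Rightarrow> (nat \<Rightarrow> nat) \<Rightarrow> nat" where
  "algebraic_degree N E k = (THE m. \<exists>U. zariski_open (entries N E k) U \<and> U \<noteq> {} \<and>
     (\<forall>u\<in>U. finite (isolated_solutions N E k u) \<and>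
        (\<Sum>x\<in>isolated_solutions N E k u.
           multiplicity_at (slots N k) (slots N k) (indiff_poly E k u) x) = m))"

end

theory Submission
  imports Defs "HOL-Computational_Algebra.Fundamental_Theorem_Algebra" "HOL-Library.Nat_Bijection"
begin

text \<open>
  The formula for the network degree polynomial is the multinomial theorem: a choice of one term
  from the expansion of each power is a matrix \<open>a\<close> with prescribed column sums, and it contributes
  to the coefficient of \<open>z\<^sup>k\<close> if its row sums are prescribed as well (\<open>network_coefficient\<close>). Setting
  the variables of absent arcs to 0 turns the sum of the weights over the factors supported on \<open>E\<close>
  into the coefficient \<open>m\<close> of \<open>z\<^sup>k\<close> in \<open>\<Prod>\<^sub>i (\<Sum>\<^sub>j z\<^sub>j)\<^bsup>k i\<^esup>\<close>, where \<open>j\<close> runs over the in-neighbours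
  of \<open>i\<close>. This \<open>m\<close> is also the number of ways to choose, for every equation \<open>(i, s)\<close>, an in-neighbour
  of \<open>i\<close> such that every player \<open>q\<close> is chosen \<open>k q\<close> times.

  It remains to see that a generic indifference system has \<open>m\<close> solutions in the torus. The proof is
  linear algebra in the finite-dimensional spaces \<open>P D\<close> of polynomials of degree at most \<open>D q\<close> in the
  variables of each player \<open>q\<close>, modulo the truncated ideals \<open>I\<close> spanned by the multiples of the
  equations that stay in \<open>P D\<close>.

  There is a payoff table \<open>u0\<close> for which every equation is a product of linear forms, one for each
  in-neighbour. Its zeros correspond to the choices that \<open>m\<close> counts, a choice naming the factor that
  vanishes. Splitting off one factor at a time bounds the codimension of \<open>I\<close> in \<open>P D\<close> from above by a
  recursively defined number \<open>G\<close>, for every subsystem (\<open>codim_prods\<close>). Such an upper bound says that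
  certain vectors span, so it persists for all tables outside the zero set of a polynomial that does
  not vanish at \<open>u0\<close> (\<open>near_span_modulo\<close>). Lower bounds come from an inequality that holds for every
  table when the equations are added one by one: a multiple of a new equation \<open>f\<close> by an element of the old ideal is not new
  (\<open>dim_I_Cons\<close>). As \<open>G\<close> obeys the same recursion (\<open>G_Cons\<close>), both bounds agree near \<open>u0\<close>
  (\<open>near_dim\<close>), and for the whole system \<open>G\<close> equals \<open>m\<close> (\<open>G_eq_card_choices\<close>).

  Now let \<open>l\<close> be a polynomial that separates the \<open>m\<close> zeros at \<open>u0\<close>. Then \<open>1, l, \<dots>, l\<^bsup>m-1\<^esup>\<close> is a
  basis of \<open>P D\<close> modulo \<open>I\<close> at \<open>u0\<close>, hence also near \<open>u0\<close> (\<open>generic_structure\<close>). Therefore the quotient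
  ring of a table near \<open>u0\<close> is \<open>\<complex>[T]\<close> modulo a monic polynomial \<open>chi\<close> of degree \<open>m\<close>, the solutions are
  the roots of \<open>chi\<close>, and their multiplicities are the orders of the roots (\<open>multiplicity_sol\<close>). These
  add up to \<open>m\<close>. As two nonempty Zariski-open sets meet, no other number can be the generic one.
\<close>

section \<open>Evaluating polynomials in several variables\<close>

abbreviation lkp where "lkp \<equiv> Poly_Mapping.lookup"
abbreviation keys where "keys \<equiv> Poly_Mapping.keys"
abbreviation single where "single \<equiv> Poly_Mapping.single"
abbreviation mon :: "('v \<Rightarrow>\<^sub>0 nat) \<Rightarrow> ('v, 'a::zero_neq_one) mpoly" where
  "mon \<mu> \<equiv> single \<mu> 1"

definition mono_val :: "('v \<Rightarrow> 'r::comm_semiring_1) \<Rightarrow> ('v \<Rightarrow>\<^sub>0 nat) \<Rightarrow> 'r" where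
  "mono_val x m = (\<Prod>v\<in>keys m. x v ^ lkp m v)"

text \<open>Evaluation in an algebra over the coefficients. The identity as \<open>\<iota>\<close> gives \<open>meval\<close>; the
  embedding of \<open>\<complex>\<close> in \<open>\<complex>[T]\<close> gives substitution of univariate polynomials.\<close>

definition peval :: "('a::comm_semiring_1 \<Rightarrow> 'r::comm_semiring_1) \<Rightarrow> ('v \<Rightarrow> 'r) \<Rightarrow> ('v, 'a) mpoly \<Rightarrow> 'r"
  where "peval \<iota> x p = (\<Sum>m\<in>keys p. \<iota> (lkp p m) * mono_val x m)"

lemma mono_val_superset:
  "finite A \<Longrightarrow> keys m \<subseteq> A \<Longrightarrow> mono_val x m = (\<Prod>v\<in>A. x v ^ lkp m v)"
  unfolding mono_val_def
  by (intro prod.mono_neutral_left) (auto simp: in_keys_iff)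

lemma mono_val_0 [simp]: "mono_val x 0 = 1"
  by (simp add: mono_val_def)

lemma mono_val_add: "mono_val x (m + n) = mono_val x m * mono_val x n"
proof -
  let ?A = "keys m \<union> keys n"
  have "keys (m + n) \<subseteq> ?A" by (rule keys_add)
  then show ?thesis
    by (simp add: mono_val_superset[of ?A] lookup_add power_add prod.distrib)
qed

lemma mono_val_single [simp]: "mono_val x (single v n) = x v ^ n"
  by (simp add: mono_val_superset[of "{v}"])

lemma mono_val_cong:
  "(\<And>v. v \<in> keys m \<Longrightarrow> x v = y v) \<Longrightarrow> mono_val x m = mono_val y m"
  by (simp add: mono_val_def)

lemma mpoly_sum_monomials: "p = (\<Sum>m\<in>keys p. single m (lkp p m))"
proof (rule poly_mapping_eqI)
  fix n
  have "lkp (\<Sum>m\<in>keys p. single m (lkp p m)) n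
      = (\<Sum>m\<in>keys p. if m = n then lkp p m else 0)"
    by (simp add: lookup_sum lookup_single when_def)
  also have "\<dots> = lkp p n" by (simp add: sum.delta in_keys_iff)
  finally show "lkp p n = lkp (\<Sum>m\<in>keys p. single m (lkp p m)) n" by simp
qed

locale coeff_hom =
  fixes \<iota> :: "'a::comm_semiring_1 \<Rightarrow> 'r::comm_semiring_1"
  assumes hom_0: "\<iota> 0 = 0" and hom_1: "\<iota> 1 = 1"
    and hom_add: "\<iota> (a + b) = \<iota> a + \<iota> b" and hom_mult: "\<iota> (a * b) = \<iota> a * \<iota> b"
begin

lemma peval_superset:
  "finite A \<Longrightarrow> keys p \<subseteq> A \<Longrightarrow> peval \<iota> x p = (\<Sum>m\<in>A. \<iota> (lkp p m) * mono_val x m)"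
  unfolding peval_def by (intro sum.mono_neutral_left) (auto simp: in_keys_iff hom_0)

lemma peval_0 [simp]: "peval \<iota> x 0 = 0"
  by (simp add: peval_def)

lemma peval_add: "peval \<iota> x (p + q) = peval \<iota> x p + peval \<iota> x q"
proof -
  let ?A = "keys p \<union> keys q"
  have "keys (p + q) \<subseteq> ?A" by (rule keys_add)
  then show ?thesis
    by (simp add: peval_superset[of ?A] lookup_add hom_add sum.distrib distrib_right)
qed

lemma peval_sum: "peval \<iota> x (sum f I) = (\<Sum>i\<in>I. peval \<iota> x (f i))"
  by (induction I rule: infinite_finite_induct) (auto simp: peval_add)

lemma peval_single [simp]: "peval \<iota> x (single m c) = \<iota> c * mono_val x m"
  by (simp add: peval_superset[of "{m}"] hom_0)

lemma peval_Const [simp]: "peval \<iota> x (Const c) = \<iota> c"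
  by (simp add: Const_def)

lemma peval_1 [simp]: "peval \<iota> x 1 = 1"
  using peval_Const[of x 1] by (simp add: Const_def hom_1)

lemma peval_Var [simp]: "peval \<iota> x (Var v) = x v"
  by (simp add: Var_def hom_1)

lemma peval_mult: "peval \<iota> x (p * q) = peval \<iota> x p * peval \<iota> x q"
proof -
  have "peval \<iota> x (p * q) = peval \<iota> x
     ((\<Sum>m\<in>keys p. single m (lkp p m)) *
      (\<Sum>n\<in>keys q. single n (lkp q n)))"
    by (simp flip: mpoly_sum_monomials)
  also have "\<dots> = (\<Sum>m\<in>keys p. \<iota> (lkp p m) * mono_val x m) *
      (\<Sum>n\<in>keys q. \<iota> (lkp q n) * mono_val x n)"
    by (simp add: sum_product mult_single peval_sum hom_mult mono_val_add mult_ac)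
  finally show ?thesis by (simp add: peval_def)
qed

lemma peval_prod: "peval \<iota> x (prod f I) = (\<Prod>i\<in>I. peval \<iota> x (f i))"
  by (induction I rule: infinite_finite_induct) (auto simp: peval_mult)

lemma peval_power: "peval \<iota> x (p ^ n) = peval \<iota> x p ^ n"
  by (induction n) (auto simp: peval_mult)

end

locale coeff_ring_hom = coeff_hom \<iota> for \<iota> :: "'a::comm_ring_1 \<Rightarrow> 'r::comm_ring_1"
begin

lemma peval_uminus: "peval \<iota> x (- p) = - peval \<iota> x p"
proof -
  have "peval \<iota> x (- p) + peval \<iota> x p = 0"
    by (simp flip: peval_add)
  then show ?thesis by (simp add: eq_neg_iff_add_eq_0)
qed

lemma peval_diff: "peval \<iota> x (p - q) = peval \<iota> x p - peval \<iota> x q"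
  using peval_add[of x p "- q"] by (simp add: peval_uminus)

end

lemma meval_eq_peval: "meval = peval (\<lambda>c. c)"
  by (intro ext) (simp add: meval_def peval_def mcoeff_def mono_val_def)

global_interpretation ev0: coeff_hom "\<lambda>c::'a::comm_semiring_1. c"
  by unfold_locales simp_all

global_interpretation ev1: coeff_ring_hom "\<lambda>c::'a::comm_ring_1. c"
  by unfold_locales

lemmas meval_simps [simp] =
  ev0.peval_0 [folded meval_eq_peval] ev0.peval_1 [folded meval_eq_peval]
  ev0.peval_Const [folded meval_eq_peval] ev0.peval_Var [folded meval_eq_peval]
  ev0.peval_single [folded meval_eq_peval]

lemmas meval_hom =
  ev0.peval_add [folded meval_eq_peval] ev0.peval_mult [folded meval_eq_peval]
  ev0.peval_sum [folded meval_eq_peval] ev0.peval_prod [folded meval_eq_peval]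
  ev0.peval_power [folded meval_eq_peval] ev1.peval_diff [folded meval_eq_peval]
  ev1.peval_uminus [folded meval_eq_peval]

lemma coeff_hom_poly: "coeff_ring_hom (\<lambda>c::complex. [:c:])"
  by unfold_locales simp_all

interpretation pv: coeff_ring_hom "\<lambda>c::complex. [:c:]"
  by (rule coeff_hom_poly)

lemma meval_cong:
  assumes "p \<in> mpolys V" "\<And>v. v \<in> V \<Longrightarrow> x v = y v"
  shows "meval x p = meval y p"
  unfolding meval_eq_peval peval_def
  using assms by (intro sum.cong refl arg_cong2[where f = "(*)"] mono_val_cong) (auto simp: mpolys_def)

lemma poly_peval:
  "poly (peval (\<lambda>c. [:c:]) g p) \<tau> = meval (\<lambda>v. poly (g v) \<tau>) p"
  by (simp add: peval_def meval_eq_peval mono_val_def poly_sum poly_prod)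

section \<open>Polynomials as a vector space\<close>

lemma Const_0 [simp]: "Const 0 = 0" and Const_1 [simp]: "Const 1 = 1"
  by (auto simp: Const_def)
lemma Const_add: "Const (a + b) = Const a + Const b" by (simp add: Const_def single_add)
lemma Const_mult: "Const (a * b) = Const a * (Const b :: ('v,'a::semiring_0) mpoly)"
  by (simp add: Const_def mult_single)
lemma Const_uminus: "Const (- a) = - (Const a :: ('v,'a::ab_group_add) mpoly)"
  by (simp add: Const_def single_uminus)
lemma Const_diff: "Const (a - b) = Const a - (Const b :: ('v,'a::ab_group_add) mpoly)"
  by (simp add: Const_def single_diff)
lemma Const_sum: "Const (\<Sum>i\<in>I. f i) = (\<Sum>i\<in>I. Const (f i))"
  by (induction I rule: infinite_finite_induct) (auto simp: Const_add)
lemma Const_prod: "Const (\<Prod>i\<in>I. f i) = (\<Prod>i\<in>I. Const (f i) :: ('v,'a::comm_semiring_1) mpoly)"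
  by (induction I rule: infinite_finite_induct) (auto simp: Const_mult)
lemma Const_power: "Const (a ^ n) = (Const a ^ n :: ('v,'a::comm_semiring_1) mpoly)"
  by (induction n) (auto simp: Const_mult)

lemma Const_of_nat: "Const (of_nat n) = (of_nat n :: ('v, 'a::comm_semiring_1) mpoly)"
  by (simp add: Const_def)

lemma lookup_Const_mult: "lkp (Const c * p) m = c * lkp (p :: ('v,'a::comm_semiring_1) mpoly) m"
  by (simp add: Const_def flip: mult_map_scale_conv_mult)
     (simp add: Poly_Mapping.map.rep_eq when_def)

lemma single_eq_Const_mon: "single m c = Const c * (mon m :: ('v,'a::comm_semiring_1) mpoly)"
  by (simp add: Const_def mult_single)

lemma mpoly_sum_mon:
  "(p::('v,'a::comm_semiring_1) mpoly) = (\<Sum>m\<in>keys p. Const (lkp p m) * mon m)"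
  unfolding single_eq_Const_mon[symmetric] by (rule mpoly_sum_monomials)

interpretation mp: vector_space "\<lambda>c p. Const c * (p :: ('v, complex) mpoly)"
  by unfold_locales (auto simp: Const_add Const_mult algebra_simps)

definition supp_in :: "('v \<Rightarrow>\<^sub>0 nat) set \<Rightarrow> ('v, 'a::zero) mpoly set" where
  "supp_in M = {p. keys p \<subseteq> M}"

lemma mpolys_eq_supp_in: "mpolys V = supp_in {m. keys m \<subseteq> V}"
  by (auto simp: mpolys_def supp_in_def)

lemma supp_in_0 [simp]: "0 \<in> supp_in M" by (simp add: supp_in_def)
lemma supp_in_add: "p \<in> supp_in M \<Longrightarrow> q \<in> supp_in M \<Longrightarrow> p + q \<in> supp_in M"
  using keys_add[of p q] by (auto simp: supp_in_def)
lemma supp_in_uminus: "(p :: ('v,'a::ab_group_add) mpoly) \<in> supp_in M \<Longrightarrow> - p \<in> supp_in M"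
  by (auto simp: supp_in_def in_keys_iff)
lemma supp_in_diff: "(p :: ('v,'a::ab_group_add) mpoly) \<in> supp_in M \<Longrightarrow> q \<in> supp_in M \<Longrightarrow> p - q \<in> supp_in M"
  using supp_in_add[of p M "- q"] supp_in_uminus[of q M] by simp
lemma supp_in_sum: "(\<And>i. i \<in> I \<Longrightarrow> f i \<in> supp_in M) \<Longrightarrow> sum f I \<in> supp_in M"
  by (induction I rule: infinite_finite_induct) (auto intro: supp_in_add)
lemma supp_in_mult:
  assumes "p \<in> supp_in M" "q \<in> supp_in M'" "\<And>a b. a \<in> M \<Longrightarrow> b \<in> M' \<Longrightarrow> a + b \<in> M''"
  shows "p * q \<in> supp_in M''"
  unfolding supp_in_def
proof safe
  fix m assume "m \<in> keys (p * q)"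
  then obtain a b where "m = a + b" "a \<in> keys p" "b \<in> keys q"
    using keys_mult[of p q] by blast
  then show "m \<in> M''" using assms by (auto simp: supp_in_def)
qed
lemma supp_in_single: "m \<in> M \<Longrightarrow> single m c \<in> supp_in M"
  by (simp add: supp_in_def)
lemma supp_in_scale: "p \<in> supp_in M \<Longrightarrow> Const c * (p :: ('v,'a::comm_semiring_1) mpoly) \<in> supp_in M"
  by (fastforce simp: supp_in_def in_keys_iff lookup_Const_mult)
lemma supp_in_mono: "M \<subseteq> M' \<Longrightarrow> supp_in M \<subseteq> supp_in M'" by (auto simp: supp_in_def)

lemma subspace_supp_in: "mp.subspace (supp_in M)"
  by (intro mp.subspaceI) (auto intro: supp_in_add supp_in_scale)

lemma supp_in_eq_span: "supp_in M = mp.span (mon ` M)"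
proof
  show "supp_in M \<subseteq> mp.span (mon ` M)"
  proof
    fix p :: "('a, complex) mpoly" assume "p \<in> supp_in M"
    then have "(\<Sum>m\<in>keys p. Const (lkp p m) * mon m) \<in> mp.span (mon ` M)"
      by (intro mp.span_sum mp.span_scale mp.span_base) (auto simp: supp_in_def)
    then show "p \<in> mp.span (mon ` M)" by (simp flip: mpoly_sum_mon)
  qed
  show "mp.span (mon ` M) \<subseteq> supp_in M"
    by (intro mp.span_minimal subspace_supp_in) (auto intro: supp_in_single)
qed

lemma dim_supp_in:
  fixes M :: "('v \<Rightarrow>\<^sub>0 nat) set"
  assumes "finite M" shows "mp.dim (supp_in M :: ('v, complex) mpoly set) = card M"
proof -
  have inj: "inj_on (mon :: _ \<Rightarrow> ('v, complex) mpoly) M"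
    by (intro inj_onI) (metis keys_single singleton_inject zero_neq_one)
  have "mp.independent ((mon :: _ \<Rightarrow> ('v, complex) mpoly) ` M)"
  proof (rule mp.independent_if_scalars_zero)
    fix f :: "('v, complex) mpoly \<Rightarrow> complex" and x :: "('v, complex) mpoly"
    assume s: "(\<Sum>x\<in>mon ` M. Const (f x) * x) = 0" and x: "x \<in> mon ` M"
    then obtain m where m: "m \<in> M" "x = mon m" by auto
    have "0 = lkp (\<Sum>x\<in>mon ` M. Const (f x) * x) m" using s by simp
    also have "\<dots> = (\<Sum>n\<in>M. f (mon n) * (if n = m then 1 else 0))"
      by (simp add: sum.reindex[OF inj] lookup_sum lookup_Const_mult lookup_single when_def)
    also have "\<dots> = f x" using m assms by (simp add: if_distrib sum.delta cong: if_cong)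
    finally show "f x = 0" by simp
  qed (use assms in simp)
  then show ?thesis
    by (simp add: supp_in_eq_span mp.dim_eq_card_independent card_image[OF inj])
qed

lemma mpolys_0 [simp]: "0 \<in> mpolys V" by (simp add: mpolys_def)
lemma mpolys_Const [simp]: "Const c \<in> mpolys V" by (simp add: mpolys_def Const_def)
lemma mpolys_1 [simp]: "1 \<in> mpolys V" by (simp add: mpolys_def)
lemma mpolys_Var [simp]: "(Var v :: ('v,'a::zero_neq_one) mpoly) \<in> mpolys V \<longleftrightarrow> v \<in> V"
  by (simp add: mpolys_def Var_def)
lemma mpolys_add: "p \<in> mpolys V \<Longrightarrow> q \<in> mpolys V \<Longrightarrow> p + q \<in> mpolys V"
  by (simp add: mpolys_eq_supp_in supp_in_add)
lemma mpolys_diff: "(p :: ('v,'a::ab_group_add) mpoly) \<in> mpolys V \<Longrightarrow> q \<in> mpolys V \<Longrightarrow> p - q \<in> mpolys V"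
  by (simp add: mpolys_eq_supp_in supp_in_diff)
lemma mpolys_mult: "p \<in> mpolys V \<Longrightarrow> q \<in> mpolys V \<Longrightarrow> p * q \<in> mpolys V"
  unfolding mpolys_eq_supp_in
  by (erule supp_in_mult, assumption) (metis (mono_tags, lifting) Un_subset_iff keys_add mem_Collect_eq order_trans Un_least)
lemma mpolys_sum: "(\<And>i. i \<in> I \<Longrightarrow> f i \<in> mpolys V) \<Longrightarrow> sum f I \<in> mpolys V"
  by (simp add: mpolys_eq_supp_in supp_in_sum)
lemma mpolys_prod: "(\<And>i. i \<in> I \<Longrightarrow> f i \<in> mpolys V) \<Longrightarrow> prod f I \<in> mpolys V"
  by (induction I rule: infinite_finite_induct) (auto intro: mpolys_mult)
lemma mpolys_power: "p \<in> mpolys V \<Longrightarrow> p ^ n \<in> mpolys V"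
  by (induction n) (auto intro: mpolys_mult)

section \<open>The multinomial theorem\<close>

definition compositions :: "'i set \<Rightarrow> nat \<Rightarrow> ('i \<Rightarrow> nat) set" where
  "compositions S n = {a \<in> S \<rightarrow>\<^sub>E UNIV. sum a S = n}"

definition multinomial :: "'i set \<Rightarrow> ('i \<Rightarrow> nat) \<Rightarrow> nat" where
  "multinomial S a = fact (sum a S) div (\<Prod>j\<in>S. fact (a j))"

lemma finite_compositions:
  assumes "finite S" shows "finite (compositions S n)"
proof (rule finite_subset)
  show "compositions S n \<subseteq> S \<rightarrow>\<^sub>E {..n}"
  proof
    fix a assume a: "a \<in> compositions S n"
    have "a j \<le> n" if "j \<in> S" for j
      using member_le_sum[of j S a] a that assms by (simp add: compositions_def)
    then show "a \<in> S \<rightarrow>\<^sub>E {..n}" using a by (auto simp: compositions_def PiE_iff)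
  qed
qed (use assms in \<open>simp add: finite_PiE\<close>)

lemma multinomialI:
  "c * (\<Prod>j\<in>S. fact (a j)) = (fact (sum a S) :: nat) \<Longrightarrow> multinomial S a = c"
  unfolding multinomial_def by (metis fact_nonzero mult_zero_right nonzero_mult_div_cancel_right)

lemma multinomial_mult_fact:
  "finite S \<Longrightarrow> multinomial S a * (\<Prod>j\<in>S. fact (a j)) = fact (sum a S)"
proof (induction S rule: finite_induct)
  case empty
  then show ?case by (simp add: multinomial_def)
next
  case (insert x S)
  let ?c = "(sum a (insert x S) choose a x) * multinomial S a"
  have "fact (a x) * fact (sum a S) * (sum a (insert x S) choose a x) = fact (sum a (insert x S))"
    using binomial_fact_lemma[of "a x" "sum a (insert x S)"] insert.hyps by simp
  then have "?c * (\<Prod>j\<in>insert x S. fact (a j)) = fact (sum a (insert x S))"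
    using insert.hyps by (simp add: mult_ac flip: insert.IH)
  then show ?case by (simp only: multinomialI)
qed

lemma multinomial_insert:
  assumes "finite S" "x \<notin> S"
  shows "multinomial (insert x S) a = (sum a (insert x S) choose a x) * multinomial S a"
proof (rule multinomialI)
  have "fact (a x) * fact (sum a S) * (sum a (insert x S) choose a x) = fact (sum a (insert x S))"
    using binomial_fact_lemma[of "a x" "sum a (insert x S)"] assms by simp
  then show "(sum a (insert x S) choose a x) * multinomial S a * (\<Prod>j\<in>insert x S. fact (a j)) =
      fact (sum a (insert x S))"
    using assms by (simp add: mult_ac flip: multinomial_mult_fact)
qed

theorem multinomial_theorem:
  fixes y :: "'i \<Rightarrow> 'a::comm_semiring_1"
  assumes "finite S"
  shows "(\<Sum>j\<in>S. y j) ^ n =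
    (\<Sum>a\<in>compositions S n. of_nat (multinomial S a) * (\<Prod>j\<in>S. y j ^ a j))"
  using assms
proof (induction S arbitrary: n)
  case empty
  have "compositions ({} :: 'i set) n = (if n = 0 then {\<lambda>_. undefined} else {})"
    by (auto simp: compositions_def)
  then show ?case by (simp add: multinomial_def power_0_left)
next
  case (insert x S)
  have "(\<Sum>j\<in>insert x S. y j) ^ n = (\<Sum>k\<le>n. of_nat (n choose k) * y x ^ k * (\<Sum>j\<in>S. y j) ^ (n - k))"
    using insert.hyps by (simp add: binomial_ring)
  also have "\<dots> = (\<Sum>k\<le>n. \<Sum>a\<in>compositions S (n - k).
      of_nat (n choose k) * y x ^ k * (of_nat (multinomial S a) * (\<Prod>j\<in>S. y j ^ a j)))"
    by (simp add: insert.IH sum_distrib_left)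
  also have "\<dots> = (\<Sum>(k, a)\<in>(SIGMA k:{..n}. compositions S (n - k)).
      of_nat (n choose k) * y x ^ k * (of_nat (multinomial S a) * (\<Prod>j\<in>S. y j ^ a j)))"
    using insert.hyps by (intro sum.Sigma) (auto intro: finite_compositions)
  also have "\<dots> = (\<Sum>a\<in>compositions (insert x S) n.
      of_nat (multinomial (insert x S) a) * (\<Prod>j\<in>insert x S. y j ^ a j))"
  proof (rule sum.reindex_bij_witness[where i = "\<lambda>a. (a x, restrict a S)" and j = "\<lambda>(k, a). a(x := k)"])
    fix p assume p: "p \<in> (SIGMA k:{..n}. compositions S (n - k))"
    obtain k a where ka: "p = (k, a)" by force
    have upd: "sum (a(x := k)) S = sum a S"
      using insert.hyps by (intro sum.cong) auto
    have a: "k \<le> n" "a \<in> extensional S" "sum a S = n - k"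
      using p ka by (auto simp: compositions_def PiE_def)
    show "(case p of (k, a) \<Rightarrow> a(x := k)) \<in> compositions (insert x S) n"
      using a ka insert.hyps upd by (auto simp: compositions_def PiE_def extensional_def)
    have "restrict (a(x := k)) S = a"
      using a(2) insert.hyps by (auto simp: extensional_def fun_eq_iff restrict_def)
    then show "((case p of (k, a) \<Rightarrow> a(x := k)) x,
           restrict (case p of (k, a) \<Rightarrow> a(x := k)) S) = p"
      using ka by simp
    have "multinomial S (a(x := k)) = multinomial S a"
      using insert.hyps upd unfolding multinomial_def
      by (intro arg_cong2[where f = "(div)"] prod.cong) auto
    moreover have "(\<Prod>j\<in>S. y j ^ (a(x := k)) j) = (\<Prod>j\<in>S. y j ^ a j)"
      using insert.hyps by (intro prod.cong) auto
    moreover have "sum (a(x := k)) (insert x S) = n"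
      using a insert.hyps upd by simp
    ultimately show "of_nat (multinomial (insert x S) (case p of (k, a) \<Rightarrow> a(x := k))) *
          (\<Prod>j\<in>insert x S. y j ^ (case p of (k, a) \<Rightarrow> a(x := k)) j) =
        (case p of (k, a) \<Rightarrow>
           of_nat (n choose k) * y x ^ k * (of_nat (multinomial S a) * (\<Prod>j\<in>S. y j ^ a j)))"
      using insert.hyps ka by (simp add: multinomial_insert mult_ac)
  next
    fix a assume a: "a \<in> compositions (insert x S) n"
    then have ext: "a \<in> extensional (insert x S)" and s: "a x + sum a S = n"
      using insert.hyps by (auto simp: compositions_def PiE_def)
    show "(case (a x, restrict a S) of (k, a) \<Rightarrow> a(x := k)) = a"
      using ext by (auto simp: extensional_def fun_eq_iff restrict_def)
    show "(a x, restrict a S) \<in> (SIGMA k:{..n}. compositions S (n - k))"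
      using s by (auto simp: compositions_def)
  qed
  finally show ?case .
qed

section \<open>Coefficients of products of linear forms\<close>

lemma arcs_eq: "arcs N = (\<lambda>(i, j). (j, i)) ` (SIGMA i:{1..N}. {1..N} - {i})"
  by (auto simp: arcs_def)

lemma prod_arcs:
  "(\<Prod>e\<in>arcs N. f e) = (\<Prod>i\<in>{1..N}. \<Prod>j\<in>{1..N} - {i}. f (j, i))"
proof -
  have "(\<Prod>e\<in>arcs N. f e) = (\<Prod>(i, j)\<in>(SIGMA i:{1..N}. {1..N} - {i}). f (j, i))"
    unfolding arcs_eq by (subst prod.reindex) (auto simp: inj_on_def case_prod_unfold)
  then show ?thesis by (simp add: prod.Sigma)
qed

lemma mon_add: "(mon (m + n) :: ('v, 'a::comm_semiring_1) mpoly) = mon m * mon n"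
  by (simp add: mult_single)

lemma mon_sum: "mon (\<Sum>i\<in>I. m i) = (\<Prod>i\<in>I. mon (m i) :: ('v, 'a::comm_semiring_1) mpoly)"
  by (induction I rule: infinite_finite_induct) (auto simp: mon_add)

lemma Var_power: "(Var v :: ('v, 'a::comm_semiring_1) mpoly) ^ n = mon (single v n)"
proof (induction n)
  case (Suc n)
  then show ?case by (simp add: Var_def mult_single flip: single_add)
qed simp

definition factor_count :: "nat \<Rightarrow> (nat \<times> nat \<Rightarrow> nat) \<Rightarrow> nat" where
  "factor_count N a = (\<Prod>i\<in>{1..N}. multinomial ({1..N} - {i}) (\<lambda>j. a (j, i)))"

lemma factor_weight_eq:
  assumes "a \<in> balanced_factors N k E"
  shows "factor_weight N k a = of_nat (factor_count N a)"
proof -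
  have "(fact (k i) / (\<Prod>j\<in>{1..N} - {i}. fact (a (j, i))) :: rat) =
      of_nat (multinomial ({1..N} - {i}) (\<lambda>j. a (j, i)))" if i: "i \<in> {1..N}" for i
  proof -
    have "of_nat (multinomial ({1..N} - {i}) (\<lambda>j. a (j, i)) * (\<Prod>j\<in>{1..N} - {i}. fact (a (j, i))))
        = (fact (k i) :: rat)"
      using assms i by (subst multinomial_mult_fact) (auto simp: balanced_factors_def)
    then show ?thesis by (simp add: field_simps)
  qed
  then show ?thesis by (simp add: factor_weight_def factor_count_def)
qed

text \<open>The terms of the expanded product are indexed by families of compositions, one for each \<open>i\<close>. Their
  column sums are right by construction, and comparing exponents of \<open>z\<close> imposes the row sums.\<close>

theorem network_coefficient:
  fixes y :: "nat \<times> nat \<Rightarrow> 'a::comm_semiring_1"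
  shows "mcoeff (\<Prod>i\<in>{1..N}. (\<Sum>j\<in>{1..N} - {i}. Const (y (j, i)) * Var j) ^ k i)
      (\<Sum>i\<in>{1..N}. single i (k i)) =
    (\<Sum>a\<in>balanced_factors N k (arcs N). of_nat (factor_count N a) * (\<Prod>e\<in>arcs N. y e ^ a e))"
proof -
  let ?I = "{1..N}"
  define C where "C i = compositions (?I - {i}) (k i)" for i
  define c where "c g = (\<Prod>i\<in>?I. of_nat (multinomial (?I - {i}) (g i)) * (\<Prod>j\<in>?I - {i}. y (j, i) ^ g i j))" for g
  define \<mu> where "\<mu> g = (\<Sum>i\<in>?I. \<Sum>j\<in>?I - {i}. single j (g i j))" for g :: "nat \<Rightarrow> nat \<Rightarrow> nat"
  define \<kappa> where "\<kappa> = (\<Sum>i\<in>?I. single i (k i))"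
  have "(\<Prod>i\<in>?I. (\<Sum>j\<in>?I - {i}. Const (y (j, i)) * Var j) ^ k i) =
      (\<Prod>i\<in>?I. \<Sum>a\<in>C i. of_nat (multinomial (?I - {i}) a) *
         (\<Prod>j\<in>?I - {i}. (Const (y (j, i)) * Var j) ^ a j))"
    by (simp add: multinomial_theorem C_def)
  also have "\<dots> = (\<Sum>g\<in>PiE ?I C. \<Prod>i\<in>?I. of_nat (multinomial (?I - {i}) (g i)) *
         (\<Prod>j\<in>?I - {i}. (Const (y (j, i)) * Var j) ^ g i j))"
    by (rule prod_sum_PiE) (auto simp: C_def finite_compositions)
  also have "\<dots> = (\<Sum>g\<in>PiE ?I C. Const (c g) * mon (\<mu> g))"
    by (simp add: c_def \<mu>_def mon_sum Const_prod Const_mult Const_power Const_of_nat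
        power_mult_distrib Var_power prod.distrib mult_ac)
  finally have "mcoeff (\<Prod>i\<in>?I. (\<Sum>j\<in>?I - {i}. Const (y (j, i)) * Var j) ^ k i) \<kappa> =
      (\<Sum>g\<in>PiE ?I C. if \<mu> g = \<kappa> then c g else 0)"
    by (simp add: mcoeff_def lookup_sum lookup_Const_mult lookup_single when_def if_distrib cong: if_cong)
  also have "\<dots> = (\<Sum>g\<in>{g \<in> PiE ?I C. \<mu> g = \<kappa>}. c g)"
    by (rule sum.inter_filter [symmetric]) (auto simp: C_def finite_compositions intro!: finite_PiE)
  also have "\<dots> = (\<Sum>a\<in>balanced_factors N k (arcs N). of_nat (factor_count N a) * (\<Prod>e\<in>arcs N. y e ^ a e))"
  proof -
    have \<mu>: "\<mu> g = \<kappa> \<longleftrightarrow> (\<forall>j\<in>?I. (\<Sum>i\<in>?I - {j}. g i j) = k j)" for g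
    proof -
      have l\<mu>: "lkp (\<mu> g) j = (if j \<in> ?I then \<Sum>i\<in>?I - {j}. g i j else 0)" for j
      proof -
        have "lkp (\<mu> g) j = (\<Sum>i\<in>?I. if j \<in> ?I - {i} then g i j else 0)"
          by (auto simp: \<mu>_def lookup_sum lookup_single when_def sum.delta intro!: sum.cong)
        also have "\<dots> = (if j \<in> ?I then \<Sum>i\<in>?I - {j}. g i j else 0)"
          by (auto simp: sum.If_cases Int_def intro!: sum.mono_neutral_cong_right)
        finally show ?thesis .
      qed
      have l\<kappa>: "lkp \<kappa> j = (if j \<in> ?I then k j else 0)" for j
        by (simp add: \<kappa>_def lookup_sum lookup_single when_def sum.delta)
      show ?thesis by (auto simp: poly_mapping_eq_iff fun_eq_iff l\<mu> l\<kappa>)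
    qed
    show ?thesis
    proof (rule sum.reindex_bij_witness[where
          j = "\<lambda>g. \<lambda>e\<in>arcs N. g (snd e) (fst e)" and
          i = "\<lambda>a. \<lambda>i\<in>?I. \<lambda>j\<in>?I - {i}. a (j, i)"])
      fix a assume a: "a \<in> balanced_factors N k (arcs N)"
      then show "(\<lambda>e\<in>arcs N. (\<lambda>i\<in>?I. \<lambda>j\<in>?I - {i}. a (j, i)) (snd e) (fst e)) = a"
        by (auto simp: balanced_factors_def arcs_def fun_eq_iff restrict_def PiE_def extensional_def)
      show "(\<lambda>i\<in>?I. \<lambda>j\<in>?I - {i}. a (j, i)) \<in> {g \<in> PiE ?I C. \<mu> g = \<kappa>}"
        using a by (auto simp: balanced_factors_def C_def compositions_def \<mu> intro!: sum.cong)
    next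
      fix g assume g: "g \<in> {g \<in> PiE ?I C. \<mu> g = \<kappa>}"
      let ?a = "\<lambda>e\<in>arcs N. g (snd e) (fst e)"
      have a: "?a (j, i) = g i j" if "i \<in> ?I" "j \<in> ?I" "i \<noteq> j" for i j
        using that by (simp add: arcs_def)
      have gi: "g i \<in> extensional (?I - {i})" "sum (g i) (?I - {i}) = k i" if "i \<in> ?I" for i
        using g that by (auto simp: C_def compositions_def PiE_def)
      show "(\<lambda>i\<in>?I. \<lambda>j\<in>?I - {i}. ?a (j, i)) = g"
      proof (intro ext)
        fix i j
        show "(\<lambda>i\<in>?I. \<lambda>j\<in>?I - {i}. ?a (j, i)) i j = g i j"
        proof (cases "i \<in> ?I")
          case True
          then show ?thesis using gi(1)[of i] by (auto simp: restrict_def extensional_def arcs_def)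
        next
          case False
          then show ?thesis using g by (auto simp: PiE_def extensional_def)
        qed
      qed
      have s1: "(\<Sum>j\<in>?I - {i}. ?a (j, i)) = k i" if "i \<in> ?I" for i
      proof -
        have "(\<Sum>j\<in>?I - {i}. ?a (j, i)) = sum (g i) (?I - {i})"
          using that by (intro sum.cong) (auto simp: arcs_def)
        then show ?thesis using gi(2)[OF that] by simp
      qed
      have s2: "(\<Sum>i\<in>?I - {j}. ?a (j, i)) = k j" if "j \<in> ?I" for j
      proof -
        have "(\<Sum>i\<in>?I - {j}. ?a (j, i)) = (\<Sum>i\<in>?I - {j}. g i j)"
          using that by (intro sum.cong) (auto simp: arcs_def)
        then show ?thesis using g that by (auto simp: \<mu>)
      qed
      show "?a \<in> balanced_factors N k (arcs N)"
        using s1 s2 by (auto simp: balanced_factors_def)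
      have "multinomial (?I - {i}) (\<lambda>j. ?a (j, i)) = multinomial (?I - {i}) (g i)" if "i \<in> ?I" for i
      proof -
        have "(\<Prod>j\<in>?I - {i}. fact (?a (j, i))) = (\<Prod>j\<in>?I - {i}. fact (g i j) :: nat)"
          using that by (intro prod.cong) (auto simp: arcs_def)
        then show ?thesis using s1[OF that] gi(2)[OF that] by (simp add: multinomial_def)
      qed
      moreover have "(\<Prod>j\<in>?I - {i}. y (j, i) ^ ?a (j, i)) = (\<Prod>j\<in>?I - {i}. y (j, i) ^ g i j)"
        if "i \<in> ?I" for i
        using that by (intro prod.cong) (auto simp: arcs_def)
      ultimately show "of_nat (factor_count N ?a) * (\<Prod>e\<in>arcs N. y e ^ ?a e) = c g"
        unfolding prod_arcs factor_count_def c_def of_nat_prod prod.distrib[symmetric]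
        by (intro prod.cong refl) (simp only:)
    qed
  qed
  finally show ?thesis by (simp add: \<kappa>_def)
qed

theorem network_degree_poly_eq:
  "network_degree_poly N k =
     (\<Sum>a\<in>balanced_factors N k (arcs N). Const (factor_weight N k a) * (\<Prod>e\<in>arcs N. Var e ^ a e))"
  unfolding network_degree_poly_def network_coefficient
  by (intro sum.cong refl) (simp add: factor_weight_eq Const_of_nat)

text \<open>Setting the variables of the absent arcs to 0 and those of the arcs of \<open>E\<close> to 1 kills exactly
  the factors that use an absent arc.\<close>

theorem digraph_coefficient:
  assumes E: "E \<subseteq> arcs N"
  shows "of_nat (mcoeff (\<Prod>i\<in>{1..N}. (\<Sum>j\<in>in_nbrs E i. Var j) ^ k i)
      (\<Sum>i\<in>{1..N}. single i (k i))) = (\<Sum>a\<in>balanced_factors N k E. factor_weight N k a)"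
proof -
  let ?I = "{1..N}"
  define y :: "nat \<times> nat \<Rightarrow> nat" where "y e = (if e \<in> E then 1 else 0)" for e
  have "(\<Sum>j\<in>in_nbrs E i. Var j) = (\<Sum>j\<in>?I - {i}. Const (y (j, i)) * (Var j :: (nat, nat) mpoly))" for i
    using E by (intro sum.mono_neutral_cong_left) (auto simp: in_nbrs_def y_def arcs_def simp flip: One_nat_def)
  then have "mcoeff (\<Prod>i\<in>?I. (\<Sum>j\<in>in_nbrs E i. Var j) ^ k i) (\<Sum>i\<in>?I. single i (k i)) =
      (\<Sum>a\<in>balanced_factors N k (arcs N). factor_count N a * (\<Prod>e\<in>arcs N. y e ^ a e))"
    by (simp only: network_coefficient of_nat_id)
  also have "\<dots> = (\<Sum>a\<in>balanced_factors N k E. factor_count N a)"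
  proof (rule sum.mono_neutral_cong_right)
    have "balanced_factors N k (arcs N) \<subseteq> arcs N \<rightarrow>\<^sub>E {..Max (k ` ?I)}"
    proof
      fix a assume a: "a \<in> balanced_factors N k (arcs N)"
      have "a (j, i) \<le> Max (k ` ?I)" if "(j, i) \<in> arcs N" for j i
      proof -
        have "a (j, i) \<le> (\<Sum>j\<in>?I - {i}. a (j, i))"
          using that by (intro member_le_sum) (auto simp: arcs_def)
        also have "\<dots> = k i" using a that by (auto simp: balanced_factors_def arcs_def)
        also have "\<dots> \<le> Max (k ` ?I)" using that by (intro Max_ge) (auto simp: arcs_def)
        finally show ?thesis .
      qed
      then show "a \<in> arcs N \<rightarrow>\<^sub>E {..Max (k ` ?I)}"
        using a by (auto simp: balanced_factors_def PiE_iff)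
    qed
    moreover have "finite (arcs N)" by (auto simp: arcs_eq)
    ultimately show "finite (balanced_factors N k (arcs N))"
      by (auto intro: finite_subset finite_PiE)
    show "balanced_factors N k E \<subseteq> balanced_factors N k (arcs N)"
      by (auto simp: balanced_factors_def)
    show "\<forall>a\<in>balanced_factors N k (arcs N) - balanced_factors N k E.
        factor_count N a * (\<Prod>e\<in>arcs N. y e ^ a e) = 0"
    proof
      fix a assume "a \<in> balanced_factors N k (arcs N) - balanced_factors N k E"
      then obtain e where "e \<in> arcs N - E" "a e \<noteq> 0" by (auto simp: balanced_factors_def)
      then have "y e ^ a e = 0" by (auto simp: y_def)
      then have "(\<Prod>e\<in>arcs N. y e ^ a e) = 0"
        using \<open>e \<in> arcs N - E\<close> \<open>finite (arcs N)\<close> by (intro prod_zero) auto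
      then show "factor_count N a * (\<Prod>e\<in>arcs N. y e ^ a e) = 0" by simp
    qed
    fix a assume "a \<in> balanced_factors N k E"
    then have "(\<Prod>e\<in>arcs N. y e ^ a e) = 1"
      by (intro prod.neutral) (auto simp: y_def balanced_factors_def)
    then show "factor_count N a * (\<Prod>e\<in>arcs N. y e ^ a e) = factor_count N a" by simp
  qed
  finally show ?thesis
    by (simp add: factor_weight_eq of_nat_sum)
qed

section \<open>Dimension modulo a subspace\<close>

context vector_space
begin

lemma finite_basis:
  assumes "V \<subseteq> span F" "finite F"
  obtains B where "B \<subseteq> V" "independent B" "V \<subseteq> span B" "finite B" "card B = dim V"
proof -
  obtain B where B: "B \<subseteq> V" "independent B" "V \<subseteq> span B" "card B = dim V"
    using basis_exists by blast
  moreover have "finite B"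
    using independent_span_bound[OF assms(2) B(2)] B(1) assms(1) by blast
  ultimately show ?thesis using that by blast
qed

text \<open>This bound and the next two take the place of the dimension of a quotient space.\<close>

lemma dim_le_card_plus:
  assumes "finite B" "I \<subseteq> span F" "finite F"
    and "\<And>p. p \<in> V \<Longrightarrow> \<exists>b\<in>span B. p - b \<in> I"
  shows "dim V \<le> card B + dim I"
proof -
  obtain C where C: "C \<subseteq> I" "I \<subseteq> span C" "finite C" "card C = dim I"
    using finite_basis[OF assms(2,3)] by metis
  have "V \<subseteq> span (B \<union> C)"
  proof
    fix p assume "p \<in> V"
    then obtain b where b: "b \<in> span B" "p - b \<in> I" using assms(4) by blast
    then have "b + (p - b) \<in> span (B \<union> C)"
      using C(2) by (intro span_add) (auto intro: subsetD[OF span_mono, rotated])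
    then show "p \<in> span (B \<union> C)" by simp
  qed
  then have "dim V \<le> card (B \<union> C)" using assms(1) C(3) by (intro dim_le_card) auto
  also have "\<dots> \<le> card B + dim I" using card_Un_le[of B C] C(4) by simp
  finally show ?thesis .
qed

lemma card_plus_dim_le:
  fixes n :: nat
  assumes V: "V \<subseteq> span F" "finite F" and I: "subspace I" "I \<subseteq> V"
    and w: "\<And>j. j < n \<Longrightarrow> w j \<in> V"
    and indep: "\<And>c j. (\<Sum>j<n. scale (c j) (w j)) \<in> I \<Longrightarrow> j < n \<Longrightarrow> c j = 0"
  shows "n + dim I \<le> dim V"
proof -
  obtain D where D: "D \<subseteq> V" "V \<subseteq> span D" "finite D" "card D = dim V"
    using finite_basis[OF V] by metis
  obtain C where C: "C \<subseteq> I" "I \<subseteq> span C" "finite C" "card C = dim I" "independent C"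
    using finite_basis[of I F] V I by (metis order_trans)
  let ?e = "\<lambda>i j. if j = i then 1 else 0 :: 'a"
  have e: "(\<Sum>j<n. scale (?e i j) (w j)) = w i" if "i < n" for i
    using that by (simp add: if_distrib[of "\<lambda>c. scale c _"] sum.delta cong: if_cong)
  have notI: "w i \<notin> I" if "i < n" for i
    using indep[of "?e i" i] that e[OF that] by auto
  have inj: "inj_on w {..<n}"
  proof (intro inj_onI, rule ccontr)
    fix i j assume ij: "i \<in> {..<n}" "j \<in> {..<n}" "w i = w j" "i \<noteq> j"
    have "(\<Sum>l<n. scale (?e i l - ?e j l) (w l)) = w i - w j"
      using ij e[of i] e[of j] by (simp add: scale_left_diff_distrib sum_subtractf)
    also have "\<dots> = 0" using ij by simp
    finally have "(\<Sum>l<n. scale (?e i l - ?e j l) (w l)) \<in> I"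
      using subspace_0[OF I(1)] by simp
    from indep[OF this, of i] ij show False by simp
  qed
  have disj: "w ` {..<n} \<inter> C = {}" using notI C(1) by auto
  have "independent (w ` {..<n} \<union> C)"
  proof (rule independent_if_scalars_zero)
    fix f x
    assume s: "(\<Sum>x\<in>w ` {..<n} \<union> C. scale (f x) x) = 0" and x: "x \<in> w ` {..<n} \<union> C"
    have s': "(\<Sum>j<n. scale (f (w j)) (w j)) + (\<Sum>x\<in>C. scale (f x) x) = 0"
      using s disj C(3) by (simp add: sum.union_disjoint sum.reindex[OF inj])
    have "(\<Sum>x\<in>C. scale (f x) x) \<in> I"
      using C(1) I(1) by (intro subspace_sum subspace_scale) auto
    then have "(\<Sum>j<n. scale (f (w j)) (w j)) \<in> I"
      using s' subspace_neg[OF I(1)] by (metis add_eq_0_iff2)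
    then have f0: "f (w j) = 0" if "j < n" for j using indep[of "\<lambda>j. f (w j)" j] that by blast
    then have "(\<Sum>x\<in>C. scale (f x) x) = 0" using s' by simp
    then have "f x = 0" if "x \<in> C" for x
      using independentD[OF C(5) C(3) subset_refl] that by blast
    then show "f x = 0" using f0 x by auto
  qed (use C(3) in simp)
  moreover have "w ` {..<n} \<union> C \<subseteq> span D" using w C(1) I(2) D(2) by auto
  ultimately have "card (w ` {..<n} \<union> C) \<le> card D"
    using independent_span_bound[OF D(3)] by blast
  then show ?thesis
    using disj C D inj by (simp add: card_Un_disjoint card_image)
qed

text \<open>The subspace \<open>Q\<close> may have infinite dimension and codimension, so the comparison is made inside the
  span of the finitely many vectors involved.\<close>

lemma card_le_card_modulo:
  fixes n :: nat
  assumes Q: "subspace Q" and B: "finite B" "\<And>j. j < n \<Longrightarrow> \<exists>b\<in>span B. w j - b \<in> Q"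
    and indep: "\<And>c j. (\<Sum>j<n. scale (c j) (w j)) \<in> Q \<Longrightarrow> j < n \<Longrightarrow> c j = 0"
  shows "n \<le> card B"
proof -
  let ?F = "B \<union> w ` {..<n}"
  let ?V = "span ?F"
  have F: "finite ?F" using B by simp
  have "dim ?V \<le> card B + dim (?V \<inter> Q)"
  proof (rule dim_le_card_plus[OF B(1) _ F])
    fix p assume "p \<in> ?V"
    then show "\<exists>b\<in>span B. p - b \<in> ?V \<inter> Q"
    proof (induction rule: span_induct_alt)
      case base
      then show ?case using span_zero subspace_0[OF Q] by (intro bexI[of _ 0]) auto
    next
      case (step c x y)
      obtain b where b: "b \<in> span B" "y - b \<in> ?V \<inter> Q" using step by blast
      have "\<exists>b'\<in>span B. x - b' \<in> ?V \<inter> Q"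
      proof (cases "x \<in> B")
        case True
        then show ?thesis using span_base span_zero subspace_0[OF Q] by (intro bexI[of _ x]) auto
      next
        case False
        then obtain j where "j < n" "x = w j" using step by auto
        then obtain b' where b': "b' \<in> span B" "x - b' \<in> Q" using B(2) by blast
        then have "b' \<in> ?V" using span_mono[of B ?F] by auto
        then have "x - b' \<in> ?V" using step by (intro span_diff) (auto intro: span_base)
        then show ?thesis using b' by auto
      qed
      then obtain b' where b': "b' \<in> span B" "x - b' \<in> ?V \<inter> Q" by blast
      have "scale c x + y - (scale c b' + b) = scale c (x - b') + (y - b)"
        by (simp add: algebra_simps)
      also have "\<dots> \<in> ?V \<inter> Q"
        using b b' Q by (auto intro!: span_add span_scale subspace_add subspace_scale)
      finally show ?case using b b' by (intro bexI[of _ "scale c b' + b"]) (auto intro!: span_add span_scale)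
    qed
  qed auto
  moreover have "n + dim (?V \<inter> Q) \<le> dim ?V"
    by (rule card_plus_dim_le[where w = w, OF _ F])
      (use Q indep in \<open>auto intro!: subspace_inter intro: span_base span_sum span_scale\<close>)
  ultimately show ?thesis by simp
qed

end

text \<open>Any two bases modulo \<open>Q\<close> have the same size, so the definite description in \<open>quot_dim\<close> can be
  computed from one of them.\<close>

lemma quot_dim_eqI:
  fixes n :: nat
  assumes A: "mp.subspace A" and Q: "mp.subspace Q"
    and w: "\<And>j. j < n \<Longrightarrow> w j \<in> A"
    and sp: "\<And>g. g \<in> A \<Longrightarrow> \<exists>c. g - (\<Sum>j<n. Const (c j) * w j) \<in> Q"
    and indep: "\<And>c j. (\<Sum>j<n. Const (c j) * w j) \<in> Q \<Longrightarrow> j < n \<Longrightarrow> c j = 0"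
  shows "quot_dim A Q = n"
proof -
  define basis where "basis B \<longleftrightarrow> (\<forall>g\<in>A. \<exists>!c. c \<in> B \<rightarrow>\<^sub>E UNIV \<and> g - (\<Sum>b\<in>B. Const (c b) * b) \<in> Q)"
    for B :: "('a, complex) mpoly set"
  have uniq: "card B = n" if B: "B \<subseteq> A" "finite B" "basis B" for B
  proof (rule antisym)
    have "\<exists>b\<in>mp.span B. w j - b \<in> Q" if j: "j < n" for j
    proof -
      obtain c where "w j - (\<Sum>b\<in>B. Const (c b) * b) \<in> Q"
        using B(3) w[OF j] unfolding basis_def by blast
      then show ?thesis by (intro bexI) (auto intro: mp.span_sum mp.span_scale mp.span_base)
    qed
    then show "n \<le> card B"
      by (rule mp.card_le_card_modulo[where w = w, OF Q B(2)]) (auto intro: indep)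
    define b where "b = from_nat_into B"
    have bij: "bij_betw b {..<card B} B"
      unfolding b_def by (rule bij_betw_from_nat_into_finite[OF B(2)])
    have "card B \<le> card (w ` {..<n})"
    proof (rule mp.card_le_card_modulo[OF Q])
      fix j assume "j < card B"
      then have "b j \<in> A" using bij B(1) by (auto simp: bij_betw_def)
      then obtain c where "b j - (\<Sum>j<n. Const (c j) * w j) \<in> Q" using sp by blast
      moreover have "(\<Sum>j<n. Const (c j) * w j) \<in> mp.span (w ` {..<n})"
        by (intro mp.span_sum mp.span_scale) (auto intro: mp.span_base)
      ultimately show "\<exists>p\<in>mp.span (w ` {..<n}). b j - p \<in> Q" by blast
    next
      fix c j assume s: "(\<Sum>j<card B. Const (c j) * b j) \<in> Q" and j: "j < card B"
      define d where "d = (\<lambda>x\<in>B. - c (the_inv_into {..<card B} b x))"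
      have inv: "the_inv_into {..<card B} b (b j) = j" if "j < card B" for j
        using bij that by (simp add: bij_betw_def the_inv_into_f_f)
      have "(\<Sum>x\<in>B. Const (d x) * x) = (\<Sum>j<card B. Const (d (b j)) * b j)"
        using sum.reindex_bij_betw[OF bij, of "\<lambda>x. Const (d x) * x"] by simp
      also have "\<dots> = - (\<Sum>j<card B. Const (c j) * b j)"
        using bij inv by (auto simp: d_def Const_uminus bij_betw_def sum_negf[symmetric] intro!: sum.cong)
      finally have "0 - (\<Sum>x\<in>B. Const (d x) * x) \<in> Q" using s by simp
      moreover have "0 - (\<Sum>x\<in>B. Const ((\<lambda>x\<in>B. 0) x) * x) \<in> Q"
        using mp.subspace_0[OF Q] by simp
      moreover have "d \<in> B \<rightarrow>\<^sub>E UNIV" "(\<lambda>x\<in>B. 0 :: complex) \<in> B \<rightarrow>\<^sub>E UNIV" by (auto simp: d_def)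
      ultimately have "d = (\<lambda>x\<in>B. 0)"
        using B(3) mp.subspace_0[OF A] unfolding basis_def by blast
      moreover have "b j \<in> B" using bij j by (auto simp: bij_betw_def)
      ultimately have "d (b j) = 0" by simp
      then show "c j = 0" using \<open>b j \<in> B\<close> inv[OF j] by (simp add: d_def)
    qed simp
    also have "\<dots> \<le> n" using card_image_le[of "{..<n}" w] by simp
    finally show "card B \<le> n" .
  qed
  have inj: "inj_on w {..<n}"
  proof (intro inj_onI, rule ccontr)
    fix i j assume ij: "i \<in> {..<n}" "j \<in> {..<n}" "w i = w j" "i \<noteq> j"
    let ?e = "\<lambda>l. (if l = i then 1 else 0) - (if l = j then 1 else 0) :: complex"
    have "(\<Sum>l<n. Const (?e l) * w l) =
       (\<Sum>l<n. if l = i then w l else 0) - (\<Sum>l<n. if l = j then w l else 0)"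
      unfolding sum_subtractf[symmetric] by (intro sum.cong) (auto simp: Const_diff)
    also have "\<dots> = 0" using ij by (simp add: sum.delta)
    finally have "(\<Sum>l<n. Const (?e l) * w l) \<in> Q" using mp.subspace_0[OF Q] by simp
    from indep[OF this, of i] ij show False by simp
  qed
  let ?B = "w ` {..<n}"
  have B: "?B \<subseteq> A" "finite ?B" "basis ?B"
  proof -
    show "basis ?B" unfolding basis_def
    proof (intro ballI ex_ex1I)
      fix g assume "g \<in> A"
      then obtain c where c: "g - (\<Sum>j<n. Const (c j) * w j) \<in> Q" using sp by blast
      have "(\<Sum>b\<in>?B. Const ((\<lambda>b\<in>?B. c (the_inv_into {..<n} w b)) b) * b) = (\<Sum>j<n. Const (c j) * w j)"
        by (simp add: sum.reindex[OF inj] the_inv_into_f_f[OF inj])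
      then show "\<exists>c. c \<in> ?B \<rightarrow>\<^sub>E UNIV \<and> g - (\<Sum>b\<in>?B. Const (c b) * b) \<in> Q"
        using c by (intro exI[of _ "\<lambda>b\<in>?B. c (the_inv_into {..<n} w b)"]) auto
    next
      fix g c d
      assume c: "c \<in> ?B \<rightarrow>\<^sub>E UNIV \<and> g - (\<Sum>b\<in>?B. Const (c b) * b) \<in> Q"
        and d: "d \<in> ?B \<rightarrow>\<^sub>E UNIV \<and> g - (\<Sum>b\<in>?B. Const (d b) * b) \<in> Q"
      have "(g - (\<Sum>b\<in>?B. Const (d b) * b)) - (g - (\<Sum>b\<in>?B. Const (c b) * b)) \<in> Q"
        using c d mp.subspace_diff[OF Q] by blast
      also have "(g - (\<Sum>b\<in>?B. Const (d b) * b)) - (g - (\<Sum>b\<in>?B. Const (c b) * b)) =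
          (\<Sum>j<n. Const (c (w j) - d (w j)) * w j)"
        by (simp add: sum.reindex[OF inj] Const_diff algebra_simps sum_subtractf)
      finally have "c (w j) = d (w j)" if "j < n" for j using indep that by fastforce
      then show "c = d" using c d by (intro PiE_ext[of c ?B "\<lambda>_. UNIV" d]) auto
    qed
  qed (use w in auto)
  show ?thesis unfolding quot_dim_def basis_def[symmetric]
  proof (rule the_equality)
    show "\<exists>B\<subseteq>A. finite B \<and> card B = n \<and> basis B" using B uniq by blast
  qed (use uniq in blast)
qed

section \<open>Conditions that hold near a point in the Zariski topology\<close>

definition polyfun :: "'t set \<Rightarrow> (('t \<Rightarrow> complex) \<Rightarrow> complex) \<Rightarrow> bool" where
  "polyfun T f \<longleftrightarrow> (\<exists>p\<in>mpolys T. \<forall>u. f u = meval u p)"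

lemma polyfun_const: "polyfun T (\<lambda>u. c)"
  unfolding polyfun_def by (intro bexI[of _ "Const c"]) auto
lemma polyfun_coord: "e \<in> T \<Longrightarrow> polyfun T (\<lambda>u. u e)"
  unfolding polyfun_def by (intro bexI[of _ "Var e"]) auto
lemma polyfun_add: "polyfun T f \<Longrightarrow> polyfun T g \<Longrightarrow> polyfun T (\<lambda>u. f u + g u)"
  unfolding polyfun_def by (metis meval_hom(1) mpolys_add)
lemma polyfun_diff: "polyfun T f \<Longrightarrow> polyfun T g \<Longrightarrow> polyfun T (\<lambda>u. f u - g u)"
  unfolding polyfun_def by (metis meval_hom(6) mpolys_diff)
lemma polyfun_mult: "polyfun T f \<Longrightarrow> polyfun T g \<Longrightarrow> polyfun T (\<lambda>u. f u * g u)"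
  unfolding polyfun_def by (metis meval_hom(2) mpolys_mult)
lemma polyfun_sum: "(\<And>i. i \<in> I \<Longrightarrow> polyfun T (f i)) \<Longrightarrow> polyfun T (\<lambda>u. \<Sum>i\<in>I. f i u)"
  by (induction I rule: infinite_finite_induct) (auto intro: polyfun_const polyfun_add)

text \<open>The property holds on the basic Zariski-open neighbourhood of \<open>u0\<close> where a suitable polynomial does
  not vanish.\<close>

definition near :: "'t set \<Rightarrow> ('t \<Rightarrow> complex) \<Rightarrow> (('t \<Rightarrow> complex) \<Rightarrow> bool) \<Rightarrow> bool" where
  "near T u0 P \<longleftrightarrow> (\<exists>f. polyfun T f \<and> f u0 \<noteq> 0 \<and> (\<forall>u. f u \<noteq> 0 \<longrightarrow> P u))"

lemma nearI: "polyfun T f \<Longrightarrow> f u0 \<noteq> 0 \<Longrightarrow> (\<And>u. f u \<noteq> 0 \<Longrightarrow> P u) \<Longrightarrow> near T u0 P"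
  unfolding near_def by blast
lemma near_always: "(\<And>u. P u) \<Longrightarrow> near T u0 P"
  by (rule nearI[of _ "\<lambda>u. 1"]) (auto intro: polyfun_const)
lemma near_mono: "near T u0 P \<Longrightarrow> (\<And>u. P u \<Longrightarrow> Q u) \<Longrightarrow> near T u0 Q"
  unfolding near_def by blast
lemma near_conj:
  assumes "near T u0 P" "near T u0 Q" shows "near T u0 (\<lambda>u. P u \<and> Q u)"
proof -
  obtain f g where "polyfun T f" "f u0 \<noteq> 0" "\<And>u. f u \<noteq> 0 \<Longrightarrow> P u"
    "polyfun T g" "g u0 \<noteq> 0" "\<And>u. g u \<noteq> 0 \<Longrightarrow> Q u"
    using assms unfolding near_def by blast
  then show ?thesis by (intro nearI[of T "\<lambda>u. f u * g u"]) (auto intro: polyfun_mult)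
qed
lemma near_ball:
  "finite I \<Longrightarrow> (\<And>i. i \<in> I \<Longrightarrow> near T u0 (P i)) \<Longrightarrow> near T u0 (\<lambda>u. \<forall>i\<in>I. P i u)"
proof (induction rule: finite_induct)
  case (insert i I)
  then have "near T u0 (\<lambda>u. P i u \<and> (\<forall>i\<in>I. P i u))" by (intro near_conj) auto
  then show ?case by (rule near_mono) auto
qed (auto intro: near_always)

text \<open>A family that spans at \<open>u0\<close> spans near \<open>u0\<close>. The proof is Gaussian elimination with a
  pivot that does not vanish at \<open>u0\<close>; eliminating without division keeps all entries polynomial.\<close>

lemma near_spanning:
  fixes w :: "'j \<Rightarrow> ('t \<Rightarrow> complex) \<Rightarrow> 'm \<Rightarrow> complex"
  assumes "finite M" "finite J" and "\<And>j \<mu>. j \<in> J \<Longrightarrow> \<mu> \<in> M \<Longrightarrow> polyfun T (\<lambda>u. w j u \<mu>)"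
    and "\<And>b. \<exists>c. \<forall>\<mu>\<in>M. (\<Sum>j\<in>J. c j * w j u0 \<mu>) = b \<mu>"
  shows "near T u0 (\<lambda>u. \<forall>b. \<exists>c. \<forall>\<mu>\<in>M. (\<Sum>j\<in>J. c j * w j u \<mu>) = b \<mu>)"
  using assms(1,3,4)
proof (induction M arbitrary: w rule: finite_induct)
  case empty
  then show ?case by (intro near_always) auto
next
  case (insert \<mu>0 M)
  obtain c where c: "(\<Sum>j\<in>J. c j * w j u0 \<mu>0) = 1"
    using insert.prems(2)[of "\<lambda>_. 1"] by auto
  obtain j0 where j0: "j0 \<in> J" "w j0 u0 \<mu>0 \<noteq> 0"
  proof -
    have "\<exists>j\<in>J. c j * w j u0 \<mu>0 \<noteq> 0"
      using c by (metis (mono_tags, lifting) sum.neutral zero_neq_one)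
    then show ?thesis using that by auto
  qed
  \<comment> \<open>One elimination step: coordinate \<open>\<mu>0\<close> becomes 0 and is dropped.\<close>
  define w' where "w' j u \<mu> = w j0 u \<mu>0 * w j u \<mu> - w j u \<mu>0 * w j0 u \<mu>" for j u \<mu>
  have sum_w': "(\<Sum>j\<in>J. c j * w' j u \<mu>) =
      w j0 u \<mu>0 * (\<Sum>j\<in>J. c j * w j u \<mu>) - (\<Sum>j\<in>J. c j * w j u \<mu>0) * w j0 u \<mu>" for c u \<mu>
    by (simp add: w'_def sum_distrib_left sum_distrib_right sum_subtractf algebra_simps)
  have "near T u0 (\<lambda>u. \<forall>b. \<exists>c. \<forall>\<mu>\<in>M. (\<Sum>j\<in>J. c j * w' j u \<mu>) = b \<mu>)"
  proof (rule insert.IH)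
    show "polyfun T (\<lambda>u. w' j u \<mu>)" if "j \<in> J" "\<mu> \<in> M" for j \<mu>
      unfolding w'_def using that j0 insert.prems(1)
      by (intro polyfun_diff polyfun_mult) auto
    fix b
    obtain c where c: "\<forall>\<mu>\<in>insert \<mu>0 M. (\<Sum>j\<in>J. c j * w j u0 \<mu>) =
        (if \<mu> = \<mu>0 then 0 else b \<mu> / w j0 u0 \<mu>0)"
      using insert.prems(2)[of "\<lambda>\<mu>. if \<mu> = \<mu>0 then 0 else b \<mu> / w j0 u0 \<mu>0"] by blast
    have "(\<Sum>j\<in>J. c j * w' j u0 \<mu>) = b \<mu>" if "\<mu> \<in> M" for \<mu>
      unfolding sum_w' using c that insert.hyps j0 by auto
    then show "\<exists>c. \<forall>\<mu>\<in>M. (\<Sum>j\<in>J. c j * w' j u0 \<mu>) = b \<mu>" by blast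
  qed
  moreover have "near T u0 (\<lambda>u. w j0 u \<mu>0 \<noteq> 0)"
    using j0 insert.prems(1) by (intro nearI[of T "\<lambda>u. w j0 u \<mu>0"]) auto
  ultimately have "near T u0 (\<lambda>u. (\<forall>b. \<exists>c. \<forall>\<mu>\<in>M. (\<Sum>j\<in>J. c j * w' j u \<mu>) = b \<mu>) \<and> w j0 u \<mu>0 \<noteq> 0)"
    by (rule near_conj)
  then show ?case
  proof (rule near_mono, safe)
    fix u b
    assume sp: "\<forall>b. \<exists>c. \<forall>\<mu>\<in>M. (\<Sum>j\<in>J. c j * w' j u \<mu>) = b \<mu>" and nz: "w j0 u \<mu>0 \<noteq> 0"
    define t where "t = w j0 u \<mu>0"
    obtain c where c: "\<And>\<mu>. \<mu> \<in> M \<Longrightarrow> (\<Sum>j\<in>J. c j * w' j u \<mu>) = b \<mu> - b \<mu>0 / t * w j0 u \<mu>"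
      using sp[rule_format, of "\<lambda>\<mu>. b \<mu> - b \<mu>0 / t * w j0 u \<mu>"] by blast
    define s where "s = b \<mu>0 / t - (\<Sum>j\<in>J. c j * w j u \<mu>0)"
    define d where "d j = t * c j + (if j = j0 then s else 0)" for j
    have "(\<Sum>j\<in>J. d j * w j u \<mu>) = t * (\<Sum>j\<in>J. c j * w j u \<mu>) + s * w j0 u \<mu>" for \<mu>
    proof -
      have "(\<Sum>j\<in>J. d j * w j u \<mu>) = (\<Sum>j\<in>J. t * (c j * w j u \<mu>) + (if j = j0 then s * w j0 u \<mu> else 0))"
        by (intro sum.cong) (auto simp: d_def algebra_simps)
      then show ?thesis using j0 assms(2) by (simp add: sum.distrib sum_distrib_left)
    qed
    moreover have "t * (\<Sum>j\<in>J. c j * w j u \<mu>) + s * w j0 u \<mu> = b \<mu>" if "\<mu> \<in> insert \<mu>0 M" for \<mu>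
    proof (cases "\<mu> = \<mu>0")
      case True
      then show ?thesis using nz by (simp add: s_def t_def field_simps)
    next
      case False
      then show ?thesis using c[of \<mu>] that sum_w'[of c u \<mu>] by (simp add: s_def t_def algebra_simps)
    qed
    ultimately show "\<exists>c. \<forall>\<mu>\<in>insert \<mu>0 M. (\<Sum>j\<in>J. c j * w j u \<mu>) = b \<mu>" by metis
  qed
qed

text \<open>Restricted to the line through two points where they do not vanish, the polynomials have only
  finitely many zeros.\<close>

lemma zariski_open_Int:
  assumes "zariski_open T U" "zariski_open T U'" "U \<noteq> {}" "U' \<noteq> {}"
  shows "U \<inter> U' \<noteq> {}"
proof -
  obtain a p where a: "a \<in> T \<rightarrow>\<^sub>E UNIV" "p \<in> mpolys T" "meval a p \<noteq> 0"
    and U: "\<And>u. u \<in> T \<rightarrow>\<^sub>E UNIV \<Longrightarrow> meval u p \<noteq> 0 \<Longrightarrow> u \<in> U"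
    using assms(1,3) unfolding zariski_open_def by blast
  obtain b q where b: "b \<in> T \<rightarrow>\<^sub>E UNIV" "q \<in> mpolys T" "meval b q \<noteq> 0"
    and U': "\<And>u. u \<in> T \<rightarrow>\<^sub>E UNIV \<Longrightarrow> meval u q \<noteq> 0 \<Longrightarrow> u \<in> U'"
    using assms(2,4) unfolding zariski_open_def by blast
  define line where "line v = [:a v, b v - a v:]" for v
  define P where "P = peval (\<lambda>c. [:c:]) line p"
  define Q where "Q = peval (\<lambda>c. [:c:]) line q"
  have "poly P 0 \<noteq> 0" "poly Q 1 \<noteq> 0"
    using a b by (auto simp: P_def Q_def line_def poly_peval)
  then have "P * Q \<noteq> 0" by auto
  then obtain t where t: "poly (P * Q) t \<noteq> 0"
    using poly_all_0_iff_0 by blast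
  define u where "u = (\<lambda>v\<in>T. poly (line v) t)"
  have "meval u p = poly P t" "meval u q = poly Q t"
    using a(2) b(2) by (auto simp: P_def Q_def poly_peval u_def intro!: meval_cong)
  then have "u \<in> U" "u \<in> U'" using t by (auto simp: u_def intro!: U U')
  then show ?thesis by blast
qed

lemma near_zariski_open:
  assumes "near T u0 P" "u0 \<in> T \<rightarrow>\<^sub>E UNIV"
  obtains U where "zariski_open T U" "U \<noteq> {}" "\<And>u. u \<in> U \<Longrightarrow> P u"
proof -
  obtain f where f: "polyfun T f" "f u0 \<noteq> 0" "\<And>u. f u \<noteq> 0 \<Longrightarrow> P u"
    using assms(1) unfolding near_def by blast
  obtain p where p: "p \<in> mpolys T" "\<And>u. f u = meval u p" using f(1) unfolding polyfun_def by blast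
  show ?thesis
  proof (rule that)
    show "zariski_open T {u \<in> T \<rightarrow>\<^sub>E UNIV. meval u p \<noteq> 0}"
      unfolding zariski_open_def using p(1) by (intro exI[of _ "{p}"]) auto
  qed (use f p assms(2) in auto)
qed

section \<open>Vandermonde systems\<close>

lemma vandermonde_inj:
  fixes c :: "nat \<Rightarrow> complex"
  assumes "finite A" "card A = n" "\<And>b. b \<in> A \<Longrightarrow> (\<Sum>j<n. c j * b ^ j) = 0" "j < n"
  shows "c j = 0"
proof -
  define p where "p = (\<Sum>j<n. monom (c j) j)"
  have coeff_p: "coeff p i = (if i < n then c i else 0)" for i
    by (simp add: p_def coeff_sum if_distrib sum.delta cong: if_cong)
  have "poly p b = 0" if "b \<in> A" for b
    using assms(3)[OF that] by (simp add: p_def poly_sum poly_monom)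
  have "p = 0"
  proof (rule ccontr)
    assume "p \<noteq> 0"
    have "card A \<le> card {b. poly p b = 0}"
      using \<open>p \<noteq> 0\<close> \<open>\<And>b. b \<in> A \<Longrightarrow> poly p b = 0\<close> by (intro card_mono poly_roots_finite) auto
    also have "\<dots> \<le> degree p" using \<open>p \<noteq> 0\<close> by (rule card_poly_roots_bound)
    also have "degree p < n"
    proof -
      have "coeff p (degree p) \<noteq> 0" using \<open>p \<noteq> 0\<close> by simp
      then show ?thesis by (auto simp: coeff_p split: if_splits)
    qed
    finally show False using assms(2) by simp
  qed
  then show ?thesis using coeff_p[of j] assms(4) by simp
qed

lemma lagrange_basis:
  fixes b :: complex
  assumes "finite A" "b \<in> A"
  obtains c where "\<And>b'. b' \<in> A \<Longrightarrow> (\<Sum>j<card A. c j * b' ^ j) = (if b' = b then 1 else 0)"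
proof -
  define p where "p = (\<Prod>b'\<in>A - {b}. smult (inverse (b - b')) [:- b', 1:])"
  have "degree p \<le> (\<Sum>b'\<in>A - {b}. degree (smult (inverse (b - b')) [:- b', 1:]))"
    using degree_prod_sum_le[of "A - {b}" "\<lambda>b'. smult (inverse (b - b')) [:- b', 1:]"] assms(1)
    unfolding p_def by (simp only: o_def finite_Diff)
  also have "\<dots> \<le> (\<Sum>b'\<in>A - {b}. 1)" by (intro sum_mono) simp
  also have "\<dots> < card A" using card_Diff1_less[OF assms] by simp
  finally have deg: "degree p < card A" .
  have "(\<Sum>j<card A. coeff p j * b' ^ j) = poly p b'" for b'
    unfolding poly_altdef using deg
    by (intro sum.mono_neutral_right) (auto simp: coeff_eq_0)
  moreover have "poly p b' = (if b' = b then 1 else 0)" if "b' \<in> A" for b'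
  proof -
    have "poly p b' = (\<Prod>b''\<in>A - {b}. (b' - b'') / (b - b''))"
      by (simp add: p_def poly_prod divide_inverse algebra_simps)
    also have "\<dots> = (if b' = b then 1 else 0)"
      using assms that by (auto intro!: prod.neutral)
    finally show ?thesis .
  qed
  ultimately show ?thesis using that by metis
qed

lemma vandermonde_surj:
  fixes y :: "complex \<Rightarrow> complex"
  assumes "finite A"
  obtains c where "\<And>b. b \<in> A \<Longrightarrow> (\<Sum>j<card A. c j * b ^ j) = y b"
proof -
  have "\<exists>c. \<forall>b'\<in>A. (\<Sum>j<card A. c j * b' ^ j) = (if b' = b then 1 else 0)" if "b \<in> A" for b
    using lagrange_basis[OF assms that] by metis
  then obtain c where c: "\<And>b b'. b \<in> A \<Longrightarrow> b' \<in> A \<Longrightarrow>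
      (\<Sum>j<card A. c b j * b' ^ j) = (if b' = b then 1 else 0)" by metis
  show ?thesis
  proof (rule that[of "\<lambda>j. \<Sum>b\<in>A. y b * c b j"])
    fix b' assume b': "b' \<in> A"
    have "(\<Sum>j<card A. (\<Sum>b\<in>A. y b * c b j) * b' ^ j) = (\<Sum>b\<in>A. y b * (\<Sum>j<card A. c b j * b' ^ j))"
      unfolding sum_distrib_left sum_distrib_right by (subst sum.swap) (simp add: mult_ac)
    also have "\<dots> = (\<Sum>b\<in>A. if b = b' then y b else 0)"
      using b' by (intro sum.cong) (auto simp: c)
    also have "\<dots> = y b'" using b' assms by simp
    finally show "(\<Sum>j<card A. (\<Sum>b\<in>A. y b * c b j) * b' ^ j) = y b'" .
  qed
qed

lemma vandermonde_dual:
  assumes "finite A" "t < card A"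
  obtains c :: "complex \<Rightarrow> complex"
    where "\<And>s. s < card A \<Longrightarrow> (\<Sum>b\<in>A. c b * b ^ s) = (if s = t then 1 else 0)"
proof -
  have "\<exists>c. \<forall>b'\<in>A. (\<Sum>j<card A. c j * b' ^ j) = (if b' = b then 1 else 0)" if "b \<in> A" for b
    using lagrange_basis[OF assms(1) that] by metis
  then obtain c where c: "\<And>b b'. b \<in> A \<Longrightarrow> b' \<in> A \<Longrightarrow>
      (\<Sum>j<card A. c b j * b' ^ j) = (if b' = b then 1 else 0)" by metis
  show ?thesis
  proof (rule that[of "\<lambda>b. c b t"])
    fix s assume s: "s < card A"
    define d where "d j = (\<Sum>b\<in>A. b ^ s * c b j) - (if j = s then 1 else 0)" for j
    have "d t = 0"
    proof (rule vandermonde_inj[OF assms(1) refl _ assms(2)])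
      fix b' assume b': "b' \<in> A"
      have "(\<Sum>j<card A. d j * b' ^ j) =
          (\<Sum>j<card A. (\<Sum>b\<in>A. b ^ s * c b j) * b' ^ j) - (\<Sum>j<card A. if j = s then b' ^ s else 0)"
        unfolding sum_subtractf[symmetric] by (intro sum.cong) (auto simp: d_def algebra_simps)
      also have "(\<Sum>j<card A. (\<Sum>b\<in>A. b ^ s * c b j) * b' ^ j) = (\<Sum>b\<in>A. b ^ s * (\<Sum>j<card A. c b j * b' ^ j))"
        unfolding sum_distrib_left sum_distrib_right by (subst sum.swap) (simp add: mult_ac)
      also have "\<dots> = (\<Sum>b\<in>A. if b = b' then b' ^ s else 0)"
        using b' by (intro sum.cong) (auto simp: c)
      also have "\<dots> = b' ^ s" using b' assms by simp
      finally show "(\<Sum>j<card A. d j * b' ^ j) = 0" using s by simp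
    qed
    then show "(\<Sum>b\<in>A. c b t * b ^ s) = (if s = t then 1 else 0)"
      by (auto simp: d_def mult.commute split: if_splits)
  qed
qed

section \<open>Polynomials of bounded degree in each group of variables\<close>

type_synonym gpoly = "(nat \<times> nat, complex) mpoly"

locale strategy_spaces =
  fixes N :: nat and k :: "nat \<Rightarrow> nat"
begin

abbreviation V where "V \<equiv> slots N k"

abbreviation inc :: "(nat \<Rightarrow> nat) \<Rightarrow> nat \<Rightarrow> nat \<Rightarrow> nat" where "inc n q \<equiv> n(q := Suc (n q))"

abbreviation dec :: "(nat \<Rightarrow> nat) \<Rightarrow> nat \<Rightarrow> nat \<Rightarrow> nat" where "dec D q \<equiv> D(q := D q - 1)"

definition grade :: "(nat \<times> nat \<Rightarrow>\<^sub>0 nat) \<Rightarrow> nat \<Rightarrow> nat" where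
  "grade \<mu> q = (\<Sum>t\<in>{1..k q}. lkp \<mu> (q, t))"

text \<open>Exponents in the variables \<open>(q, t)\<close> with \<open>t > n q\<close>, those that remain after the first \<open>n q\<close> variables
  of each group \<open>q\<close> have been eliminated; \<open>D\<close> bounds the degree in each group.\<close>

definition Mon :: "(nat \<Rightarrow> nat) \<Rightarrow> (nat \<Rightarrow> nat) \<Rightarrow> (nat \<times> nat \<Rightarrow>\<^sub>0 nat) set" where
  "Mon n D = {\<mu>. keys \<mu> \<subseteq> (SIGMA q:{1..N}. {n q<..k q}) \<and>
     (\<forall>q\<in>{1..N}. grade \<mu> q \<le> D q)}"

definition P :: "(nat \<Rightarrow> nat) \<Rightarrow> gpoly set" where
  "P D = supp_in (Mon (\<lambda>_. 0) D)"

lemma grade_add: "grade (\<mu> + \<nu>) q = grade \<mu> q + grade \<nu> q"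
  by (simp add: grade_def lookup_add sum.distrib)

lemma grade_0 [simp]: "grade 0 q = 0" by (simp add: grade_def)

lemma grade_single:
  "t \<in> {1..k q} \<Longrightarrow> grade (single (q, t) m) q' = (if q' = q then m else 0)"
  by (auto simp: grade_def lookup_single when_def sum.delta')

lemma split_monomial:
  fixes \<mu> :: "'v \<Rightarrow>\<^sub>0 nat"
  assumes "lkp \<mu> v \<noteq> 0"
  obtains \<nu> where "\<mu> = single v 1 + \<nu>" "keys \<nu> \<subseteq> keys \<mu>"
proof
  show "\<mu> = single v 1 + (\<mu> - single v 1)"
    using assms by (intro poly_mapping_eqI) (auto simp: lookup_add lookup_minus lookup_single when_def)
  show "keys (\<mu> - single v 1) \<subseteq> keys \<mu>"
    by (auto simp: in_keys_iff lookup_minus)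
qed

lemma split_Mon:
  assumes "\<mu> \<in> Mon n D" "t \<in> {1..k q}" "lkp \<mu> (q, t) \<noteq> 0"
  obtains \<nu> where "\<mu> = single (q, t) 1 + \<nu>" "keys \<nu> \<subseteq> keys \<mu>" "\<nu> \<in> Mon n (dec D q)"
proof -
  obtain \<nu> where \<nu>: "\<mu> = single (q, t) 1 + \<nu>" "keys \<nu> \<subseteq> keys \<mu>"
    using split_monomial[OF assms(3)] .
  have "grade \<nu> q' \<le> (dec D q) q'" if "q' \<in> {1..N}" for q'
  proof -
    have "grade \<mu> q' = (if q' = q then 1 else 0) + grade \<nu> q'"
      using grade_single[OF assms(2), of 1 q'] by (simp add: \<nu>(1) grade_add)
    moreover have "grade \<mu> q' \<le> D q'" using assms(1) that by (simp add: Mon_def)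
    ultimately show ?thesis by (auto split: if_splits)
  qed
  then have "\<nu> \<in> Mon n (dec D q)" using assms(1) \<nu>(2) by (auto simp: Mon_def)
  then show ?thesis using \<nu> that by blast
qed

lemma zero_in_Mon [simp]: "0 \<in> Mon n D" by (simp add: Mon_def)

lemma Mon_mono: "(\<And>q. q \<in> {1..N} \<Longrightarrow> D q \<le> D' q) \<Longrightarrow> Mon n D \<subseteq> Mon n D'"
  unfolding Mon_def by (fastforce intro: order_trans)

lemma Mon_antimono: "(\<And>q. n q \<le> n' q) \<Longrightarrow> Mon n' D \<subseteq> Mon n D"
proof -
  assume n: "\<And>q. n q \<le> n' q"
  have "(SIGMA q:{1..N}. {n' q<..k q}) \<subseteq> (SIGMA q:{1..N}. {n q<..k q})"
    by (intro Sigma_mono) (auto intro: le_less_trans[OF n])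
  then show ?thesis unfolding Mon_def by blast
qed

lemma lookup_le_grade: "t \<in> {1..k q} \<Longrightarrow> lkp \<mu> (q, t) \<le> grade \<mu> q"
  unfolding grade_def by (rule member_le_sum[where f = "\<lambda>t. lkp \<mu> (q, t)"]) auto

lemma finite_Mon: "finite (Mon n D)"
proof -
  let ?V = "SIGMA q:{1..N}. {n q<..k q}"
  have V: "finite ?V" by auto
  let ?R = "\<lambda>\<mu>. restrict (lkp \<mu>) ?V"
  have "inj_on ?R (Mon n D)"
  proof (intro inj_onI poly_mapping_eqI)
    fix \<mu> \<nu> v assume \<mu>: "\<mu> \<in> Mon n D" "\<nu> \<in> Mon n D" "?R \<mu> = ?R \<nu>"
    show "lkp \<mu> v = lkp \<nu> v"
    proof (cases "v \<in> ?V")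
      case True
      then show ?thesis using fun_cong[OF \<mu>(3), of v] by simp
    next
      case False
      then have "v \<notin> keys \<mu>" "v \<notin> keys \<nu>"
        using \<mu> unfolding Mon_def by blast+
      then show ?thesis by (simp add: in_keys_iff)
    qed
  qed
  moreover have "?R ` Mon n D \<subseteq> PiE ?V (\<lambda>v. {..D (fst v)})"
  proof (intro image_subsetI PiE_I)
    fix \<mu> v assume \<mu>: "\<mu> \<in> Mon n D" and v: "v \<in> ?V"
    obtain q t where qt: "v = (q, t)" by force
    have "lkp \<mu> (q, t) \<le> grade \<mu> q" using v qt by (intro lookup_le_grade) auto
    also have "grade \<mu> q \<le> D q" using \<mu> v qt by (simp add: Mon_def)
    finally show "?R \<mu> v \<in> {..D (fst v)}" using v qt by simp
  qed simp
  moreover have "finite (PiE ?V (\<lambda>v. {..D (fst v)}))" using V by (intro finite_PiE) auto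
  ultimately show ?thesis by (meson finite_subset inj_on_finite)
qed

lemma Mon_add: "\<mu> \<in> Mon n D \<Longrightarrow> \<nu> \<in> Mon n D' \<Longrightarrow> \<mu> + \<nu> \<in> Mon n (\<lambda>q. D q + D' q)"
  using keys_add[of \<mu> \<nu>] unfolding Mon_def mem_Collect_eq grade_add
  by (blast intro: add_mono)

lemma subspace_P: "mp.subspace (P D)" unfolding P_def by (rule subspace_supp_in)

lemma P_mono: "(\<And>q. q \<in> {1..N} \<Longrightarrow> D q \<le> D' q) \<Longrightarrow> P D \<subseteq> P D'"
  unfolding P_def by (intro supp_in_mono Mon_mono)

lemma P_mult:
  assumes "p \<in> P D" "h \<in> P D'" "\<And>q. q \<in> {1..N} \<Longrightarrow> D q + D' q \<le> D'' q"
  shows "p * h \<in> P D''"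
  using assms(1,2) unfolding P_def
proof (rule supp_in_mult)
  fix a b assume "a \<in> Mon (\<lambda>_. 0) D" "b \<in> Mon (\<lambda>_. 0) D'"
  then have "a + b \<in> Mon (\<lambda>_. 0) (\<lambda>q. D q + D' q)" by (rule Mon_add)
  then show "a + b \<in> Mon (\<lambda>_. 0) D''" using Mon_mono[of "\<lambda>q. D q + D' q" D'', OF assms(3)] by blast
qed

lemma Const_in_P [simp]: "Const c \<in> P D"
  unfolding P_def Const_def by (rule supp_in_single) simp

lemma one_in_P [simp]: "1 \<in> P D" using Const_in_P[of 1 D] by simp

lemma zero_in_P [simp]: "0 \<in> P D" using Const_in_P[of 0 D] by simp

lemma Var_in_P:
  assumes "(q, t) \<in> V" "D q \<ge> 1" shows "Var (q, t) \<in> P D"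
  unfolding P_def Var_def using assms
  by (intro supp_in_single) (auto simp: Mon_def slots_def grade_single)

lemma mon_in_P: "\<mu> \<in> Mon n D \<Longrightarrow> mon \<mu> \<in> P D"
  unfolding P_def by (rule supp_in_single) (use Mon_antimono[of "\<lambda>_. 0" n D] in auto)

lemma P_eq_span: "P D = mp.span (mon ` Mon (\<lambda>_. 0) D)"
  unfolding P_def by (rule supp_in_eq_span)

lemma dim_P: "mp.dim (P D) = card (Mon (\<lambda>_. 0) D)"
  unfolding P_def by (rule dim_supp_in[OF finite_Mon])

lemma P_le_mpolys: "P D \<subseteq> mpolys V"
  unfolding P_def mpolys_eq_supp_in by (rule supp_in_mono) (auto simp: Mon_def slots_def)

lemma mpolys_in_P:
  assumes "p \<in> mpolys V"
  obtains D0 where "\<And>D. (\<And>q. D q \<ge> D0) \<Longrightarrow> p \<in> P D"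
proof
  let ?S = "(\<lambda>(\<mu>, q). grade \<mu> q) ` (keys p \<times> {1..N})"
  have fin: "finite ?S" by simp
  fix D :: "nat \<Rightarrow> nat" assume D: "\<And>q. D q \<ge> Max ?S"
  have "\<mu> \<in> Mon (\<lambda>_. 0) D" if "\<mu> \<in> keys p" for \<mu>
  proof -
    have "grade \<mu> q \<le> D q" if "q \<in> {1..N}" for q
    proof -
      have "grade \<mu> q \<in> ?S" using that \<open>\<mu> \<in> keys p\<close> by (intro image_eqI[of _ _ "(\<mu>, q)"]) auto
      from Max_ge[OF fin this] D[of q] show ?thesis by simp
    qed
    moreover have "keys \<mu> \<subseteq> V" using assms that by (auto simp: mpolys_def)
    ultimately show ?thesis by (auto simp: Mon_def slots_def Suc_le_eq)
  qed
  then show "p \<in> P D" by (auto simp: P_def supp_in_def)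
qed

section \<open>Truncated ideals\<close>

definition degs :: "nat list \<Rightarrow> (nat \<Rightarrow> nat) \<Rightarrow> nat \<Rightarrow> nat" where
  "degs \<delta> D q = D q - count_list \<delta> q"

text \<open>In the system, an equation \<open>f\<close> comes with a list \<open>\<delta>\<close> in which each group occurs at least as
  often as the degree of \<open>f\<close> in it. The condition on the multipliers \<open>h\<close> keeps \<open>f * h\<close> in \<open>P D\<close>.\<close>

fun I :: "(gpoly \<times> nat list) list \<Rightarrow> (nat \<Rightarrow> nat) \<Rightarrow> gpoly set" where
  "I [] D = {0}"
| "I ((f, \<delta>) # sys) D = {f * h + g | h g. h \<in> P (degs \<delta> D) \<and> g \<in> I sys D}"

definition dominated :: "(gpoly \<times> nat list) list \<Rightarrow> (nat \<Rightarrow> nat) \<Rightarrow> bool" where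
  "dominated sys D \<longleftrightarrow> (\<forall>(f, \<delta>)\<in>set sys. \<forall>q. count_list \<delta> q \<le> D q)"

definition wf_sys :: "(gpoly \<times> nat list) list \<Rightarrow> bool" where
  "wf_sys sys \<longleftrightarrow> (\<forall>(f, \<delta>)\<in>set sys. f \<in> P (count_list \<delta>))"

lemma subspace_I: "mp.subspace (I sys D)"
proof (induction sys)
  case (Cons a sys)
  obtain f \<delta> where a: "a = (f, \<delta>)" by force
  have "{f * h + g | h g. h \<in> P (degs \<delta> D) \<and> g \<in> I sys D} =
     {x + y | x y. x \<in> (\<lambda>h. f * h) ` P (degs \<delta> D) \<and> y \<in> I sys D}" by auto
  moreover have "mp.subspace ((\<lambda>h. f * h) ` P (degs \<delta> D))"
  proof (intro mp.subspaceI)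
    show "0 \<in> (\<lambda>h. f * h) ` P (degs \<delta> D)" by (intro image_eqI[of _ _ 0]) auto
    fix x y assume "x \<in> (\<lambda>h. f * h) ` P (degs \<delta> D)" "y \<in> (\<lambda>h. f * h) ` P (degs \<delta> D)"
    then show "x + y \<in> (\<lambda>h. f * h) ` P (degs \<delta> D)"
      by (auto simp flip: distrib_left intro!: imageI mp.subspace_add[OF subspace_P])
  next
    fix c x assume "x \<in> (\<lambda>h. f * h) ` P (degs \<delta> D)"
    then obtain h where "h \<in> P (degs \<delta> D)" "x = f * h" by auto
    then show "Const c * x \<in> (\<lambda>h. f * h) ` P (degs \<delta> D)"
      by (intro image_eqI[of _ _ "Const c * h"] mp.subspace_scale[OF subspace_P]) (auto simp: mult_ac)
  qed
  ultimately show ?case using mp.subspace_sums[OF _ Cons.IH] by (simp add: a)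
qed (simp add: mp.subspace_single_0)

lemmas zero_in_I [simp] = mp.subspace_0[OF subspace_I]
lemmas I_add = mp.subspace_add[OF subspace_I]
lemmas I_diff = mp.subspace_diff[OF subspace_I]
lemmas I_scale = mp.subspace_scale[OF subspace_I]
lemmas I_sum = mp.subspace_sum[OF subspace_I]
lemmas P_add = mp.subspace_add[OF subspace_P]
lemmas P_diff = mp.subspace_diff[OF subspace_P]
lemmas P_scale = mp.subspace_scale[OF subspace_P]
lemmas P_sum = mp.subspace_sum[OF subspace_P]

lemma I_memberI: "(f, \<delta>) \<in> set sys \<Longrightarrow> h \<in> P (degs \<delta> D) \<Longrightarrow> f * h \<in> I sys D"
proof (induction sys)
  case (Cons a sys)
  obtain f' \<delta>' where a: "a = (f', \<delta>')" by force
  show ?case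
  proof (cases "(f, \<delta>) = a")
    case True
    then have "f * h = f' * h + 0 \<and> h \<in> P (degs \<delta>' D) \<and> 0 \<in> I sys D" using Cons.prems a by simp
    then show ?thesis unfolding a I.simps by blast
  next
    case False
    then have "f * h \<in> I sys D" using Cons by auto
    then have "f * h = f' * 0 + f * h \<and> 0 \<in> P (degs \<delta>' D) \<and> f * h \<in> I sys D" by simp
    then show ?thesis unfolding a I.simps by blast
  qed
qed simp

lemma I_least:
  assumes "mp.subspace W" "\<And>f \<delta> h. (f, \<delta>) \<in> set sys \<Longrightarrow> h \<in> P (degs \<delta> D) \<Longrightarrow> f * h \<in> W"
  shows "I sys D \<subseteq> W"
  using assms(2)
proof (induction sys)
  case (Cons a sys)
  obtain f \<delta> where a: "a = (f, \<delta>)" by force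
  have "I sys D \<subseteq> W" by (rule Cons.IH) (use Cons.prems in auto)
  moreover have "f * h \<in> W" if "h \<in> P (degs \<delta> D)" for h using Cons.prems a that by auto
  ultimately show ?case by (auto simp: a intro!: mp.subspace_add[OF assms(1)])
qed (simp add: mp.subspace_0[OF assms(1)])

lemma I_cong_set: "set sys \<subseteq> set sys' \<Longrightarrow> I sys D \<subseteq> I sys' D"
  by (rule I_least[OF subspace_I]) (auto intro: I_memberI)

lemma I_mono: "(\<And>q. q \<in> {1..N} \<Longrightarrow> D q \<le> D' q) \<Longrightarrow> I sys D \<subseteq> I sys D'"
proof (rule I_least[OF subspace_I])
  fix f \<delta> h assume D: "\<And>q. q \<in> {1..N} \<Longrightarrow> D q \<le> D' q" and "(f, \<delta>) \<in> set sys" "h \<in> P (degs \<delta> D)"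
  moreover have "P (degs \<delta> D) \<subseteq> P (degs \<delta> D')" by (rule P_mono) (auto simp: degs_def intro!: diff_le_mono D)
  ultimately show "f * h \<in> I sys D'" by (auto intro: I_memberI)
qed

lemma I_subset_P:
  assumes "wf_sys sys" "dominated sys D" shows "I sys D \<subseteq> P D"
proof (rule I_least[OF subspace_P])
  fix f \<delta> h assume *: "(f, \<delta>) \<in> set sys" "h \<in> P (degs \<delta> D)"
  then have "f \<in> P (count_list \<delta>)" using assms by (auto simp: wf_sys_def)
  then show "f * h \<in> P D"
    by (rule P_mult[OF _ *(2)]) (use * assms(2) in \<open>auto simp: dominated_def degs_def\<close>)
qed

lemma subspace_mult_preimage:
  assumes "mp.subspace W" shows "mp.subspace {p. h * p \<in> W}"
proof (intro mp.subspaceI)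
  fix c x assume "x \<in> {p. h * p \<in> W}"
  then have "Const c * (h * x) \<in> W" by (intro mp.subspace_scale[OF assms]) auto
  then show "Const c * x \<in> {p. h * p \<in> W}" by (simp add: mult.left_commute)
qed (use assms in \<open>auto simp: mp.subspace_0 mp.subspace_add distrib_left\<close>)

lemma I_mult:
  assumes "h \<in> P D'" "g \<in> I sys D" "dominated sys D" "\<And>q. q \<in> {1..N} \<Longrightarrow> D q + D' q \<le> D'' q"
  shows "h * g \<in> I sys D''"
proof -
  have "I sys D \<subseteq> {p. h * p \<in> I sys D''}"
  proof (rule I_least[OF subspace_mult_preimage[OF subspace_I]], rule CollectI)
    fix f \<delta> h' assume *: "(f, \<delta>) \<in> set sys" "h' \<in> P (degs \<delta> D)"
    have "count_list \<delta> q \<le> D q" for q using *(1) assms(3) by (auto simp: dominated_def)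
    have "h' * h \<in> P (degs \<delta> D'')"
    proof (rule P_mult[OF *(2) assms(1)])
      fix q assume "q \<in> {1..N}"
      from assms(4)[OF this] \<open>count_list \<delta> q \<le> D q\<close> show "degs \<delta> D q + D' q \<le> degs \<delta> D'' q"
        by (simp add: degs_def)
    qed
    then have "f * (h' * h) \<in> I sys D''" using *(1) by (intro I_memberI)
    then show "h * (f * h') \<in> I sys D''" by (simp add: mult_ac)
  qed
  then show ?thesis using assms(2) by auto
qed

end

context strategy_spaces
begin

section \<open>The Hilbert function of a generic system\<close>

text \<open>For large \<open>D\<close>, the codimension in \<open>P D\<close> of the ideal of products of linear forms in general position, where \<open>fs\<close>
  lists the groups of the factors of each product and \<open>n q\<close> further linear forms in group \<open>q\<close> are
  present. Modulo \<open>L * f\<close> with \<open>L\<close> linear in group \<open>q\<close>, the space is an extension of the quotient by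
  \<open>L\<close> by the multiples of \<open>L\<close>, that is, by the quotient by \<open>f\<close> in degrees reduced by one in \<open>q\<close>.\<close>

fun G :: "(nat \<Rightarrow> nat) \<Rightarrow> nat list list \<Rightarrow> (nat \<Rightarrow> nat) \<Rightarrow> nat" where
  "G n [] D = (if \<forall>q\<in>{1..N}. n q \<le> k q then card (Mon n D) else 0)"
| "G n ([] # fs) D = 0"
| "G n ((q # \<delta>) # fs) D = G (inc n q) fs D + G n (\<delta> # fs) (dec D q)"

text \<open>Degrees so large that no subtraction in the recursion for \<open>G\<close> is truncated at 0.\<close>

definition margin :: "nat list list \<Rightarrow> (nat \<Rightarrow> nat) \<Rightarrow> bool" where
  "margin fs D \<longleftrightarrow> (\<forall>q. D q > count_list (concat fs) q)"

text \<open>Monomials either avoid the variable \<open>(q, n q + 1)\<close> or are multiples of it.\<close>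

lemma card_Mon_split:
  assumes q: "q \<in> {1..N}" "n q < k q" "D q \<ge> 1"
  shows "card (Mon n D) = card (Mon (inc n q) D) + card (Mon n (dec D q))"
proof -
  let ?s = "single (q, Suc (n q)) (1::nat)"
  let ?A = "Mon (inc n q) D" and ?B = "(\<lambda>\<mu>. \<mu> + ?s) ` Mon n (dec D q)"
  have gs: "grade ?s q' = (if q' = q then 1 else 0)" for q'
    by (rule grade_single) (use q in auto)
  have "Mon n D = ?A \<union> ?B"
  proof (intro equalityI subsetI)
    fix \<mu> assume \<mu>: "\<mu> \<in> Mon n D"
    show "\<mu> \<in> ?A \<union> ?B"
    proof (cases "lkp \<mu> (q, Suc (n q)) = 0")
      case True
      have "v \<in> (SIGMA q':{1..N}. {(inc n q) q'<..k q'})" if "v \<in> keys \<mu>" for v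
      proof -
        have "v \<noteq> (q, Suc (n q))" using that True by (auto simp: in_keys_iff)
        moreover have "v \<in> (SIGMA q:{1..N}. {n q<..k q})" using \<mu> that by (auto simp: Mon_def)
        ultimately show ?thesis by (cases v) (auto simp: Suc_lessI)
      qed
      then have "\<mu> \<in> ?A" using \<mu> by (auto simp: Mon_def)
      then show ?thesis ..
    next
      case False
      then obtain \<nu> where "\<mu> = ?s + \<nu>" "\<nu> \<in> Mon n (dec D q)"
        using split_Mon[OF \<mu>, of "Suc (n q)" q] q by auto
      then show ?thesis by (auto simp: add.commute)
    qed
  next
    fix \<mu> assume "\<mu> \<in> ?A \<union> ?B"
    then show "\<mu> \<in> Mon n D"
    proof
      assume "\<mu> \<in> ?A"
      moreover have "?A \<subseteq> Mon n D" by (rule Mon_antimono) auto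
      ultimately show ?thesis by blast
    next
      assume "\<mu> \<in> ?B"
      then obtain \<nu> where \<nu>: "\<nu> \<in> Mon n (dec D q)" "\<mu> = \<nu> + ?s" by blast
      have "keys \<mu> \<subseteq> (SIGMA q:{1..N}. {n q<..k q})"
        using keys_add[of \<nu> ?s] \<nu> q by (auto simp: Mon_def)
      moreover have "grade \<mu> q' \<le> D q'" if "q' \<in> {1..N}" for q'
      proof -
        have "grade \<nu> q' \<le> (dec D q) q'" using \<nu>(1) that by (auto simp: Mon_def)
        then show ?thesis using q(3) unfolding \<nu>(2) grade_add gs by (auto split: if_splits)
      qed
      ultimately show ?thesis by (auto simp: Mon_def)
    qed
  qed
  moreover have "?A \<inter> ?B = {}"
  proof -
    have "\<mu> \<notin> ?B" if "\<mu> \<in> ?A" for \<mu>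
    proof
      assume "\<mu> \<in> ?B"
      then have "lkp \<mu> (q, Suc (n q)) \<noteq> 0" by (auto simp: lookup_add)
      then have "(q, Suc (n q)) \<in> keys \<mu>" by (simp add: in_keys_iff)
      then show False using that by (auto simp: Mon_def)
    qed
    then show ?thesis by blast
  qed
  moreover have "card ?B = card (Mon n (dec D q))"
    by (rule card_image) (auto simp: inj_on_def)
  ultimately show ?thesis by (simp add: card_Un_disjoint finite_Mon)
qed

lemma margin_Cons: "margin (\<delta> # fs) D \<Longrightarrow> margin fs D"
  by (auto simp: margin_def intro: le_less_trans[rotated])

lemma margin_tl:
  assumes "margin ((q # \<delta>) # fs) D" shows "margin (\<delta> # fs) (dec D q)"
  unfolding margin_def
proof
  fix q'
  have "D q' > count_list (concat ((q # \<delta>) # fs)) q'" using assms by (simp add: margin_def)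
  then show "(dec D q) q' > count_list (concat (\<delta> # fs)) q'"
    by (auto split: if_splits)
qed

lemma margin_pos: "margin fs D \<Longrightarrow> D q \<ge> 1"
  unfolding margin_def by (metis Suc_leI One_nat_def bot_nat_0.not_eq_extremum less_nat_zero_code)

text \<open>A linear form is not a zero divisor modulo the other forms. In terms of \<open>G\<close> this holds at the leaves
  of the recursion by splitting monomials and is inherited by sums.\<close>

lemma G_difference:
  assumes "q \<in> {1..N}" "margin fs D" "set (concat fs) \<subseteq> {1..N}"
  shows "G n fs D = G (inc n q) fs D + G n fs (dec D q)"
  using assms
proof (induction n fs D rule: G.induct)
  case (1 n D)
  have Dq: "D q \<ge> 1" using margin_pos 1 by blast
  show ?case
  proof (cases "\<forall>q\<in>{1..N}. n q \<le> k q")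
    case le: True
    show ?thesis
    proof (cases "n q < k q")
      case True
      then have "\<forall>q'\<in>{1..N}. (inc n q) q' \<le> k q'" using le by auto
      then show ?thesis using le card_Mon_split[of q n D, OF \<open>q \<in> {1..N}\<close> True Dq] by (simp add: fun_upd_def)
    next
      case False
      then have nq: "n q = k q" using le \<open>q \<in> {1..N}\<close> by (meson le_neq_implies_less)
      then have "\<not> (\<forall>q'\<in>{1..N}. (inc n q) q' \<le> k q')" using \<open>q \<in> {1..N}\<close> by auto
      moreover have "Mon n D = Mon n (dec D q)"
      proof -
        have "grade \<mu> q = 0" if "keys \<mu> \<subseteq> (SIGMA q:{1..N}. {n q<..k q})" for \<mu>
        proof -
          have "(q, t) \<notin> keys \<mu>" for t using that nq by auto
          then show ?thesis by (simp add: grade_def in_keys_iff)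
        qed
        then show ?thesis unfolding Mon_def by auto
      qed
      ultimately show ?thesis using le nq \<open>q \<in> {1..N}\<close> by (auto simp: fun_upd_def)
    qed
  next
    case False
    then obtain q' where "q' \<in> {1..N}" "n q' > k q'" by (auto simp: not_le)
    then have "q' \<in> {1..N}" "(inc n q) q' > k q'" by auto
    then have "\<not> (\<forall>q\<in>{1..N}. n q \<le> k q)" "\<not> (\<forall>q'\<in>{1..N}. (inc n q) q' \<le> k q')"
      using \<open>n q' > k q'\<close> by (meson not_le)+
    then show ?thesis unfolding G.simps by (simp only: if_False add_0)
  qed
next
  case (2 n fs D)
  then show ?case by simp
next
  case (3 n q' \<delta> fs D)
  have "G (n(q' := Suc (n q'))) fs D = G (n(q' := Suc (n q'), q := Suc ((n(q' := Suc (n q'))) q))) fs D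
      + G (n(q' := Suc (n q'))) fs (dec D q)"
    using "3.prems" by (intro "3.IH"(1)) (auto dest: margin_Cons)
  moreover have "G n (\<delta> # fs) (D(q' := D q' - 1)) = G (inc n q) (\<delta> # fs) (D(q' := D q' - 1))
      + G n (\<delta> # fs) (D(q' := D q' - 1, q := (D(q' := D q' - 1)) q - 1))"
    using "3.prems" by (intro "3.IH"(2) margin_tl) auto
  moreover have "n(q' := Suc (n q'), q := Suc ((n(q' := Suc (n q'))) q))
      = n(q := Suc (n q), q' := Suc ((inc n q) q'))" by auto
  moreover have "D(q' := D q' - 1, q := (D(q' := D q' - 1)) q - 1)
      = D(q := D q - 1, q' := (dec D q) q' - 1)" by auto
  ultimately show ?case unfolding G.simps by (simp only: add_ac)
qed

lemma degs_Nil [simp]: "degs [] D = D" by (simp add: degs_def fun_eq_iff)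
lemma degs_Cons: "degs (q # \<delta>) D = degs \<delta> (dec D q)" by (auto simp: degs_def fun_eq_iff)
lemma degs_single: "degs [q] D = dec D q" by (simp add: degs_Cons)

text \<open>The same for a product of linear forms, one factor after the other.\<close>

lemma G_Cons:
  assumes "margin (\<delta> # fs) D" "set (concat (\<delta> # fs)) \<subseteq> {1..N}"
  shows "G n fs D = G n (\<delta> # fs) D + G n fs (degs \<delta> D)"
  using assms
proof (induction \<delta> arbitrary: D)
  case (Cons q \<delta>)
  have "G n fs D = G (inc n q) fs D + G n fs (dec D q)"
    using Cons.prems by (intro G_difference) (auto dest: margin_Cons)
  also have "G n fs (dec D q) = G n (\<delta> # fs) (dec D q) + G n fs (degs (q # \<delta>) D)"
    unfolding degs_Cons using Cons.prems by (intro Cons.IH margin_tl) auto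
  finally show ?case by (simp add: fun_upd_def)
qed simp

text \<open>A choice picks one group from each product so that, with the \<open>n q\<close> given forms, exactly \<open>k q\<close>
  linear forms are picked in each group.\<close>

definition choices :: "(nat \<Rightarrow> nat) \<Rightarrow> nat list list \<Rightarrow> nat list set" where
  "choices n fs = {c. list_all2 (\<lambda>q \<delta>. q \<in> set \<delta>) c fs \<and> (\<forall>q\<in>{1..N}. n q + count_list c q = k q)}"

lemma finite_choices: "finite (choices n fs)"
proof (rule finite_subset)
  show "choices n fs \<subseteq> {c. set c \<subseteq> set (concat fs) \<and> length c = length fs}"
    by (fastforce simp: choices_def list_all2_conv_all_nth in_set_conv_nth)
qed (rule finite_lists_length_eq, simp)

lemma choices_Cons:
  "choices n (\<delta> # fs) = (\<Union>q\<in>set \<delta>. (#) q ` choices (inc n q) fs)"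
proof -
  have "(\<forall>q'\<in>{1..N}. n q' + count_list (q # c) q' = k q') \<longleftrightarrow>
      (\<forall>q'\<in>{1..N}. (inc n q) q' + count_list c q' = k q')" for q c by auto
  then have "q # c \<in> choices n (\<delta> # fs) \<longleftrightarrow> q \<in> set \<delta> \<and> c \<in> choices (inc n q) fs" for q c
    unfolding choices_def mem_Collect_eq list_all2_Cons by blast
  moreover have "[] \<notin> choices n (\<delta> # fs)" by (simp add: choices_def)
  ultimately show ?thesis
    by (intro set_eqI, rename_tac c, case_tac c) (auto simp del: fun_upd_apply)
qed

text \<open>If there are as many forms as variables, a leaf of the recursion has either too many forms in some
  group and contributes 0, or exactly \<open>k q\<close> forms in each group, which leaves only the monomial 1.\<close>

lemma G_eq_card_choices:
  assumes "(\<Sum>q\<in>{1..N}. n q) + length fs = (\<Sum>q\<in>{1..N}. k q)"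
    and "set (concat fs) \<subseteq> {1..N}" "\<forall>\<delta>\<in>set fs. distinct \<delta>"
  shows "G n fs D = card (choices n fs)"
  using assms
proof (induction n fs D rule: G.induct)
  case (1 n D)
  show ?case
  proof (cases "\<forall>q\<in>{1..N}. n q \<le> k q")
    case True
    have eq: "n q = k q" if "q \<in> {1..N}" for q
    proof (rule ccontr)
      assume "n q \<noteq> k q"
      then have "(\<Sum>q\<in>{1..N}. n q) < (\<Sum>q\<in>{1..N}. k q)"
        using True that by (intro sum_strict_mono_ex1) (auto intro!: bexI[of _ q] le_neq_implies_less)
      then show False using 1 by simp
    qed
    then have "Mon n D = {0}"
    proof -
      have "\<mu> = 0" if "\<mu> \<in> Mon n D" for \<mu>
      proof -
        have "keys \<mu> \<subseteq> (SIGMA q:{1..N}. {n q<..k q})" using that by (simp add: Mon_def)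
        also have "\<dots> = {}" using eq by auto
        finally show ?thesis by simp
      qed
      then show ?thesis by auto
    qed
    moreover have "choices n [] = {[]}" using eq by (auto simp: choices_def)
    ultimately show ?thesis using True by simp
  next
    case False
    then have "choices n [] = {}" by (force simp: choices_def)
    then show ?thesis using False by auto
  qed
next
  case (2 n fs D)
  then show ?case by (simp add: choices_Cons)
next
  case (3 n q \<delta> fs D)
  have "G (inc n q) fs D = card (choices (inc n q) fs)"
  proof (rule "3.IH")
    have "(\<Sum>q'\<in>{1..N}. (inc n q) q') = Suc (\<Sum>q\<in>{1..N}. n q)"
      using 3 by (simp add: sum.remove[of _ q])
    then show "(\<Sum>q'\<in>{1..N}. (inc n q) q') + length fs = (\<Sum>q\<in>{1..N}. k q)"
      using 3 by simp
  qed (use 3 in auto)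
  moreover have "G n (\<delta> # fs) (dec D q) = card (choices n (\<delta> # fs))"
    by (rule "3.IH") (use 3 in auto)
  moreover have "choices n ((q # \<delta>) # fs) =
      (#) q ` choices (inc n q) fs \<union> choices n (\<delta> # fs)"
    by (simp add: choices_Cons)
  moreover have "(#) q ` choices (inc n q) fs \<inter> choices n (\<delta> # fs) = {}"
    using 3 by (auto simp: choices_Cons)
  moreover have "card ((#) q ` choices (inc n q) fs) = card (choices (inc n q) fs)"
    by (rule card_image) simp
  ultimately show ?case
    by (simp add: card_Un_disjoint finite_choices)
qed

end

context strategy_spaces
begin

section \<open>Products of linear forms\<close>

text \<open>The variables of group \<open>q\<close> are regarded as the lower coefficients of a monic polynomial
  \<open>\<Sum>\<^sub>s X q s * T\<^sup>s\<close> of degree \<open>k q\<close>, and \<open>lin b q\<close> is its value at \<open>b\<close>. Thus \<open>k q\<close> forms with different \<open>b\<close>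
  have exactly one common zero, and more of them have none.\<close>

definition X :: "nat \<Rightarrow> nat \<Rightarrow> gpoly" where
  "X q s = (if s < k q then Var (q, Suc s) else 1)"

definition lin :: "complex \<Rightarrow> nat \<Rightarrow> gpoly" where
  "lin b q = (\<Sum>s\<le>k q. Const (b ^ s) * X q s)"

definition lin_prod :: "complex \<Rightarrow> nat list \<Rightarrow> gpoly" where
  "lin_prod b \<delta> = prod_list (map (lin b) \<delta>)"

lemma X_in_P: "q \<in> {1..N} \<Longrightarrow> D q \<ge> 1 \<Longrightarrow> X q s \<in> P D"
  by (auto simp: X_def slots_def intro: Var_in_P)

lemma lin_in_P: "q \<in> {1..N} \<Longrightarrow> D q \<ge> 1 \<Longrightarrow> lin b q \<in> P D"
  unfolding lin_def by (intro P_sum P_scale X_in_P)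

lemma lin_prod_in_P: "set \<delta> \<subseteq> {1..N} \<Longrightarrow> lin_prod b \<delta> \<in> P (count_list \<delta>)"
proof (induction \<delta>)
  case (Cons q \<delta>)
  have "lin b q * lin_prod b \<delta> \<in> P (count_list (q # \<delta>))"
  proof (rule P_mult)
    show "lin b q \<in> P (\<lambda>q'. if q' = q then 1 else 0)" using Cons by (intro lin_in_P) auto
    show "lin_prod b \<delta> \<in> P (count_list \<delta>)" using Cons by auto
  qed auto
  then show ?case by (simp add: lin_prod_def del: count_list.simps)
qed (simp add: lin_prod_def)

text \<open>By a Vandermonde system, enough of the forms \<open>lin b q\<close> eliminate the first coordinates.\<close>

lemma X_eliminate:
  assumes "finite A" "card A \<le> Suc (k q)" "s < card A"
  obtains c \<gamma> where
    "X q s = (\<Sum>b\<in>A. Const (c b) * lin b q) + (\<Sum>s'\<in>{card A..k q}. Const (\<gamma> s') * X q s')"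
proof -
  obtain c where c: "\<And>s'. s' < card A \<Longrightarrow> (\<Sum>b\<in>A. c b * b ^ s') = (if s' = s then 1 else 0)"
    using vandermonde_dual[OF assms(1,3)] by metis
  define \<gamma> where "\<gamma> s' = (\<Sum>b\<in>A. c b * b ^ s')" for s'
  have "(\<Sum>b\<in>A. Const (c b) * lin b q) = (\<Sum>s'\<le>k q. Const (\<gamma> s') * X q s')"
    unfolding lin_def \<gamma>_def Const_sum sum_distrib_left sum_distrib_right Const_mult
    by (subst sum.swap) (simp add: mult_ac)
  also have "{..k q} = {..<card A} \<union> {card A..k q}" using assms(2) by auto
  also have "(\<Sum>s'\<in>\<dots>. Const (\<gamma> s') * X q s') =
      (\<Sum>s'<card A. Const (\<gamma> s') * X q s') + (\<Sum>s'\<in>{card A..k q}. Const (\<gamma> s') * X q s')"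
    by (rule sum.union_disjoint) auto
  also have "(\<Sum>s'<card A. Const (\<gamma> s') * X q s') = (\<Sum>s'<card A. if s' = s then X q s else 0)"
    by (intro sum.cong) (auto simp: \<gamma>_def c)
  also have "\<dots> = X q s" using assms(3) by simp
  finally have "X q s = (\<Sum>b\<in>A. Const (c b) * lin b q) + (\<Sum>s'\<in>{card A..k q}. Const (- \<gamma> s') * X q s')"
    by (simp add: Const_uminus sum_negf)
  then show ?thesis by (rule that)
qed

definition codim_le :: "nat \<Rightarrow> (nat \<Rightarrow> nat) \<Rightarrow> gpoly set \<Rightarrow> bool" where
  "codim_le n D J \<longleftrightarrow> (\<exists>B. finite B \<and> B \<subseteq> P D \<and> card B \<le> n \<and> (\<forall>p\<in>P D. \<exists>b\<in>mp.span B. p - b \<in> J))"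

lemma subspace_plus_modulo:
  assumes "mp.subspace J" shows "mp.subspace {p. \<exists>b\<in>mp.span B. p - b \<in> J}"
proof (intro mp.subspaceI; clarify)
  show "\<exists>b\<in>mp.span B. 0 - b \<in> J"
    by (rule bexI[of _ 0]) (use assms in \<open>auto simp: mp.subspace_0 mp.span_zero\<close>)
next
  fix x y b b' assume "b \<in> mp.span B" "x - b \<in> J" "b' \<in> mp.span B" "y - b' \<in> J"
  moreover have "x + y - (b + b') = (x - b) + (y - b')" by simp
  ultimately show "\<exists>b\<in>mp.span B. x + y - b \<in> J"
    using mp.subspace_add[OF assms, of "x - b" "y - b'"]
    by (intro bexI[of _ "b + b'"]) (auto simp only: intro: mp.span_add)
next
  fix c x b assume "b \<in> mp.span B" "x - b \<in> J"
  moreover have "Const c * x - Const c * b = Const c * (x - b)" by (simp add: right_diff_distrib)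
  ultimately show "\<exists>b\<in>mp.span B. Const c * x - b \<in> J"
    using mp.subspace_scale[OF assms, of "x - b" c]
    by (intro bexI[of _ "Const c * b"]) (auto simp only: intro: mp.span_scale)
qed

definition singles :: "(complex \<times> nat) list \<Rightarrow> (gpoly \<times> nat list) list" where
  "singles s = map (\<lambda>(b, q). (lin b q, [q])) s"

definition prods :: "(complex \<times> nat list) list \<Rightarrow> (gpoly \<times> nat list) list" where
  "prods fs = map (\<lambda>(b, \<delta>). (lin_prod b \<delta>, \<delta>)) fs"

definition cnt :: "(complex \<times> nat) list \<Rightarrow> nat \<Rightarrow> nat" where
  "cnt s = count_list (map snd s)"

lemma card_params:
  assumes "distinct (map fst s)"
  shows "card {b. (b, q) \<in> set s} = cnt s q"
  using assms
proof (induction s)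
  case (Cons a s)
  obtain b q' where a: "a = (b, q')" by force
  have fin: "finite {b. (b, q) \<in> set s}"
    by (rule finite_subset[of _ "fst ` set s"]) force+
  show ?case
  proof (cases "q' = q")
    case True
    then have "{b. (b, q) \<in> set (a # s)} = insert b {b. (b, q) \<in> set s}" using a by auto
    moreover have "b \<notin> {b. (b, q) \<in> set s}" using Cons.prems a by force
    ultimately show ?thesis using fin Cons True a by (simp add: cnt_def)
  next
    case False
    then have "{b. (b, q) \<in> set (a # s)} = {b. (b, q) \<in> set s}" using a by auto
    then show ?thesis using Cons False a by (simp add: cnt_def)
  qed
qed (simp add: cnt_def)

lemma finite_params: "finite {b. (b, q) \<in> set s}"
  by (rule finite_subset[of _ "fst ` set s"]) force+

lemma singles_member: "(b, q) \<in> set s \<Longrightarrow> h \<in> P (dec D q) \<Longrightarrow> lin b q * h \<in> I (singles s) D"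
  by (rule I_memberI[of _ "[q]"]) (force simp: singles_def degs_single)+

text \<open>The values at \<open>k q + 1\<close> different places determine all coefficients, among them the leading
  coefficient 1. Hence both 1 and the variables of group \<open>q\<close> are combinations of the forms.\<close>

lemma P_subset_I_overdetermined:
  assumes dist: "distinct (map fst s)" and q: "q \<in> {1..N}" "cnt s q > k q" and D: "D q \<ge> 1"
  shows "P D \<subseteq> I (singles s) D"
proof -
  obtain A where A: "A \<subseteq> {b. (b, q) \<in> set s}" "card A = Suc (k q)" "finite A"
  proof -
    have "Suc (k q) \<le> card {b. (b, q) \<in> set s}" unfolding card_params[OF dist] using q(2) by simp
    then show ?thesis by (rule obtain_subset_with_card_n) (use that in blast)
  qed
  let ?D = "dec D q"
  have X: "X q s' * h \<in> I (singles s) D" if s': "s' \<le> k q" and h: "h \<in> P ?D" for s' h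
  proof -
    obtain c \<gamma> where "X q s' = (\<Sum>b\<in>A. Const (c b) * lin b q) + (\<Sum>s'\<in>{card A..k q}. Const (\<gamma> s') * X q s')"
      by (rule X_eliminate[of A q s']) (use A s' in auto)
    then have "X q s' * h = (\<Sum>b\<in>A. Const (c b) * (lin b q * h))"
      using A(2) by (simp add: sum_distrib_right mult.assoc)
    also have "\<dots> \<in> I (singles s) D"
      using A(1) h by (intro I_sum I_scale singles_member) auto
    finally show ?thesis .
  qed
  have "mon ` Mon (\<lambda>_. 0) D \<subseteq> I (singles s) D"
  proof (intro image_subsetI)
    fix \<mu> assume \<mu>: "\<mu> \<in> Mon (\<lambda>_. 0) D"
    show "mon \<mu> \<in> I (singles s) D"
    proof (cases "grade \<mu> q = 0")
      case True
      then have "\<mu> \<in> Mon (\<lambda>_. 0) ?D" using \<mu> by (auto simp: Mon_def)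
      then show ?thesis using X[of "k q" "mon \<mu>"] mon_in_P by (auto simp: X_def)
    next
      case False
      then obtain t where t: "t \<in> {1..k q}" "lkp \<mu> (q, t) \<noteq> 0" unfolding grade_def by (meson sum.neutral)
      obtain \<nu> where \<nu>: "\<mu> = single (q, t) 1 + \<nu>" "\<nu> \<in> Mon (\<lambda>_. 0) (dec D q)"
        using split_Mon[OF \<mu> t] by blast
      then have "X q (t - 1) * mon \<nu> \<in> I (singles s) D"
        using t by (intro X mon_in_P) auto
      moreover have "X q (t - 1) = mon (single (q, t) 1)" using t by (auto simp: X_def Var_def)
      ultimately show ?thesis using \<nu>(1) by (simp add: mult_single)
    qed
  qed
  then show ?thesis unfolding P_eq_span by (intro mp.span_minimal subspace_I)
qed

text \<open>Eliminating one of the first \<open>cnt s q\<close> variables of a group lowers the total degree in these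
  variables, on which the induction runs.\<close>

lemma span_reduced_monomials:
  assumes dist: "distinct (map fst s)" and le: "\<forall>q\<in>{1..N}. cnt s q \<le> k q" and D: "\<And>q. D q \<ge> 1"
    and \<mu>: "\<mu> \<in> Mon (\<lambda>_. 0) D"
  shows "\<exists>b\<in>mp.span (mon ` Mon (cnt s) D). mon \<mu> - b \<in> I (singles s) D"
  using \<mu>
proof (induction "\<Sum>v\<in>(SIGMA q:{1..N}. {1..cnt s q}). lkp \<mu> v" arbitrary: \<mu> rule: less_induct)
  case less
  let ?E = "SIGMA q:{1..N}. {1..cnt s q}"
  let ?W = "{p. \<exists>b\<in>mp.span (mon ` Mon (cnt s) D). p - b \<in> I (singles s) D}"
  have W: "mp.subspace ?W" by (rule subspace_plus_modulo[OF subspace_I])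
  have IW: "I (singles s) D \<subseteq> ?W" by (auto intro!: bexI[of _ 0] mp.span_zero)
  show ?case
  proof (cases "\<forall>v\<in>?E. lkp \<mu> v = 0")
    case True
    have "keys \<mu> \<subseteq> (SIGMA q:{1..N}. {cnt s q<..k q})"
    proof
      fix v assume v: "v \<in> keys \<mu>"
      then have "v \<in> (SIGMA q:{1..N}. {0<..k q})" using less.prems by (auto simp: Mon_def)
      moreover have "v \<notin> ?E" using v True by (auto simp: in_keys_iff)
      ultimately show "v \<in> (SIGMA q:{1..N}. {cnt s q<..k q})" by (cases v) auto
    qed
    then have "\<mu> \<in> Mon (cnt s) D" using less.prems by (auto simp: Mon_def)
    then show ?thesis by (intro bexI[of _ "mon \<mu>"]) (auto intro: mp.span_base)
  next
    case False
    then obtain q t where v: "q \<in> {1..N}" "t \<in> {1..cnt s q}" "lkp \<mu> (q, t) \<noteq> 0" by auto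
    let ?A = "{b. (b, q) \<in> set s}"
    let ?D = "dec D q"
    let ?s = "single (q, t) (1::nat)"
    have t: "t \<in> {1..k q}" using v(2) bspec[OF le v(1)] by auto
    obtain \<nu> where eq: "\<mu> = ?s + \<nu>" and sub: "keys \<nu> \<subseteq> keys \<mu>" and \<nu>: "\<nu> \<in> Mon (\<lambda>_. 0) ?D"
      using split_Mon[OF less.prems t v(3)] .
    have gr: "grade \<mu> q' = (if q' = q then 1 else 0) + grade \<nu> q'" for q'
      using grade_single[OF t, of 1 q'] by (simp add: eq grade_add)
    have g: "grade \<mu> q' \<le> D q'" if "q' \<in> {1..N}" for q' using less.prems that by (auto simp: Mon_def)
    have meas\<mu>: "(\<Sum>v\<in>?E. lkp \<mu> v) = Suc (\<Sum>v\<in>?E. lkp \<nu> v)"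
    proof -
      have "(\<Sum>v\<in>?E. lkp \<mu> v) = (\<Sum>v\<in>?E. lkp ?s v) + (\<Sum>v\<in>?E. lkp \<nu> v)"
        unfolding eq lookup_add sum.distrib ..
      also have "(\<Sum>v\<in>?E. lkp ?s v) = 1"
        using v by (simp add: lookup_single when_def sum.delta')
      finally show ?thesis by simp
    qed
    have redX: "X q s' * mon \<nu> \<in> ?W" if s': "s' \<in> {cnt s q..k q}" for s'
    proof (cases "s' < k q")
      case True
      let ?r = "single (q, Suc s') (1::nat)"
      have "?r + \<nu> \<in> Mon (\<lambda>_. 0) D"
      proof -
        have "grade (?r + \<nu>) q' = grade \<mu> q'" for q'
          using True by (simp add: grade_add grade_single gr)
        moreover have "keys (?r + \<nu>) \<subseteq> (SIGMA q:{1..N}. {0<..k q})"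
        proof -
          have "keys ?r \<subseteq> (SIGMA q:{1..N}. {0<..k q})" using v True by auto
          moreover have "keys \<mu> \<subseteq> (SIGMA q:{1..N}. {0<..k q})"
            using less.prems by (simp add: Mon_def)
          ultimately show ?thesis using keys_add[of ?r \<nu>] sub by blast
        qed
        ultimately show ?thesis using g by (auto simp: Mon_def)
      qed
      moreover have "(\<Sum>v\<in>?E. lkp (?r + \<nu>) v) < (\<Sum>v\<in>?E. lkp \<mu> v)"
      proof -
        have "(\<Sum>v\<in>?E. lkp ?r v) = 0"
          using s' by (intro sum.neutral) (auto simp: lookup_single when_def)
        then show ?thesis unfolding meas\<mu> lookup_add sum.distrib by simp
      qed
      ultimately have "mon (?r + \<nu>) \<in> ?W" using less.hyps by blast
      then show ?thesis using True by (simp add: X_def Var_def mult_single)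
    next
      case False
      have "\<nu> \<in> Mon (\<lambda>_. 0) D" by (rule subsetD[OF Mon_mono \<nu>]) auto
      then have "mon \<nu> \<in> ?W" using less.hyps[of \<nu>] meas\<mu> by auto
      then show ?thesis using False by (simp add: X_def)
    qed
    have cA: "card ?A = cnt s q" by (rule card_params[OF dist])
    obtain c \<gamma> where c: "X q (t - 1) = (\<Sum>b\<in>?A. Const (c b) * lin b q) +
        (\<Sum>s'\<in>{cnt s q..k q}. Const (\<gamma> s') * X q s')"
    proof (rule X_eliminate[of ?A q "t - 1", unfolded cA])
      show "cnt s q \<le> Suc (k q)" using le v(1) by (simp add: le_SucI)
      show "t - 1 < cnt s q" using v(2) by auto
    qed (use finite_params in auto)
    have "mon \<mu> = X q (t - 1) * mon \<nu>"
    proof -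
      have "X q (t - 1) = mon ?s" using t by (auto simp: X_def Var_def)
      moreover have "mon ?s * mon \<nu> = (mon \<mu> :: gpoly)"
        unfolding eq mult_single by simp
      ultimately show ?thesis by simp
    qed
    also have "\<dots> = (\<Sum>b\<in>?A. Const (c b) * (lin b q * mon \<nu>)) +
        (\<Sum>s'\<in>{cnt s q..k q}. Const (\<gamma> s') * (X q s' * mon \<nu>))"
      unfolding c by (simp only: distrib_right sum_distrib_right mult.assoc)
    also have "\<dots> \<in> ?W"
    proof (rule mp.subspace_add[OF W])
      show "(\<Sum>b\<in>?A. Const (c b) * (lin b q * mon \<nu>)) \<in> ?W"
        by (rule subsetD[OF IW], intro I_sum I_scale singles_member) (use mon_in_P[OF \<nu>] in auto)
      show "(\<Sum>s'\<in>{cnt s q..k q}. Const (\<gamma> s') * (X q s' * mon \<nu>)) \<in> ?W"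
        by (intro mp.subspace_sum[OF W] mp.subspace_scale[OF W] redX)
    qed
    finally show ?thesis by simp
  qed
qed

lemma codim_singles:
  assumes dist: "distinct (map fst s)" and D: "\<And>q. D q \<ge> 1"
  shows "codim_le (G (cnt s) [] D) D (I (singles s) D)"
proof (cases "\<forall>q\<in>{1..N}. cnt s q \<le> k q")
  case True
  let ?B = "mon ` Mon (cnt s) D"
  have "P D \<subseteq> {p. \<exists>b\<in>mp.span ?B. p - b \<in> I (singles s) D}"
    unfolding P_eq_span using span_reduced_monomials[OF dist True D]
    by (intro mp.span_minimal subspace_plus_modulo subspace_I) auto
  then show ?thesis unfolding codim_le_def using True
    by (intro exI[of _ ?B]) (auto simp: finite_Mon card_image_le intro: mon_in_P)
next
  case False
  then obtain q where "q \<in> {1..N}" "cnt s q > k q" by (auto simp: not_le)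
  then have "P D \<subseteq> I (singles s) D" using P_subset_I_overdetermined[OF dist, of q D] D by blast
  then show ?thesis unfolding codim_le_def by (intro exI[of _ "{}"]) auto
qed

text \<open>If \<open>B2\<close> spans modulo the ideal with \<open>L\<close> in place of \<open>L * f\<close>, and
  \<open>B1\<close> spans modulo the ideal with \<open>f\<close> in place of \<open>L * f\<close>, then \<open>B2\<close> together with the products of
  \<open>L\<close> with \<open>B1\<close> spans modulo the ideal with \<open>L * f\<close>. Products reduced to one factor are collected
  in \<open>s\<close>.\<close>

lemma codim_prods:
  assumes "distinct (map fst fs @ map fst s)" "margin (map snd fs) D"
    and "set (concat (map snd fs)) \<subseteq> {1..N}"
  shows "codim_le (G (cnt s) (map snd fs) D) D (I (prods fs @ singles s) D)"
  using assms
proof (induction fs arbitrary: s D)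
  case Nil
  then show ?case using codim_singles[of s D] margin_pos[of "[]" D] by (simp add: prods_def)
next
  case (Cons a fs)
  obtain b \<delta> where a: "a = (b, \<delta>)" by force
  have b: "b \<notin> set (map fst fs)" "b \<notin> set (map fst s)" "distinct (map fst fs @ map fst s)"
    using Cons.prems(1) a by auto
  have fs: "set (concat (map snd fs)) \<subseteq> {1..N}" using Cons.prems(3) by auto
  let ?rest = "prods fs @ singles s"
  note IH = Cons.IH
  have "codim_le (G (cnt s) (\<delta> # map snd fs) D) D (I ((lin_prod b \<delta>, \<delta>) # ?rest) D)"
    if "margin (\<delta> # map snd fs) D" "set \<delta> \<subseteq> {1..N}" for \<delta> D
    using that
  proof (induction \<delta> arbitrary: D)
    case Nil
    have "P D \<subseteq> I ((lin_prod b [], []) # ?rest) D"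
      using I_memberI[of "lin_prod b []" "[]" "(lin_prod b [], []) # ?rest" _ D]
      by (auto simp: lin_prod_def)
    then show ?case unfolding codim_le_def by (intro exI[of _ "{}"]) auto
  next
    case (Cons q \<delta>)
    let ?D = "dec D q"
    let ?L = "lin b q" and ?F = "lin_prod b \<delta>"
    have q: "q \<in> {1..N}" and m: "margin (\<delta> # map snd fs) ?D" and Dq: "D q \<ge> 1"
      using Cons.prems margin_tl[OF Cons.prems(1)] margin_pos[OF Cons.prems(1)] by auto
    obtain B1 where B1: "finite B1" "B1 \<subseteq> P ?D" "card B1 \<le> G (cnt s) (\<delta> # map snd fs) ?D"
      "\<And>p. p \<in> P ?D \<Longrightarrow> \<exists>b\<in>mp.span B1. p - b \<in> I ((?F, \<delta>) # ?rest) ?D"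
      using Cons.IH[OF m] Cons.prems(2) unfolding codim_le_def by auto
    have cnt: "cnt ((b, q) # s) = (cnt s)(q := Suc (cnt s q))" by (auto simp: cnt_def)
    have "codim_le (G (cnt ((b, q) # s)) (map snd fs) D) D (I (prods fs @ singles ((b, q) # s)) D)"
    proof (rule IH)
      show "distinct (map fst fs @ map fst ((b, q) # s))" using b by auto
      show "margin (map snd fs) D" using Cons.prems(1) by (rule margin_Cons)
    qed (rule fs)
    then obtain B2 where B2: "finite B2" "B2 \<subseteq> P D"
        "card B2 \<le> G ((cnt s)(q := Suc (cnt s q))) (map snd fs) D"
        "\<And>p. p \<in> P D \<Longrightarrow> \<exists>b'\<in>mp.span B2. p - b' \<in> I (prods fs @ singles ((b, q) # s)) D"
      unfolding codim_le_def cnt by auto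
    have dom: "dominated ?rest ?D"
    proof -
      have "count_list \<delta>' q' \<le> ?D q'" if "(f, \<delta>') \<in> set ?rest" for f \<delta>' q'
      proof -
        have "count_list \<delta>' q' \<le> max 1 (count_list (concat (map snd fs)) q')"
        proof (cases "(f, \<delta>') \<in> set (prods fs)")
          case True
          then have "\<delta>' \<in> set (map snd fs)" by (force simp: prods_def)
          then obtain xs ys where "map snd fs = xs @ \<delta>' # ys" by (meson split_list)
          then show ?thesis by simp
        next
          case False
          then have "\<exists>q. \<delta>' = [q]" using that by (auto simp: singles_def)
          then show ?thesis by auto
        qed
        also have "\<dots> \<le> ?D q'"
        proof -
          have "count_list (concat (\<delta> # map snd fs)) q' < ?D q'" using m unfolding margin_def by blast
          then show ?thesis by simp
        qed
        finally show ?thesis .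
      qed
      then show ?thesis unfolding dominated_def by blast
    qed
    have L: "?L \<in> P (\<lambda>q'. if q' = q then 1 else 0)" using q by (intro lin_in_P) auto
    let ?B = "(\<lambda>x. ?L * x) ` B1 \<union> B2"
    let ?J = "I ((lin_prod b (q # \<delta>), q # \<delta>) # ?rest) D"
    have FL: "lin_prod b (q # \<delta>) = ?L * ?F" by (simp add: lin_prod_def)
    have LJ: "?L * g \<in> ?J" if g0: "g \<in> I ((?F, \<delta>) # ?rest) ?D" for g
    proof -
      obtain h g' where g: "g = ?F * h + g'" "h \<in> P (degs \<delta> ?D)" "g' \<in> I ?rest ?D"
        using g0 unfolding I.simps by blast
      have "lin_prod b (q # \<delta>) * h \<in> ?J"
        using g(2) by (intro I_memberI[of _ "q # \<delta>"]) (auto simp: degs_Cons)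
      moreover have "?L * g' \<in> I ?rest D"
        by (rule I_mult[OF L g(3) dom]) (use Dq in auto)
      then have "?L * g' \<in> ?J" using I_cong_set[of ?rest "(lin_prod b (q # \<delta>), q # \<delta>) # ?rest" D] by auto
      ultimately have "lin_prod b (q # \<delta>) * h + ?L * g' \<in> ?J" by (rule I_add)
      then show ?thesis by (simp add: g FL algebra_simps)
    qed
    have Lspan: "?L * x \<in> mp.span ?B" if "x \<in> mp.span B1" for x
    proof -
      have "mp.span B1 \<subseteq> {p. ?L * p \<in> mp.span ?B}"
        by (intro mp.span_minimal subspace_mult_preimage) (auto intro: mp.span_base)
      then show ?thesis using that by auto
    qed
    let ?W = "{p. \<exists>b\<in>mp.span ?B. p - b \<in> ?J}"
    have W: "mp.subspace ?W" by (rule subspace_plus_modulo[OF subspace_I])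
    have JW: "?J \<subseteq> ?W" by (intro subsetI CollectI bexI[of _ 0]) (auto intro: mp.span_zero)
    have LW: "?L * h \<in> ?W" if h: "h \<in> P ?D" for h
    proof -
      obtain x where "x \<in> mp.span B1" "h - x \<in> I ((?F, \<delta>) # ?rest) ?D" using B1(4)[OF h] by blast
      then have "?L * x \<in> mp.span ?B" "?L * h - ?L * x \<in> ?J"
        using Lspan LJ[of "h - x"] by (auto simp: right_diff_distrib)
      then show ?thesis by blast
    qed
    have "I (prods fs @ singles ((b, q) # s)) D \<subseteq> ?W"
    proof (rule I_least[OF W])
      fix f \<delta>' h assume f: "(f, \<delta>') \<in> set (prods fs @ singles ((b, q) # s))" "h \<in> P (degs \<delta>' D)"
      show "f * h \<in> ?W"
      proof (cases "(f, \<delta>') \<in> set ?rest")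
        case True
        then show ?thesis using f(2) JW by (intro subsetD[OF JW] I_memberI[of f \<delta>']) auto
      next
        case False
        then have "f = ?L" "\<delta>' = [q]" using f(1) by (auto simp: singles_def)
        then show ?thesis using LW f(2) by (simp add: degs_single)
      qed
    qed
    then have "p \<in> ?W" if p: "p \<in> P D" for p
    proof -
      obtain x where x: "x \<in> mp.span B2" "p - x \<in> ?W"
        using B2(4)[OF p] \<open>I (prods fs @ singles ((b, q) # s)) D \<subseteq> ?W\<close> by blast
      then obtain y where y: "y \<in> mp.span ?B" "p - x - y \<in> ?J" by auto
      have "x \<in> mp.span ?B" using x(1) mp.span_mono[of B2 ?B] by auto
      then have "x + y \<in> mp.span ?B" using y(1) by (rule mp.span_add)
      moreover have "p - (x + y) \<in> ?J" using y(2) by (simp add: diff_diff_eq)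
      ultimately show ?thesis by blast
    qed
    moreover have "?B \<subseteq> P D"
    proof -
      have "?L * x \<in> P D" if "x \<in> B1" for x
        by (rule P_mult[OF L]) (use that B1(2) Dq in auto)
      then show ?thesis using B2(2) by auto
    qed
    moreover have "card ?B \<le> G (cnt s) ((q # \<delta>) # map snd fs) D"
    proof -
      have "card ?B \<le> card ((\<lambda>x. ?L * x) ` B1) + card B2" by (rule card_Un_le)
      also have "card ((\<lambda>x. ?L * x) ` B1) \<le> card B1" by (rule card_image_le[OF B1(1)])
      finally show ?thesis using B1(3) B2(3) unfolding G.simps by linarith
    qed
    ultimately show ?case unfolding codim_le_def using B1(1) B2(1) by (intro exI[of _ ?B]) auto
  qed
  from this[of \<delta> D] show ?case using Cons.prems a by (simp add: prods_def)
qed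

end

section \<open>Dimension count for generic payoff tables\<close>

lemma span_image_finiteE:
  assumes "finite J" "p \<in> mp.span (v ` J)"
  obtains c where "p = (\<Sum>j\<in>J. Const (c j) * v j)"
proof -
  have "mp.span (v ` J) \<subseteq> range (\<lambda>c. \<Sum>j\<in>J. Const (c j) * v j)" (is "_ \<subseteq> ?R")
  proof (rule mp.span_minimal)
    show "v ` J \<subseteq> ?R"
    proof (intro image_subsetI range_eqI)
      fix j assume "j \<in> J"
      then show "v j = (\<Sum>i\<in>J. Const (if i = j then 1 else 0) * v i)"
        using assms(1) by (simp add: if_distrib[of Const] if_distrib[of "\<lambda>x. x * _"] cong: if_cong)
    qed
    show "mp.subspace ?R"
    proof (rule mp.subspaceI)
      show "0 \<in> ?R" by (rule range_eqI[of _ _ "\<lambda>_. 0"]) simp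
    next
      fix x y assume "x \<in> ?R" "y \<in> ?R"
      then obtain c d where "x = (\<Sum>j\<in>J. Const (c j) * v j)" "y = (\<Sum>j\<in>J. Const (d j) * v j)" by blast
      then show "x + y \<in> ?R"
        by (intro range_eqI[of _ _ "\<lambda>j. c j + d j"]) (simp add: Const_add distrib_right sum.distrib)
    next
      fix a x assume "x \<in> ?R"
      then obtain c where "x = (\<Sum>j\<in>J. Const (c j) * v j)" by blast
      then show "Const a * x \<in> ?R"
        by (intro range_eqI[of _ _ "\<lambda>j. a * c j"]) (simp only: Const_mult sum_distrib_left mult.assoc)
    qed
  qed
  then show ?thesis using assms(2) that by blast
qed

context strategy_spaces
begin

lemma finite_dim_P: "P D \<subseteq> mp.span (mon ` Mon (\<lambda>_. 0) D)" "finite (mon ` Mon (\<lambda>_. 0) D :: gpoly set)"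
  by (auto simp: P_eq_span finite_Mon)

lemma degs_plus: "count_list \<delta> q \<le> D q \<Longrightarrow> degs \<delta> D q + count_list \<delta> q = D q"
  by (simp add: degs_def)

text \<open>Multiples of \<open>f\<close> by elements of the smaller truncated ideal are not new.\<close>

lemma dim_I_Cons:
  assumes f: "f \<in> P (count_list \<delta>)" and \<delta>: "\<And>q. count_list \<delta> q \<le> D q"
    and wf: "wf_sys sys" and dom: "dominated sys D" "dominated sys (degs \<delta> D)"
  shows "mp.dim (I ((f, \<delta>) # sys) D) + mp.dim (I sys (degs \<delta> D)) \<le> mp.dim (I sys D) + mp.dim (P (degs \<delta> D))"
proof -
  let ?J = "I sys (degs \<delta> D)" and ?P = "P (degs \<delta> D)"
  have JP: "?J \<subseteq> ?P" by (rule I_subset_P[OF wf dom(2)])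
  have "?J \<subseteq> mp.span (mon ` Mon (\<lambda>_. 0) (degs \<delta> D))" using JP finite_dim_P(1) by blast
  then obtain C0 where C0: "C0 \<subseteq> ?J" "mp.independent C0" "?J \<subseteq> mp.span C0" "finite C0" "card C0 = mp.dim ?J"
    using mp.finite_basis[OF _ finite_dim_P(2)] by metis
  obtain B where B: "C0 \<subseteq> B" "B \<subseteq> ?P" "mp.independent B" "?P \<subseteq> mp.span B"
    using mp.maximal_independent_subset_extend[OF subset_trans[OF C0(1) JP] C0(2)] by metis
  have finB: "finite B"
    using mp.independent_span_bound[OF finite_dim_P(2) B(3)] B(2) finite_dim_P(1) by blast
  have cB: "card B = mp.dim ?P" by (rule mp.basis_card_eq_dim[OF B(2,4,3)])
  let ?C = "B - C0"
  have cC: "card ?C + mp.dim ?J = mp.dim ?P"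
    using C0 B(1) finB cB by (metis card_Diff_subset card_mono le_add_diff_inverse2)
  have fJ: "f * g \<in> I sys D" if "g \<in> ?J" for g
    by (rule I_mult[OF f that dom(2)]) (simp add: degs_plus \<delta>)
  have "mp.dim (I ((f, \<delta>) # sys) D) \<le> card ((\<lambda>x. f * x) ` ?C) + mp.dim (I sys D)"
  proof (rule mp.dim_le_card_plus)
    show "I sys D \<subseteq> mp.span (mon ` Mon (\<lambda>_. 0) D)"
      using I_subset_P[OF wf dom(1)] finite_dim_P(1) by blast
    fix p assume "p \<in> I ((f, \<delta>) # sys) D"
    then obtain h g where p: "p = f * h + g" "h \<in> ?P" "g \<in> I sys D" unfolding I.simps by blast
    have "h \<in> mp.span (?C \<union> C0)" using p(2) B(1,4) by (simp add: Un_absorb2 subset_iff)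
    then obtain x y where xy: "h = x + y" "x \<in> mp.span ?C" "y \<in> mp.span C0"
      unfolding mp.span_Un by blast
    have "y \<in> ?J" using xy(3) mp.span_minimal[OF C0(1) subspace_I] by blast
    have "mp.span ?C \<subseteq> {x. f * x \<in> mp.span ((\<lambda>x. f * x) ` ?C)}"
      by (intro mp.span_minimal subspace_mult_preimage) (auto intro: mp.span_base)
    then have "f * x \<in> mp.span ((\<lambda>x. f * x) ` ?C)" using xy(2) by auto
    moreover have "p - f * x = f * y + g" using p(1) xy(1) by (simp add: algebra_simps)
    moreover have "f * y + g \<in> I sys D" using fJ[OF \<open>y \<in> ?J\<close>] p(3) by (rule I_add)
    ultimately show "\<exists>b\<in>mp.span ((\<lambda>x. f * x) ` ?C). p - b \<in> I sys D" by metis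
  qed (use finB finite_Mon in auto)
  also have "card ((\<lambda>x. f * x) ` ?C) \<le> card ?C" using finB by (intro card_image_le) auto
  finally show ?thesis using cC by linarith
qed

end

locale game = strategy_spaces N k for N k +
  fixes E :: "(nat \<times> nat) set"
  assumes E: "E \<subseteq> arcs N"
begin

abbreviation T where "T \<equiv> entries N E k"

abbreviation solution_number :: "(entry \<Rightarrow> complex) \<Rightarrow> nat" where
  "solution_number u \<equiv> \<Sum>x\<in>isolated_solutions N E k u. multiplicity_at V V (indiff_poly E k u) x"

definition nb :: "nat \<Rightarrow> nat list" where "nb i = sorted_list_of_set (in_nbrs E i)"

lemma in_nbrs_subset: "in_nbrs E i \<subseteq> {1..N}"
  using E by (auto simp: in_nbrs_def arcs_def)

lemma finite_in_nbrs: "finite (in_nbrs E i)"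
  by (rule finite_subset[OF in_nbrs_subset]) simp

lemma set_nb [simp]: "set (nb i) = in_nbrs E i" and distinct_nb [simp]: "distinct (nb i)"
  by (auto simp: nb_def finite_in_nbrs)

lemma count_nb: "count_list (nb i) q = (if q \<in> in_nbrs E i then 1 else 0)"
proof -
  have "distinct xs \<Longrightarrow> count_list xs q = (if q \<in> set xs then 1 else 0)" for xs
    by (induction xs) auto
  then show ?thesis by simp
qed

lemma strat_poly_in_P: "q \<in> {1..N} \<Longrightarrow> t \<in> {0..k q} \<Longrightarrow> D q \<ge> 1 \<Longrightarrow> strat_poly k q t \<in> P D"
  unfolding strat_poly_def
  by (auto intro!: P_diff P_sum Var_in_P simp: slots_def)

lemma P_prod:
  assumes "finite A" "A \<subseteq> {1..N}" "\<And>q D. q \<in> A \<Longrightarrow> D q \<ge> 1 \<Longrightarrow> p q \<in> P D"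
  shows "(\<Prod>q\<in>A. p q) \<in> P (\<lambda>q. if q \<in> A then 1 else 0)"
  using assms
proof (induction A)
  case (insert q A)
  have "p q * (\<Prod>q\<in>A. p q) \<in> P (\<lambda>q'. if q' \<in> insert q A then 1 else 0)"
  proof (rule P_mult)
    show "p q \<in> P (\<lambda>q'. if q' = q then 1 else 0)" using insert by auto
    show "(\<Prod>q\<in>A. p q) \<in> P (\<lambda>q. if q \<in> A then 1 else 0)" using insert by auto
  qed (use insert in auto)
  then show ?case using insert by simp
qed simp

lemma indiff_poly_in_P: "indiff_poly E k u e \<in> P (count_list (nb (fst e)))"
proof -
  have eq: "count_list (nb (fst e)) = (\<lambda>q. if q \<in> in_nbrs E (fst e) then 1 else 0)"
    by (rule ext) (rule count_nb)
  show ?thesis unfolding eq indiff_poly_def case_prod_unfold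
  proof (intro P_sum P_scale P_prod finite_in_nbrs in_nbrs_subset)
    fix \<alpha> q D assume "\<alpha> \<in> nbr_profiles E k (fst e)" "q \<in> in_nbrs E (fst e)" "(1::nat) \<le> D q"
    then show "strat_poly k q (\<alpha> q) \<in> P D"
      using subsetD[OF in_nbrs_subset, of q] by (intro strat_poly_in_P) (auto simp: nbr_profiles_def PiE_iff)
  qed
qed

lemma polyfun_indiff:
  assumes "e \<in> V"
  shows "polyfun T (\<lambda>u. lkp (indiff_poly E k u e * h) \<nu>)"
proof -
  obtain i s where e: "e = (i, s)" by force
  have ran: "i \<in> {1..N}" "s \<in> {0..k i}" "0 \<in> {0..k i}" using assms e by (auto simp: slots_def)
  have "lkp (indiff_poly E k u e * h) \<nu> = (\<Sum>\<alpha>\<in>nbr_profiles E k i.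
      (u (i, s, \<alpha>) - u (i, 0, \<alpha>)) * lkp ((\<Prod>q\<in>in_nbrs E i. strat_poly k q (\<alpha> q)) * h) \<nu>)" for u
    by (simp add: e indiff_poly_def sum_distrib_right lookup_sum lookup_Const_mult mult.assoc)
  then show ?thesis
    by (simp only:) (intro polyfun_sum polyfun_mult polyfun_diff polyfun_coord polyfun_const,
      use ran in \<open>auto simp: entries_def\<close>)
qed

definition sysl :: "(nat \<times> nat) list \<Rightarrow> (entry \<Rightarrow> complex) \<Rightarrow> (gpoly \<times> nat list) list" where
  "sysl es u = map (\<lambda>e. (indiff_poly E k u e, nb (fst e))) es"

lemma wf_sysl: "wf_sys (sysl es u)"
  by (auto simp: wf_sys_def sysl_def intro: indiff_poly_in_P)

lemma dominated_sysl: "(\<And>q. D q \<ge> 1) \<Longrightarrow> dominated (sysl es u) D"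
  by (auto simp: dominated_def sysl_def count_nb)

text \<open>The vectors that span modulo \<open>I\<close>, and the multiples of the equations by monomials, have coordinates
  that are polynomials in the payoffs, so \<open>near_spanning\<close> applies.\<close>

lemma near_span_modulo:
  assumes es: "set es \<subseteq> V" and D: "\<And>q. D q \<ge> 1"
    and W: "finite W" "W \<subseteq> P D"
    and sp: "\<forall>p\<in>P D. \<exists>w\<in>mp.span W. p - w \<in> I (sysl es u0) D"
  shows "near T u0 (\<lambda>u. \<forall>p\<in>P D. \<exists>w\<in>mp.span W. p - w \<in> I (sysl es u) D)"
proof -
  let ?K = "SIGMA e:set es. Mon (\<lambda>_. 0) (degs (nb (fst e)) D)"
  define J where "J = Inl ` W \<union> Inr ` ?K"
  define vec where "vec u j = (case j of Inl w \<Rightarrow> w | Inr (e, \<mu>) \<Rightarrow> indiff_poly E k u e * mon \<mu>)"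
    for u and j :: "gpoly + (nat \<times> nat) \<times> (nat \<times> nat \<Rightarrow>\<^sub>0 nat)"
  have finJ: "finite J" using W(1) finite_Mon by (auto simp: J_def)
  have vec_I: "vec u (Inr x) \<in> I (sysl es u) D" if "x \<in> ?K" for u x
  proof -
    obtain e \<mu> where x: "x = (e, \<mu>)" by (cases x) blast
    have "(indiff_poly E k u e, nb (fst e)) \<in> set (sysl es u)"
      unfolding sysl_def set_map using that x by (intro imageI) auto
    moreover have "mon \<mu> \<in> P (degs (nb (fst e)) D)"
      by (rule mon_in_P[of _ "\<lambda>_. 0"]) (use that x in auto)
    ultimately show ?thesis unfolding x vec_def by (auto intro: I_memberI)
  qed
  have I_P: "I (sysl es u) D \<subseteq> P D" for u by (rule I_subset_P[OF wf_sysl dominated_sysl[OF D]])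
  have vec_P: "vec u j \<in> P D" if "j \<in> J" for u j
  proof (cases j)
    case (Inl w)
    then show ?thesis using that W(2) by (auto simp: J_def vec_def)
  next
    case (Inr x)
    then have "x \<in> ?K" using that by (auto simp: J_def)
    from subsetD[OF I_P vec_I[OF this]] show ?thesis using Inr by simp
  qed
  have I_span: "I (sysl es u) D \<subseteq> mp.span (vec u ` J)" for u
  proof (rule I_least)
    fix f \<delta> h assume f: "(f, \<delta>) \<in> set (sysl es u)" "h \<in> P (degs \<delta> D)"
    then obtain e where e: "e \<in> set es" "f = indiff_poly E k u e" "\<delta> = nb (fst e)"
      by (auto simp: sysl_def)
    have "P (degs \<delta> D) \<subseteq> {h. f * h \<in> mp.span (vec u ` J)}"
      unfolding P_eq_span
    proof (intro mp.span_minimal subspace_mult_preimage mp.subspace_span image_subsetI CollectI)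
      fix \<mu> assume "\<mu> \<in> Mon (\<lambda>_. 0) (degs \<delta> D)"
      then have "vec u (Inr (e, \<mu>)) \<in> vec u ` J" using e by (auto simp: J_def)
      then show "f * mon \<mu> \<in> mp.span (vec u ` J)" using e by (auto simp: vec_def intro: mp.span_base)
    qed
    then show "f * h \<in> mp.span (vec u ` J)" using f(2) by auto
  qed (rule mp.subspace_span)
  have "near T u0 (\<lambda>u. \<forall>b. \<exists>c. \<forall>\<mu>\<in>Mon (\<lambda>_. 0) D. (\<Sum>j\<in>J. c j * lkp (vec u j) \<mu>) = b \<mu>)"
  proof (rule near_spanning[OF finite_Mon finJ])
    fix j \<mu> assume "j \<in> J"
    then show "polyfun T (\<lambda>u. lkp (vec u j) \<mu>)"
      using es by (auto simp: J_def vec_def intro!: polyfun_const polyfun_indiff)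
  next
    fix b
    define p :: "gpoly" where "p = (\<Sum>\<mu>\<in>Mon (\<lambda>_. 0) D. Const (b \<mu>) * mon \<mu>)"
    have "p \<in> P D" unfolding p_def by (intro P_sum P_scale mon_in_P)
    then obtain w where w: "w \<in> mp.span W" "p - w \<in> I (sysl es u0) D" using sp by blast
    have "mp.span W \<subseteq> mp.span (vec u0 ` J)"
    proof (intro mp.span_mono subsetI)
      fix x assume "x \<in> W"
      then have "vec u0 (Inl x) \<in> vec u0 ` J" by (auto simp: J_def)
      then show "x \<in> vec u0 ` J" by (simp add: vec_def)
    qed
    then have "w + (p - w) \<in> mp.span (vec u0 ` J)" using w I_span by (intro mp.span_add) auto
    then obtain c where c: "p = (\<Sum>j\<in>J. Const (c j) * vec u0 j)"
      using span_image_finiteE[OF finJ, of p "vec u0"] by auto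
    have "(\<Sum>j\<in>J. c j * lkp (vec u0 j) \<mu>) = b \<mu>" if "\<mu> \<in> Mon (\<lambda>_. 0) D" for \<mu>
    proof -
      have "(\<Sum>j\<in>J. c j * lkp (vec u0 j) \<mu>) = lkp p \<mu>" by (simp add: c lookup_sum lookup_Const_mult)
      also have "\<dots> = (\<Sum>\<nu>\<in>Mon (\<lambda>_. 0) D. if \<nu> = \<mu> then b \<nu> else 0)"
        unfolding p_def lookup_sum by (intro sum.cong) (auto simp: lookup_Const_mult lookup_single when_def)
      also have "\<dots> = b \<mu>" using that finite_Mon by simp
      finally show ?thesis .
    qed
    then show "\<exists>c. \<forall>\<mu>\<in>Mon (\<lambda>_. 0) D. (\<Sum>j\<in>J. c j * lkp (vec u0 j) \<mu>) = b \<mu>" by blast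
  qed
  then show ?thesis
  proof (rule near_mono, intro ballI)
    fix u p
    assume a: "\<forall>b. \<exists>c. \<forall>\<mu>\<in>Mon (\<lambda>_. 0) D. (\<Sum>j\<in>J. c j * lkp (vec u j) \<mu>) = b \<mu>" and p: "p \<in> P D"
    obtain c where c: "\<forall>\<mu>\<in>Mon (\<lambda>_. 0) D. (\<Sum>j\<in>J. c j * lkp (vec u j) \<mu>) = lkp p \<mu>"
      using spec[OF a, of "lkp p"] by blast
    have q: "(\<Sum>j\<in>J. Const (c j) * vec u j) = p" (is "?q = p")
    proof (rule poly_mapping_eqI)
      fix \<mu>
      have qP: "?q \<in> P D" by (intro P_sum P_scale vec_P)
      show "lkp ?q \<mu> = lkp p \<mu>"
      proof (cases "\<mu> \<in> Mon (\<lambda>_. 0) D")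
        case True
        then show ?thesis using c by (simp add: lookup_sum lookup_Const_mult)
      next
        case False
        then have "\<mu> \<notin> keys ?q" "\<mu> \<notin> keys p"
          using p qP unfolding P_def supp_in_def by blast+
        then show ?thesis by (simp only: in_keys_iff not_not)
      qed
    qed
    let ?w = "\<Sum>j\<in>Inl ` W. Const (c j) * vec u j"
    have "?q = ?w + (\<Sum>j\<in>Inr ` ?K. Const (c j) * vec u j)"
      unfolding J_def using finJ by (intro sum.union_disjoint) (auto simp: J_def)
    then have "p - ?w = (\<Sum>j\<in>Inr ` ?K. Const (c j) * vec u j)" unfolding q by simp
    moreover have "?w \<in> mp.span W"
      by (intro mp.span_sum mp.span_scale) (auto simp: vec_def intro: mp.span_base)
    moreover have "(\<Sum>j\<in>Inr ` ?K. Const (c j) * vec u j) \<in> I (sysl es u) D"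
      by (intro I_sum I_scale) (use vec_I in blast)
    ultimately show "\<exists>w\<in>mp.span W. p - w \<in> I (sysl es u) D"
      by (intro bexI[of _ ?w]) simp_all
  qed
qed

definition degl :: "(nat \<times> nat) list \<Rightarrow> nat list list" where
  "degl es = map (nb \<circ> fst) es"

lemma set_degl: "set (concat (degl es)) \<subseteq> {1..N}"
  using in_nbrs_subset by (auto simp: degl_def)

text \<open>The codimension of the truncated ideal is at most \<open>G\<close> near \<open>u0\<close> because it is so at \<open>u0\<close>. It is at
  least \<open>G\<close> because of \<open>dim_I_Cons\<close> and the recursion \<open>G_Cons\<close>, applied to the dimensions already
  known for the system with one equation less.\<close>

lemma near_dim:
  assumes u0: "\<And>es D. set es \<subseteq> V \<Longrightarrow> distinct es \<Longrightarrow> margin (degl es) D \<Longrightarrow>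
      codim_le (G (\<lambda>_. 0) (degl es) D) D (I (sysl es u0) D)"
    and "set es \<subseteq> V" "distinct es" "margin (degl es) D"
  shows "near T u0 (\<lambda>u. mp.dim (I (sysl es u) D) + G (\<lambda>_. 0) (degl es) D = mp.dim (P D))"
  using assms(2-)
proof (induction es arbitrary: D)
  case Nil
  have "mp.dim {0 :: gpoly} = 0"
    by (metis mp.dim_eq_card_independent mp.independent_empty mp.dim_span mp.span_empty card.empty)
  then show ?case by (intro near_always) (simp add: sysl_def degl_def dim_P)
next
  case (Cons e es)
  let ?\<delta> = "nb (fst e)"
  let ?D = "degs ?\<delta> D"
  have m: "margin (?\<delta> # degl es) D" using Cons.prems by (simp add: degl_def)
  have D: "D q \<ge> 1" for q by (rule margin_pos[OF m])
  have m1: "margin (degl es) D" by (rule margin_Cons[OF m])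
  have m2: "margin (degl es) ?D"
    using m by (auto simp: margin_def degs_def less_diff_conv add.commute)
  have D2: "?D q \<ge> 1" for q by (rule margin_pos[OF m2])
  have G: "G (\<lambda>_. 0) (degl es) D = G (\<lambda>_. 0) (degl (e # es)) D + G (\<lambda>_. 0) (degl es) ?D"
    using G_Cons[OF m, of "\<lambda>_. 0"] set_degl[of "e # es"] by (simp add: degl_def)
  obtain B where B: "finite B" "B \<subseteq> P D" "card B \<le> G (\<lambda>_. 0) (degl (e # es)) D"
    "\<forall>p\<in>P D. \<exists>b\<in>mp.span B. p - b \<in> I (sysl (e # es) u0) D"
    using u0[of "e # es" D] Cons.prems unfolding codim_le_def by auto
  have "near T u0 (\<lambda>u. \<forall>p\<in>P D. \<exists>w\<in>mp.span B. p - w \<in> I (sysl (e # es) u) D)"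
    using Cons.prems B by (intro near_span_modulo D) auto
  moreover have "near T u0 (\<lambda>u. mp.dim (I (sysl es u) D) + G (\<lambda>_. 0) (degl es) D = mp.dim (P D))"
    using Cons.prems m1 by (intro Cons.IH) auto
  moreover have "near T u0 (\<lambda>u. mp.dim (I (sysl es u) ?D) + G (\<lambda>_. 0) (degl es) ?D = mp.dim (P ?D))"
    using Cons.prems m2 by (intro Cons.IH) auto
  ultimately have "near T u0 (\<lambda>u. (\<forall>p\<in>P D. \<exists>w\<in>mp.span B. p - w \<in> I (sysl (e # es) u) D) \<and>
      mp.dim (I (sysl es u) D) + G (\<lambda>_. 0) (degl es) D = mp.dim (P D) \<and>
      mp.dim (I (sysl es u) ?D) + G (\<lambda>_. 0) (degl es) ?D = mp.dim (P ?D))"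
    by (intro near_conj)
  then show ?case
  proof (rule near_mono, elim conjE)
    fix u
    assume sp: "\<forall>p\<in>P D. \<exists>w\<in>mp.span B. p - w \<in> I (sysl (e # es) u) D"
      and d1: "mp.dim (I (sysl es u) D) + G (\<lambda>_. 0) (degl es) D = mp.dim (P D)"
      and d2: "mp.dim (I (sysl es u) ?D) + G (\<lambda>_. 0) (degl es) ?D = mp.dim (P ?D)"
    have "mp.dim (P D) \<le> card B + mp.dim (I (sysl (e # es) u) D)"
    proof (rule mp.dim_le_card_plus[OF B(1) _ finite_dim_P(2)])
      have "I (sysl (e # es) u) D \<subseteq> P D" by (rule I_subset_P[OF wf_sysl dominated_sysl[OF D]])
      then show "I (sysl (e # es) u) D \<subseteq> mp.span (mon ` Mon (\<lambda>_. 0) D)" by (simp only: P_eq_span)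
    qed (use sp in blast)
    moreover have "mp.dim (I (sysl (e # es) u) D) + mp.dim (I (sysl es u) ?D) \<le>
        mp.dim (I (sysl es u) D) + mp.dim (P ?D)"
    proof -
      have "count_list ?\<delta> q \<le> D q" for q using D[of q] by (simp add: count_nb)
      then have "mp.dim (I ((indiff_poly E k u e, ?\<delta>) # sysl es u) D) + mp.dim (I (sysl es u) ?D) \<le>
          mp.dim (I (sysl es u) D) + mp.dim (P ?D)"
        by (intro dim_I_Cons indiff_poly_in_P wf_sysl dominated_sysl D D2)
      then show ?thesis by (simp add: sysl_def)
    qed
    ultimately show "mp.dim (I (sysl (e # es) u) D) + G (\<lambda>_. 0) (degl (e # es)) D = mp.dim (P D)"
      using B(3) d1 d2 G by linarith
  qed
qed

end

section \<open>The product system\<close>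

text \<open>A sum of multiples of the Lagrange polynomials of the points.\<close>

lemma separating_polynomial:
  fixes S :: "('v \<Rightarrow> complex) set"
  assumes "finite S" "S \<subseteq> V \<rightarrow>\<^sub>E UNIV"
  obtains l where "l \<in> mpolys V" "inj_on (\<lambda>x. meval x l) S"
proof -
  have "\<exists>v\<in>V. x v \<noteq> y v" if "x \<in> S" "y \<in> S" "x \<noteq> y" for x y
    using that assms(2) by (metis PiE_ext subsetD)
  then obtain d where d: "\<And>x y. x \<in> S \<Longrightarrow> y \<in> S \<Longrightarrow> x \<noteq> y \<Longrightarrow> d x y \<in> V \<and> x (d x y) \<noteq> y (d x y)"
    by metis
  obtain f :: "('v \<Rightarrow> complex) \<Rightarrow> nat" where f: "inj_on f S"
    using finite_imp_inj_to_nat_seg[OF assms(1)] by blast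
  define h :: "('v \<Rightarrow> complex) \<Rightarrow> ('v, complex) mpoly" where
    "h x = (\<Prod>y\<in>S - {x}. Const (inverse (x (d x y) - y (d x y))) * (Var (d x y) - Const (y (d x y))))" for x
  define l where "l = (\<Sum>x\<in>S. Const (of_nat (f x)) * h x)"
  have h: "meval y (h x) = (if y = x then 1 else 0)" if "x \<in> S" "y \<in> S" for x y
  proof (cases "y = x")
    case True
    have "inverse (x (d x y) - y (d x y)) * (x (d x y) - y (d x y)) = 1" if "y \<in> S - {x}" for y
      using d[of x y] that \<open>x \<in> S\<close> by auto
    then show ?thesis unfolding True h_def by (simp add: meval_hom)
  next
    case False
    then show ?thesis using that assms(1) by (auto simp: h_def meval_hom intro!: prod_zero bexI[of _ y])
  qed
  have "meval y l = of_nat (f y)" if "y \<in> S" for y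
  proof -
    have "meval y l = (\<Sum>x\<in>S. if x = y then of_nat (f x) else 0)"
      unfolding l_def meval_hom by (intro sum.cong) (auto simp: h that)
    then show ?thesis using that assms(1) by simp
  qed
  then have "inj_on (\<lambda>x. meval x l) S" using f by (auto simp: inj_on_def)
  moreover have "l \<in> mpolys V" unfolding l_def h_def
    using d by (auto intro!: mpolys_sum mpolys_mult mpolys_prod mpolys_diff)
  ultimately show ?thesis using that by blast
qed

text \<open>With negative integers as roots no coefficient vanishes. This will keep the coordinates of the zeros
  of the product system away from 0.\<close>

lemma root_poly:
  fixes A :: "complex set"
  assumes "finite A"
  shows "degree (\<Prod>b\<in>A. [:- b, 1:]) = card A" "coeff (\<Prod>b\<in>A. [:- b, 1:]) (card A) = 1"
    and "(\<And>b. b \<in> A \<Longrightarrow> \<exists>n::nat. n > 0 \<and> b = - of_nat n) \<Longrightarrow> i \<le> card A \<Longrightarrow>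
      \<exists>m::nat. m > 0 \<and> coeff (\<Prod>b\<in>A. [:- b, 1:]) i = of_nat m"
proof -
  have "degree (\<Prod>b\<in>A. [:- b, 1:]) = card A \<and> coeff (\<Prod>b\<in>A. [:- b, 1:]) (card A) = 1"
    using assms
  proof (induction A)
    case (insert b A)
    let ?p = "\<Prod>b\<in>A. [:- b, 1:]"
    have "?p \<noteq> 0" using insert by auto
    then have "degree ([:- b, 1:] * ?p) = Suc (card A)" using insert by (subst degree_mult_eq) auto
    moreover have "coeff ?p (Suc (card A)) = 0" using insert by (intro coeff_eq_0) auto
    ultimately show ?case using insert by (simp del: mult_pCons_left) simp
  qed simp
  then show deg: "degree (\<Prod>b\<in>A. [:- b, 1:]) = card A" and "coeff (\<Prod>b\<in>A. [:- b, 1:]) (card A) = 1"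
    by auto
  show "\<exists>m::nat. m > 0 \<and> coeff (\<Prod>b\<in>A. [:- b, 1:]) i = of_nat m"
    if "\<And>b. b \<in> A \<Longrightarrow> \<exists>n::nat. n > 0 \<and> b = - of_nat n" "i \<le> card A"
  proof -
    have "\<exists>M::nat \<Rightarrow> nat. \<forall>i. coeff (\<Prod>b\<in>A. [:- b, 1:]) i = of_nat (M i) \<and> (i \<le> card A \<longrightarrow> M i > 0)"
      using assms that(1)
    proof (induction A)
      case empty
      show ?case by (intro exI[of _ "\<lambda>i. if i = 0 then 1 else 0"]) simp
    next
      case (insert b A)
      let ?p = "\<Prod>b\<in>A. [:- b, 1:]"
      obtain n :: nat where n: "n > 0" "b = - of_nat n" using insert.prems by blast
      obtain M :: "nat \<Rightarrow> nat" where M: "\<And>i. coeff ?p i = of_nat (M i)" "\<And>i. i \<le> card A \<Longrightarrow> M i > 0"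
        using insert.IH insert.prems by blast
      define M' where "M' i = n * M i + (if i = 0 then 0 else M (i - 1))" for i
      have "coeff (\<Prod>b\<in>insert b A. [:- b, 1:]) i = of_nat (M' i)" for i
        using insert.hyps n(2) M(1) by (cases i) (auto simp: M'_def)
      moreover have "M' i > 0" if "i \<le> card (insert b A)" for i
        using M(2)[of i] M(2)[of "i - 1"] n(1) that insert.hyps by (cases "i \<le> card A") (auto simp: M'_def)
      ultimately show ?case by blast
    qed
    then show ?thesis using that(2) by blast
  qed
qed

context game
begin

text \<open>The places at which the monic polynomials are evaluated. Different equations get different places,
  and all of them are negative so that the zeros of the product system have no vanishing coordinate.\<close>

definition par :: "nat \<times> nat \<Rightarrow> complex" where
  "par e = - of_nat (Suc (prod_encode e))"

lemma par_inj: "par e = par e' \<longleftrightarrow> e = e'"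
proof
  assume "par e = par e'"
  then have "Suc (prod_encode e) = Suc (prod_encode e')"
    unfolding par_def neg_equal_iff_equal of_nat_eq_iff .
  then have "prod_encode e = prod_encode e'" by simp
  then show "e = e'" using inj_prod_encode[of UNIV] by (auto dest: injD)
qed simp

text \<open>The coefficients of \<open>lin b q\<close> in terms of the probabilities of the strategies \<open>0, \<dots>, k q\<close>, where the
  constant \<open>b ^ k q\<close> is spread over all strategies because the probabilities add up to 1.\<close>

definition co :: "complex \<Rightarrow> nat \<Rightarrow> nat \<Rightarrow> complex" where
  "co b q t = b ^ k q + (if t = 0 then 0 else b ^ (t - 1))"

lemma lin_strat: "lin b q = (\<Sum>t\<in>{0..k q}. Const (co b q t) * strat_poly k q t)"
proof -
  have "lin b q = (\<Sum>s<k q. Const (b ^ s) * X q s) + Const (b ^ k q) * X q (k q)"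
    unfolding lin_def lessThan_Suc_atMost[symmetric] by simp
  also have "\<dots> = (\<Sum>s<k q. Const (b ^ s) * Var (q, Suc s)) + Const (b ^ k q)"
    by (simp add: X_def)
  also have "(\<Sum>s<k q. Const (b ^ s) * Var (q, Suc s)) = (\<Sum>t\<in>{1..k q}. Const (b ^ (t - 1)) * Var (q, t))"
    using sum.atLeast1_atMost_eq[of "\<lambda>t. Const (b ^ (t - 1)) * Var (q, t)" "k q"] by simp
  finally have 1: "lin b q = (\<Sum>t\<in>{1..k q}. Const (b ^ (t - 1)) * Var (q, t)) + Const (b ^ k q)" .
  have "{0..k q} = insert 0 {1..k q}" by auto
  then have "(\<Sum>t\<in>{0..k q}. Const (co b q t) * strat_poly k q t) =
      Const (b ^ k q) * (1 - (\<Sum>t\<in>{1..k q}. Var (q, t))) + (\<Sum>t\<in>{1..k q}. Const (co b q t) * strat_poly k q t)"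
    by (simp add: co_def strat_poly_def)
  also have "(\<Sum>t\<in>{1..k q}. Const (co b q t) * strat_poly k q t) =
      Const (b ^ k q) * (\<Sum>t\<in>{1..k q}. Var (q, t)) + (\<Sum>t\<in>{1..k q}. Const (b ^ (t - 1)) * Var (q, t))"
    unfolding sum_distrib_left sum.distrib[symmetric]
    by (intro sum.cong) (auto simp: co_def strat_poly_def Const_add distrib_right)
  finally show ?thesis unfolding 1 by (simp add: right_diff_distrib)
qed

definition u0 :: "entry \<Rightarrow> complex" where
  "u0 = (\<lambda>x\<in>T. case x of (i, s, \<alpha>) \<Rightarrow>
     if s = 0 then 0 else \<Prod>q\<in>in_nbrs E i. co (par (i, s)) q (\<alpha> q))"

lemma indiff_u0:
  assumes "e \<in> V"
  shows "indiff_poly E k u0 e = (\<Prod>q\<in>in_nbrs E (fst e). lin (par e) q)"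
proof -
  obtain i s where e: "e = (i, s)" by force
  have ran: "i \<in> {1..N}" "s \<in> {1..k i}" using assms e by (auto simp: slots_def)
  have "indiff_poly E k u0 e = (\<Sum>\<alpha>\<in>nbr_profiles E k i. \<Prod>q\<in>in_nbrs E i. Const (co (par e) q (\<alpha> q)) * strat_poly k q (\<alpha> q))"
    unfolding e indiff_poly_def prod.case
  proof (intro sum.cong refl)
    fix \<alpha> assume "\<alpha> \<in> nbr_profiles E k i"
    then have "u0 (i, s, \<alpha>) = (\<Prod>q\<in>in_nbrs E i. co (par (i, s)) q (\<alpha> q))" "u0 (i, 0, \<alpha>) = 0"
      using ran by (auto simp: u0_def entries_def)
    then show "Const (u0 (i, s, \<alpha>) - u0 (i, 0, \<alpha>)) * (\<Prod>q\<in>in_nbrs E i. strat_poly k q (\<alpha> q)) =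
       (\<Prod>q\<in>in_nbrs E i. Const (co (par (i, s)) q (\<alpha> q)) * strat_poly k q (\<alpha> q))"
      by (simp add: Const_prod prod.distrib)
  qed
  also have "\<dots> = (\<Prod>q\<in>in_nbrs E i. \<Sum>t\<in>{0..k q}. Const (co (par e) q t) * strat_poly k q t)"
    unfolding nbr_profiles_def by (rule prod_sum_PiE[symmetric]) (auto simp: finite_in_nbrs)
  finally show ?thesis by (simp add: e lin_strat)
qed

lemma codim_u0:
  assumes "set es \<subseteq> V" "distinct es" "margin (degl es) D"
  shows "codim_le (G (\<lambda>_. 0) (degl es) D) D (I (sysl es u0) D)"
proof -
  let ?fs = "map (\<lambda>e. (par e, nb (fst e))) es"
  have snd: "map snd ?fs = degl es" by (simp add: degl_def)
  have lp: "lin_prod b (nb i) = (\<Prod>q\<in>in_nbrs E i. lin b q)" for b i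
    unfolding lin_prod_def using prod.distinct_set_conv_list[OF distinct_nb, of "lin b" i] by simp
  have "sysl es u0 = prods ?fs"
    using assms(1) by (auto simp: sysl_def prods_def lp indiff_u0)
  moreover have "codim_le (G (cnt []) (map snd ?fs) D) D (I (prods ?fs @ singles []) D)"
  proof (rule codim_prods)
    have "map fst ?fs = map par es" by simp
    moreover have "inj_on par (set es)" by (auto simp: inj_on_def par_inj)
    ultimately show "distinct (map fst ?fs @ map fst [])" using assms(2) by (simp add: distinct_map comp_def)
  qed (use assms(3) set_degl[of es] snd in auto)
  moreover have "cnt [] = (\<lambda>_. 0)" by (auto simp: cnt_def)
  ultimately show ?thesis unfolding snd by (simp add: singles_def)
qed

definition eqs :: "(nat \<times> nat) list" where
  "eqs = (SOME es. set es = V \<and> distinct es)"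

lemma finite_slots: "finite V" by (auto simp: slots_def)

lemma eqs: "set eqs = V" "distinct eqs"
proof -
  have "\<exists>es. set es = V \<and> distinct es" using finite_distinct_list[OF finite_slots] .
  then have "set eqs = V \<and> distinct eqs" unfolding eqs_def by (rule someI_ex)
  then show "set eqs = V" "distinct eqs" by auto
qed

abbreviation sys where "sys \<equiv> sysl eqs"
abbreviation cs where "cs \<equiv> choices (\<lambda>_. 0) (degl eqs)"
definition m where "m = card cs"

lemma length_eqs: "length eqs = (\<Sum>q\<in>{1..N}. k q)"
proof -
  have "length eqs = card V" using eqs distinct_card by metis
  then show ?thesis by (simp add: slots_def)
qed

lemma G_eq_m: "G (\<lambda>_. 0) (degl eqs) D = m"
  unfolding m_def using set_degl[of eqs] length_eqs
  by (intro G_eq_card_choices) (auto simp: degl_def)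

abbreviation pows :: "gpoly \<Rightarrow> gpoly set" where "pows l \<equiv> (\<lambda>j. l ^ j) ` {..<m}"

abbreviation reduces :: "gpoly \<Rightarrow> nat \<Rightarrow> (entry \<Rightarrow> complex) \<Rightarrow> bool" where
  "reduces l d u \<equiv> \<forall>p\<in>P (\<lambda>_. d). \<exists>w\<in>mp.span (pows l). p - w \<in> I (sys u) (\<lambda>_. d)"

text \<open>The places that a choice \<open>c\<close> assigns to player \<open>q\<close>. At the point \<open>pt c\<close> they are the roots of the
  monic polynomial of \<open>q\<close>.\<close>

definition params :: "nat list \<Rightarrow> nat \<Rightarrow> complex set" where
  "params c q = (\<lambda>j. par (eqs ! j)) ` {j. j < length eqs \<and> c ! j = q}"

definition pt :: "nat list \<Rightarrow> nat \<times> nat \<Rightarrow> complex" where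
  "pt c = (\<lambda>v\<in>V. coeff (\<Prod>b\<in>params c (fst v). [:- b, 1:]) (snd v - 1))"

lemma finite_params: "finite (params c q)" by (simp add: params_def)

lemma choice_length: "c \<in> cs \<Longrightarrow> length c = length eqs"
  by (auto simp: choices_def degl_def dest: list_all2_lengthD)

lemma params_card:
  assumes "c \<in> cs" "q \<in> {1..N}" shows "card (params c q) = k q"
proof -
  have "inj_on (\<lambda>j. par (eqs ! j)) {j. j < length eqs \<and> c ! j = q}"
    using eqs(2) by (auto simp: inj_on_def par_inj nth_eq_iff_index_eq)
  then have "card (params c q) = card {j. j < length c \<and> c ! j = q}"
    unfolding params_def by (simp add: card_image choice_length[OF assms(1)])
  also have "\<dots> = count_list c q"
    by (simp add: count_list_eq_length_filter length_filter_conv_card eq_commute)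
  also have "\<dots> = k q" using assms by (auto simp: choices_def)
  finally show ?thesis .
qed

lemma meval_lin_pt:
  assumes "c \<in> cs" "q \<in> {1..N}"
  shows "meval (pt c) (lin b q) = (\<Prod>a\<in>params c q. b - a)"
proof -
  let ?Q = "\<Prod>b\<in>params c q. [:- b, 1:]"
  have deg: "degree ?Q = k q" and lead: "coeff ?Q (k q) = 1"
    using root_poly(1,2)[OF finite_params, of c q] params_card[OF assms] by auto
  have "meval (pt c) (X q s) = coeff ?Q s" if "s \<le> k q" for s
    using that assms(2) lead by (auto simp: X_def pt_def slots_def)
  then have "meval (pt c) (lin b q) = (\<Sum>s\<le>k q. b ^ s * coeff ?Q s)"
    unfolding lin_def meval_hom by (intro sum.cong) auto
  also have "\<dots> = poly ?Q b" unfolding poly_altdef deg by (simp add: mult.commute)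
  finally show ?thesis by (simp add: poly_prod)
qed

lemma pt_zero:
  assumes "c \<in> cs" "e \<in> V" shows "meval (pt c) (indiff_poly E k u0 e) = 0"
proof -
  obtain j where j: "j < length eqs" "e = eqs ! j" using assms(2) eqs(1) by (metis in_set_conv_nth)
  have "c ! j \<in> set (degl eqs ! j)"
    using assms(1) j choice_length[OF assms(1)] by (auto simp: choices_def list_all2_conv_all_nth)
  then have q: "c ! j \<in> in_nbrs E (fst e)" using j by (simp add: degl_def)
  then have "c ! j \<in> {1..N}" using in_nbrs_subset by blast
  then have "meval (pt c) (lin (par e) (c ! j)) = 0"
    using j by (auto simp: meval_lin_pt[OF assms(1)] params_def finite_params intro!: prod_zero)
  then show ?thesis
    unfolding indiff_u0[OF assms(2)] meval_hom using q finite_in_nbrs by (intro prod_zero) auto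
qed

lemma pt_nonzero:
  assumes "c \<in> cs" "v \<in> V" shows "pt c v \<noteq> 0"
proof -
  obtain q t where v: "v = (q, t)" "q \<in> {1..N}" "t \<in> {1..k q}" using assms(2) by (auto simp: slots_def)
  have "\<exists>n::nat. n > 0 \<and> b = - of_nat n" if "b \<in> params c q" for b
  proof -
    obtain j where "b = par (eqs ! j)" using \<open>b \<in> params c q\<close> by (auto simp: params_def)
    then show ?thesis by (intro exI[of _ "Suc (prod_encode (eqs ! j))"]) (simp add: par_def)
  qed
  moreover have "t - 1 \<le> card (params c q)" using params_card[OF assms(1) v(2)] v(3) by auto
  ultimately have "\<exists>m::nat. m > 0 \<and> coeff (\<Prod>b\<in>params c q. [:- b, 1:]) (t - 1) = of_nat m"
    by (rule root_poly(3)[OF finite_params])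
  then obtain m' :: nat where "m' > 0" "coeff (\<Prod>b\<in>params c q. [:- b, 1:]) (t - 1) = of_nat m'" by blast
  then show ?thesis using v assms(2) by (simp add: pt_def)
qed

lemma pt_inj: "inj_on pt cs"
proof (rule inj_onI)
  fix c c' assume c: "c \<in> cs" "c' \<in> cs" "pt c = pt c'"
  show "c = c'"
  proof (rule nth_equalityI)
    show "length c = length c'" using c choice_length by simp
    fix j assume "j < length c"
    then have j: "j < length eqs" using choice_length c by simp
    have "c ! j \<in> set (degl eqs ! j)"
      using c(1) j choice_length[OF c(1)] by (auto simp: choices_def list_all2_conv_all_nth)
    then have "c ! j \<in> in_nbrs E (fst (eqs ! j))" using j by (simp add: degl_def)
    then have q: "c ! j \<in> {1..N}" using in_nbrs_subset by blast
    have "meval (pt c) (lin (par (eqs ! j)) (c ! j)) = 0"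
      using j by (auto simp: meval_lin_pt[OF c(1) q] params_def finite_params intro!: prod_zero)
    then have "(\<Prod>a\<in>params c' (c ! j). par (eqs ! j) - a) = 0"
      using c(3) by (simp add: meval_lin_pt[OF c(2) q])
    then have "par (eqs ! j) \<in> params c' (c ! j)" using finite_params by (auto simp: prod_zero_iff)
    then obtain j' where "j' < length eqs" "c' ! j' = c ! j" "eqs ! j' = eqs ! j"
      by (auto simp: params_def par_inj)
    then show "c ! j = c' ! j" using eqs(2) j by (simp add: nth_eq_iff_index_eq)
  qed
qed

lemma I_vanish:
  assumes "\<And>e. e \<in> V \<Longrightarrow> meval x (indiff_poly E k u e) = 0" "p \<in> I (sys u) D"
  shows "meval x p = 0"
proof -
  have "mp.subspace {p. meval x p = 0}"
    by (intro mp.subspaceI) (auto simp: meval_hom)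
  moreover have "f * h \<in> {p. meval x p = 0}" if "(f, \<delta>) \<in> set (sys u)" for f \<delta> h
    using that assms(1) eqs(1) by (auto simp: sysl_def meval_hom)
  ultimately have "I (sys u) D \<subseteq> {p. meval x p = 0}" by (rule I_least)
  then show ?thesis using assms(2) by auto
qed

lemma finite_cs: "finite cs" by (rule finite_choices)

lemma P_power: "p \<in> P (\<lambda>_. d) \<Longrightarrow> p ^ j \<in> P (\<lambda>_. j * d)"
proof (induction j)
  case (Suc j)
  then have "p * p ^ j \<in> P (\<lambda>_. Suc j * d)" by (intro P_mult[of p "\<lambda>_. d" _ "\<lambda>_. j * d"]) auto
  then show ?case by simp
qed simp

text \<open>A polynomial \<open>l\<close> that separates the zeros of the product system, together with a degree
  bound beyond which the truncated ideals of nearby systems are under control.\<close>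

lemma generic_structure:
  obtains l d0 where "l \<in> P (\<lambda>_. d0)" "d0 \<ge> 1" "l ^ m \<in> P (\<lambda>_. d0)"
    "\<And>d. d \<ge> d0 \<Longrightarrow> near T u0 (\<lambda>u. reduces l d u)"
    "\<And>d. d \<ge> d0 \<Longrightarrow> near T u0 (\<lambda>u. mp.dim (I (sys u) (\<lambda>_. d)) + m = mp.dim (P (\<lambda>_. d)))"
    "near T u0 (\<lambda>u. \<forall>v\<in>V. \<exists>h. 1 - Var v * h \<in> I (sys u) (\<lambda>_. d0))"
proof -
  have "pt ` cs \<subseteq> V \<rightarrow>\<^sub>E UNIV" by (auto simp: pt_def)
  then obtain l where l: "l \<in> mpolys V" "inj_on (\<lambda>x. meval x l) (pt ` cs)"
    using separating_polynomial[of "pt ` cs"] finite_cs by blast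
  define val where "val c = meval (pt c) l" for c
  have inj: "inj_on val cs" using comp_inj_on[OF pt_inj l(2)] by (simp add: val_def[abs_def] comp_def)
  have card_val: "card (val ` cs) = m" by (simp add: m_def card_image[OF inj])
  obtain d1 where d1: "\<And>D. (\<And>q. D q \<ge> d1) \<Longrightarrow> l \<in> P D" using mpolys_in_P[OF l(1)] by metis
  \<comment> \<open>Room for the powers of \<open>l\<close> up to \<open>m\<close>, even if one degree is lowered by 1, and for the margin.\<close>
  define d0 where "d0 = Suc (m * d1) + d1 + Suc (length (concat (degl eqs)))"
  have pow: "l ^ j \<in> P D" if "j \<le> m" "\<And>q. D q \<ge> d0 - 1" for j D
  proof -
    have "l ^ j \<in> P (\<lambda>_. j * d1)" by (intro P_power d1) simp
    also have "P (\<lambda>_. j * d1) \<subseteq> P D"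
    proof (rule P_mono)
      fix q
      have "j * d1 \<le> m * d1" using that(1) by simp
      also have "\<dots> \<le> d0 - 1" by (simp add: d0_def)
      finally show "j * d1 \<le> D q" using that(2)[of q] by linarith
    qed
    finally show ?thesis .
  qed
  have marg: "margin (degl eqs) D" if "\<And>q. D q \<ge> d0" for D
  proof -
    have "count_list (concat (degl eqs)) q < D q" for q
      using count_le_length[of "concat (degl eqs)" q] that[of q] by (simp add: d0_def)
    then show ?thesis by (simp add: margin_def)
  qed
  have poly_in: "(\<Sum>j<m. Const (c j) * l ^ j) \<in> P D" if "\<And>q. D q \<ge> d0 - 1" for c D
    by (intro P_sum P_scale pow that) auto
  have interp: "\<exists>c. \<forall>s\<in>cs. meval (pt s) (\<Sum>j<m. Const (c j) * l ^ j) = y s" for y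
  proof -
    obtain c where c: "\<And>b. b \<in> val ` cs \<Longrightarrow> (\<Sum>j<card (val ` cs). c j * b ^ j) = y (the_inv_into cs val b)"
      using vandermonde_surj[of "val ` cs" "\<lambda>b. y (the_inv_into cs val b)"] finite_cs by blast
    have "meval (pt s) (\<Sum>j<m. Const (c j) * l ^ j) = y s" if "s \<in> cs" for s
    proof -
      have "meval (pt s) (\<Sum>j<m. Const (c j) * l ^ j) = (\<Sum>j<m. c j * val s ^ j)"
        by (simp add: meval_hom val_def)
      also have "\<dots> = y s" using c[of "val s"] that by (simp add: card_val the_inv_into_f_f[OF inj])
      finally show ?thesis .
    qed
    then show ?thesis by blast
  qed
  \<comment> \<open>Otherwise \<open>p\<close> and the powers of \<open>l\<close> below \<open>m\<close> would be \<open>m + 1\<close> independent vectors modulo the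
    ideal: the evaluations at the \<open>m\<close> points separate the powers by a Vandermonde argument.\<close>
  have key: "p \<in> I (sys u0) D" if D: "\<And>q. D q \<ge> d0" and p: "p \<in> P D"
    and van: "\<And>s. s \<in> cs \<Longrightarrow> meval (pt s) p = 0" for D p
  proof (rule ccontr)
    assume np: "p \<notin> I (sys u0) D"
    have D1: "D q \<ge> d0 - 1" "D q \<ge> 1" for q using D[of q] by (auto simp: d0_def)
    have IP: "I (sys u0) D \<subseteq> P D" by (rule I_subset_P[OF wf_sysl dominated_sysl[OF D1(2)]])
    define w where "w j = (if j < m then l ^ j else p)" for j
    have "Suc m + mp.dim (I (sys u0) D) \<le> mp.dim (P D)"
    proof (rule mp.card_plus_dim_le[where w = w])
      show "P D \<subseteq> mp.span (mon ` Mon (\<lambda>_. 0) D)" "finite (mon ` Mon (\<lambda>_. 0) D :: gpoly set)"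
        by (rule finite_dim_P)+
      show "w j \<in> P D" if "j < Suc m" for j using pow[of j D] D1 p by (auto simp: w_def)
      fix c j assume s: "(\<Sum>j<Suc m. Const (c j) * w j) \<in> I (sys u0) D" and j: "j < Suc m"
      have sw: "(\<Sum>j<Suc m. Const (c j) * w j) = (\<Sum>j<m. Const (c j) * l ^ j) + Const (c m) * p"
        by (simp add: w_def)
      have c0: "c i = 0" if "i < m" for i
      proof (rule vandermonde_inj[of "val ` cs" m c])
        fix b assume "b \<in> val ` cs"
        then obtain x where x: "x \<in> cs" "b = val x" by blast
        have "meval (pt x) (\<Sum>j<Suc m. Const (c j) * w j) = 0"
          by (rule I_vanish[OF _ s]) (rule pt_zero[OF x(1)])
        then show "(\<Sum>j<m. c j * b ^ j) = 0"
          unfolding sw using van[OF x(1)] x(2) by (simp add: meval_hom val_def)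
      qed (use finite_cs card_val that in auto)
      have "Const (c m) * p \<in> I (sys u0) D" using s c0 unfolding sw by simp
      then have "c m = 0"
        using np I_scale[of "Const (c m) * p" "sys u0" D "inverse (c m)"]
        by (cases "c m = 0") (auto simp flip: mult.assoc Const_mult)
      then show "c j = 0" using c0 j by (cases "j = m") auto
    qed (use subspace_I IP in auto)
    moreover have "mp.dim (P D) \<le> m + mp.dim (I (sys u0) D)"
    proof -
      obtain B where B: "finite B" "card B \<le> m" "\<forall>p\<in>P D. \<exists>b\<in>mp.span B. p - b \<in> I (sys u0) D"
        using codim_u0[of eqs D] marg[OF D] eqs unfolding codim_le_def G_eq_m by auto
      have "mp.dim (P D) \<le> card B + mp.dim (I (sys u0) D)"
        by (rule mp.dim_le_card_plus[OF B(1) order_trans[OF IP finite_dim_P(1)] finite_dim_P(2)])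
          (use B(3) in blast)
      then show ?thesis using B(2) by simp
    qed
    ultimately show False by simp
  qed
  have D0: "d0 \<ge> 1" by (simp add: d0_def)
  show ?thesis
  proof (rule that)
    show "d0 \<ge> 1" by (rule D0)
    show "l \<in> P (\<lambda>_. d0)" by (rule d1) (simp add: d0_def)
    show "l ^ m \<in> P (\<lambda>_. d0)" by (rule pow) auto
  next
    fix d assume d: "d \<ge> d0"
    show "near T u0 (\<lambda>u. reduces l d u)"
    proof (rule near_span_modulo)
      show "pows l \<subseteq> P (\<lambda>_. d)"
      proof (intro image_subsetI)
        fix j assume "j \<in> {..<m}"
        then show "l ^ j \<in> P (\<lambda>_. d)" using d by (intro pow) auto
      qed
      show "\<forall>p\<in>P (\<lambda>_. d). \<exists>w\<in>mp.span (pows l). p - w \<in> I (sys u0) (\<lambda>_. d)"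
      proof
        fix p assume p: "p \<in> P (\<lambda>_. d)"
        obtain c where c: "\<forall>s\<in>cs. meval (pt s) (\<Sum>j<m. Const (c j) * l ^ j) = meval (pt s) p"
          using interp[of "\<lambda>s. meval (pt s) p"] by blast
        have wP: "(\<Sum>j<m. Const (c j) * l ^ j) \<in> P (\<lambda>_. d)" using d by (intro poly_in) simp
        have "p - (\<Sum>j<m. Const (c j) * l ^ j) \<in> I (sys u0) (\<lambda>_. d)"
        proof (rule key)
          show "p - (\<Sum>j<m. Const (c j) * l ^ j) \<in> P (\<lambda>_. d)" using p wP by (rule P_diff)
          fix s assume "s \<in> cs"
          then have "meval (pt s) (\<Sum>j<m. Const (c j) * l ^ j) = meval (pt s) p" using c by blast
          then show "meval (pt s) (p - (\<Sum>j<m. Const (c j) * l ^ j)) = 0" unfolding meval_hom(6) by simp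
        qed (use d in auto)
        moreover have "(\<Sum>j<m. Const (c j) * l ^ j) \<in> mp.span (pows l)"
          by (intro mp.span_sum mp.span_scale mp.span_base imageI) auto
        ultimately show "\<exists>w\<in>mp.span (pows l). p - w \<in> I (sys u0) (\<lambda>_. d)" by blast
      qed
    qed (use d D0 eqs in auto)
    show "near T u0 (\<lambda>u. mp.dim (I (sys u) (\<lambda>_. d)) + m = mp.dim (P (\<lambda>_. d)))"
      using near_dim[of u0 eqs "\<lambda>_. d", OF codim_u0] eqs marg[of "\<lambda>_. d"] d by (simp add: G_eq_m)
  next
    show "near T u0 (\<lambda>u. \<forall>v\<in>V. \<exists>h. 1 - Var v * h \<in> I (sys u) (\<lambda>_. d0))"
    proof (rule near_ball[OF finite_slots])
      fix v assume v: "v \<in> V"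
      obtain q t where qt: "v = (q, t)" "q \<in> {1..N}" using v by (auto simp: slots_def)
      let ?D = "(\<lambda>_. d0)(q := d0 - 1)"
      let ?W = "(\<lambda>\<mu>. Var v * mon \<mu>) ` Mon (\<lambda>_. 0) ?D"
      have VW: "Var v * h \<in> mp.span ?W" if "h \<in> P ?D" for h
      proof -
        have "P ?D \<subseteq> {h. Var v * h \<in> mp.span ?W}"
          unfolding P_eq_span
          by (intro mp.span_minimal subspace_mult_preimage mp.subspace_span)
             (auto intro: mp.span_base)
        then show ?thesis using that by auto
      qed
      have VP: "Var v * h \<in> P (\<lambda>_. d0)" if "h \<in> P ?D" for h
      proof (rule P_mult[OF _ that])
        show "Var v \<in> P (\<lambda>q'. if q' = q then 1 else 0)"
          unfolding qt(1) by (rule Var_in_P) (use v qt in auto)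
      qed (use D0 in auto)
      have "near T u0 (\<lambda>u. \<forall>p\<in>P (\<lambda>_. d0). \<exists>w\<in>mp.span ?W. p - w \<in> I (sys u) (\<lambda>_. d0))"
      proof (rule near_span_modulo)
        show "?W \<subseteq> P (\<lambda>_. d0)" by (intro image_subsetI VP mon_in_P)
        show "finite ?W" using finite_Mon by blast
        show "\<forall>p\<in>P (\<lambda>_. d0). \<exists>w\<in>mp.span ?W. p - w \<in> I (sys u0) (\<lambda>_. d0)"
        proof
          fix p assume p: "p \<in> P (\<lambda>_. d0)"
          obtain c where c: "\<forall>s\<in>cs. meval (pt s) (\<Sum>j<m. Const (c j) * l ^ j) = meval (pt s) p / pt s v"
            using interp[of "\<lambda>s. meval (pt s) p / pt s v"] by blast
          let ?h = "\<Sum>j<m. Const (c j) * l ^ j"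
          have h: "?h \<in> P ?D" by (intro poly_in) auto
          have "p - Var v * ?h \<in> I (sys u0) (\<lambda>_. d0)"
          proof (rule key)
            show "p - Var v * ?h \<in> P (\<lambda>_. d0)" using p VP[OF h] by (rule P_diff)
            fix s assume s: "s \<in> cs"
            then have "meval (pt s) ?h = meval (pt s) p / pt s v" using c by blast
            then show "meval (pt s) (p - Var v * ?h) = 0"
              unfolding meval_hom(6) meval_hom(2) using pt_nonzero[OF s v] by simp
          qed auto
          then show "\<exists>w\<in>mp.span ?W. p - w \<in> I (sys u0) (\<lambda>_. d0)" using VW[OF h] by blast
        qed
      qed (use D0 eqs in auto)
      then show "near T u0 (\<lambda>u. \<exists>h. 1 - Var v * h \<in> I (sys u) (\<lambda>_. d0))"
      proof (rule near_mono)
        fix u assume "\<forall>p\<in>P (\<lambda>_. d0). \<exists>w\<in>mp.span ?W. p - w \<in> I (sys u) (\<lambda>_. d0)"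
        then obtain w where w: "w \<in> mp.span ?W" "1 - w \<in> I (sys u) (\<lambda>_. d0)" by (meson one_in_P)
        have "mp.span ?W \<subseteq> range (\<lambda>h. Var v * h)"
        proof (rule mp.span_minimal)
          show "mp.subspace (range (\<lambda>h. Var v * h))"
          proof (rule mp.subspaceI)
            show "0 \<in> range (\<lambda>h. Var v * h)" by (rule range_eqI[of _ _ 0]) simp
          next
            fix x y :: "gpoly" assume "x \<in> range (\<lambda>h. Var v * h)" "y \<in> range (\<lambda>h. Var v * h)"
            then show "x + y \<in> range (\<lambda>h. Var v * h)" by (auto simp flip: distrib_left)
          next
            fix c and x :: "gpoly" assume "x \<in> range (\<lambda>h. Var v * h)"
            then obtain h where "x = Var v * h" by blast
            then show "Const c * x \<in> range (\<lambda>h. Var v * h)"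
              by (intro range_eqI[of _ _ "Const c * h"]) (simp only: mult.left_commute)
          qed
        qed auto
        then show "\<exists>h. 1 - Var v * h \<in> I (sys u) (\<lambda>_. d0)" using w by blast
      qed
    qed
  qed
qed

end

section \<open>Solutions of a generic system\<close>

text \<open>The properties of the tables near \<open>u0\<close> on which the solution count rests. In degree \<open>d0\<close> the powers
  of \<open>l\<close> give normal forms; the larger degree \<open>d2\<close> exceeds the truncations
  that occur when the equations and \<open>l\<close> are rewritten by normal forms and reduced modulo the
  relation between the powers of \<open>l\<close>, and so makes it possible to show that normal forms are unique.\<close>

locale good_table = game N k E for N k E +
  fixes u :: "entry \<Rightarrow> complex" and l :: "gpoly" and d0 d2 :: nat
  assumes l: "l \<in> P (\<lambda>_. d0)" and d0: "d0 \<ge> 1" and lm: "l ^ m \<in> P (\<lambda>_. d0)"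
    and d2: "d2 \<ge> d0 * (N * d0 + 1)" "d2 \<ge> d0 + (m * (N * d0) + 1) * d0"
    and span_d0: "reduces l d0 u"
    and span_d2: "reduces l d2 u"
    and dim_d2: "mp.dim (I (sys u) (\<lambda>_. d2)) + m = mp.dim (P (\<lambda>_. d2))"
    and unit_vars: "\<forall>v\<in>V. \<exists>h. 1 - Var v * h \<in> I (sys u) (\<lambda>_. d0)"
begin

definition at_l :: "complex poly \<Rightarrow> gpoly" where
  "at_l r = (\<Sum>i\<le>degree r. Const (coeff r i) * l ^ i)"

lemma at_l_le: "degree r \<le> n \<Longrightarrow> at_l r = (\<Sum>i\<le>n. Const (coeff r i) * l ^ i)"
  unfolding at_l_def by (intro sum.mono_neutral_left) (auto simp: coeff_eq_0)

lemma at_l_less: "(\<And>i. i \<ge> n \<Longrightarrow> coeff r i = 0) \<Longrightarrow> at_l r = (\<Sum>i<n. Const (coeff r i) * l ^ i)"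
  unfolding at_l_def
  by (rule sum.mono_neutral_cong) (auto simp: coeff_eq_0 not_less not_le)

lemma at_l_0 [simp]: "at_l 0 = 0" by (simp add: at_l_def)

lemma at_l_add: "at_l (p + q) = at_l p + at_l q"
proof -
  let ?n = "max (degree p) (degree q)"
  have "degree (p + q) \<le> ?n" by (rule degree_add_le_max)
  then show ?thesis
    by (simp add: at_l_le[of _ ?n] Const_add distrib_right sum.distrib)
qed

lemma at_l_smult: "at_l (smult c p) = Const c * at_l p"
proof -
  have "at_l (smult c p) = (\<Sum>i\<le>degree p. Const (coeff (smult c p) i) * l ^ i)"
    by (rule at_l_le[OF degree_smult_le])
  also have "\<dots> = Const c * at_l p"
    unfolding at_l_def sum_distrib_left by (simp only: coeff_smult Const_mult mult.assoc)
  finally show ?thesis .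
qed

lemma at_l_diff: "at_l (p - q) = at_l p - at_l q"
  using at_l_add[of "p - q" q] by simp

lemma at_l_pCons: "at_l (pCons a p) = Const a + l * at_l p"
proof -
  have "at_l (pCons a p) = (\<Sum>i\<le>Suc (degree p). Const (coeff (pCons a p) i) * l ^ i)"
    by (rule at_l_le) (rule degree_pCons_le)
  also have "\<dots> = Const a + (\<Sum>i\<le>degree p. Const (coeff p i) * l ^ Suc i)"
    unfolding sum.atMost_Suc_shift by simp
  also have "(\<Sum>i\<le>degree p. Const (coeff p i) * l ^ Suc i) = l * at_l p"
    by (simp add: at_l_def sum_distrib_left mult_ac)
  finally show ?thesis .
qed

lemma at_l_1 [simp]: "at_l 1 = 1" using at_l_pCons[of 1 0] by (simp add: one_pCons)

lemma at_l_mult: "at_l (p * q) = at_l p * at_l q"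
proof (induction p)
  case (pCons a p)
  then show ?case by (simp add: at_l_pCons at_l_add at_l_smult algebra_simps)
qed simp

lemma at_l_sum: "at_l (sum f A) = (\<Sum>a\<in>A. at_l (f a))"
  by (induction A rule: infinite_finite_induct) (auto simp: at_l_add)

lemma at_l_monom: "at_l (monom c j) = Const c * l ^ j"
proof (induction j)
  case 0
  then show ?case using at_l_pCons[of c 0] by (simp add: monom_0)
next
  case (Suc j)
  then show ?case by (simp add: monom_Suc at_l_pCons mult_ac)
qed

lemma l_mpolys: "l \<in> mpolys V" using l P_le_mpolys by blast

lemma at_l_mpolys: "at_l r \<in> mpolys V"
  unfolding at_l_def by (intro mpolys_sum mpolys_mult mpolys_power l_mpolys mpolys_Const)

lemma dom: "1 \<le> d \<Longrightarrow> dominated (sys u) (\<lambda>_. d)" by (rule dominated_sysl)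

lemma I_le: "d \<le> d' \<Longrightarrow> I (sys u) (\<lambda>_. d) \<subseteq> I (sys u) (\<lambda>_. d')" by (rule I_mono)

lemma I_P: "1 \<le> d \<Longrightarrow> I (sys u) (\<lambda>_. d) \<subseteq> P (\<lambda>_. d)"
  by (rule I_subset_P[OF wf_sysl dom])

definition red :: "gpoly \<Rightarrow> complex poly" where
  "red p = (SOME r. (\<forall>i\<ge>m. coeff r i = 0) \<and> p - at_l r \<in> I (sys u) (\<lambda>_. d0))"

lemma red:
  assumes "p \<in> P (\<lambda>_. d0)"
  shows "i \<ge> m \<Longrightarrow> coeff (red p) i = 0" and "p - at_l (red p) \<in> I (sys u) (\<lambda>_. d0)"
proof -
  obtain w where w: "w \<in> mp.span (pows l)" "p - w \<in> I (sys u) (\<lambda>_. d0)"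
    using span_d0 assms by blast
  obtain c where c: "w = (\<Sum>j<m. Const (c j) * l ^ j)"
    using span_image_finiteE[OF finite_lessThan w(1)] by blast
  let ?r = "\<Sum>j<m. monom (c j) j"
  have "at_l ?r = w" by (simp add: c at_l_sum at_l_monom)
  moreover have "\<forall>i\<ge>m. coeff ?r i = 0" by (auto simp: coeff_sum)
  ultimately have "\<exists>r. (\<forall>i\<ge>m. coeff r i = 0) \<and> p - at_l r \<in> I (sys u) (\<lambda>_. d0)"
    using w(2) by (intro exI[of _ ?r]) simp
  from someI_ex[OF this, folded red_def]
  show "i \<ge> m \<Longrightarrow> coeff (red p) i = 0" and "p - at_l (red p) \<in> I (sys u) (\<lambda>_. d0)" by auto
qed

text \<open>The normal forms of the variables as polynomials in \<open>l\<close>, the relation \<open>chi\<close> that expresses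
  \<open>l ^ m\<close> by lower powers, and the substitution \<open>Phi\<close> that will identify the quotient ring with \<open>\<complex>[T]\<close>
  modulo \<open>chi\<close>.\<close>

definition g :: "nat \<times> nat \<Rightarrow> complex poly" where "g v = red (Var v)"

definition chi :: "complex poly" where "chi = monom 1 m - red (l ^ m)"

definition Phi :: "gpoly \<Rightarrow> complex poly" where
  "Phi = peval (\<lambda>c. [:c:]) g"

lemmas Phi_hom = pv.peval_add[of g, folded Phi_def] pv.peval_mult[of g, folded Phi_def]
  pv.peval_sum[of g, folded Phi_def] pv.peval_diff[of g, folded Phi_def]

lemma Phi_simps [simp]: "Phi 0 = 0" "Phi 1 = 1" "Phi (Const c) = [:c:]" "Phi (Var v) = g v"
  by (simp_all add: Phi_def)

lemma chi_props: "degree chi = m" "coeff chi m = 1" "chi \<noteq> 0" "at_l chi \<in> I (sys u) (\<lambda>_. d0)"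
proof -
  have c: "coeff chi i = (if i = m then 1 else 0)" if "i \<ge> m" for i
    using red(1)[OF lm that] that by (auto simp: chi_def)
  show 1: "coeff chi m = 1" using c[of m] by simp
  then show "chi \<noteq> 0" by auto
  show "degree chi = m"
    by (rule antisym) (use c 1 in \<open>auto intro!: degree_le le_degree\<close>)
  show "at_l chi \<in> I (sys u) (\<lambda>_. d0)"
    using red(2)[OF lm] by (simp add: chi_def at_l_diff at_l_monom)
qed

lemma g_props:
  assumes "v \<in> V"
  shows "Var v - at_l (g v) \<in> I (sys u) (\<lambda>_. d0)" "degree (g v) \<le> m" "at_l (g v) \<in> P (\<lambda>_. d0)"
proof -
  have V: "Var v \<in> P (\<lambda>_. d0)" using Var_in_P[of "fst v" "snd v" "\<lambda>_. d0"] assms d0 by simp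
  show 1: "Var v - at_l (g v) \<in> I (sys u) (\<lambda>_. d0)" unfolding g_def by (rule red(2)[OF V])
  show "degree (g v) \<le> m" unfolding g_def by (rule degree_le) (auto intro: red(1)[OF V])
  have "Var v - (Var v - at_l (g v)) \<in> P (\<lambda>_. d0)" using P_diff[OF V subsetD[OF I_P[OF d0] 1]] .
  then show "at_l (g v) \<in> P (\<lambda>_. d0)" by simp
qed

text \<open>Substituting \<open>g\<close> changes a monomial only by an element of a truncated ideal, with a bound
  on the truncation that depends on the degree alone.\<close>

lemma substitute_monomial:
  assumes "keys \<mu> \<subseteq> V" "(\<Sum>v\<in>V. lkp \<mu> v) = n"
  shows "mon \<mu> \<in> P (\<lambda>_. d0 * n) \<and> mon \<mu> - at_l (Phi (mon \<mu>)) \<in> I (sys u) (\<lambda>_. d0 * (n + 1)) \<and>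
    degree (Phi (mon \<mu>)) \<le> m * n"
  using assms
proof (induction n arbitrary: \<mu>)
  case 0
  have "lkp \<mu> v = 0" for v
  proof (cases "v \<in> V")
    case True
    then show ?thesis using 0 finite_slots by simp
  next
    case False
    then show ?thesis using 0 by (auto simp: in_keys_iff)
  qed
  then have "\<mu> = 0" by (intro poly_mapping_eqI) simp
  then show ?case by simp
next
  case (Suc n)
  have "(\<Sum>v\<in>V. lkp \<mu> v) \<noteq> 0" using Suc.prems by simp
  then obtain v where v: "v \<in> V" "lkp \<mu> v \<noteq> 0" by (meson sum.neutral)
  let ?s = "single v (1::nat)"
  obtain \<nu> where eq: "\<mu> = ?s + \<nu>" and k\<nu>: "keys \<nu> \<subseteq> V"
    using split_monomial[OF v(2)] Suc.prems(1) by (metis order_trans)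
  have "(\<Sum>w\<in>V. lkp ?s w) = 1"
    using v finite_slots by (simp add: lookup_single when_def)
  then have n\<nu>: "(\<Sum>w\<in>V. lkp \<nu> w) = n"
    using Suc.prems(2) unfolding eq lookup_add sum.distrib by simp
  note IH = Suc.IH[OF k\<nu> n\<nu>]
  have mon: "(mon \<mu> :: gpoly) = Var v * mon \<nu>" unfolding eq Var_def by (simp add: mult_single)
  have V: "Var v \<in> P (\<lambda>_. d0)" using Var_in_P[of "fst v" "snd v" "\<lambda>_. d0"] v d0 by simp
  have "mon \<mu> - at_l (Phi (mon \<mu>)) = mon \<nu> * (Var v - at_l (g v)) + at_l (g v) * (mon \<nu> - at_l (Phi (mon \<nu>)))"
    by (simp add: mon Phi_hom at_l_mult algebra_simps)
  also have "\<dots> \<in> I (sys u) (\<lambda>_. d0 * (Suc n + 1))"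
  proof (rule I_add)
    show "mon \<nu> * (Var v - at_l (g v)) \<in> I (sys u) (\<lambda>_. d0 * (Suc n + 1))"
      by (rule I_mult[OF conjunct1[OF IH] g_props(1)[OF v(1)] dom[OF d0]]) simp
    show "at_l (g v) * (mon \<nu> - at_l (Phi (mon \<nu>))) \<in> I (sys u) (\<lambda>_. d0 * (Suc n + 1))"
      by (rule I_mult[OF g_props(3)[OF v(1)] conjunct1[OF conjunct2[OF IH]] dom]) (use d0 in simp_all)
  qed
  finally have "mon \<mu> - at_l (Phi (mon \<mu>)) \<in> I (sys u) (\<lambda>_. d0 * (Suc n + 1))" .
  moreover have "mon \<mu> \<in> P (\<lambda>_. d0 * Suc n)"
    unfolding mon by (rule P_mult[OF V conjunct1[OF IH]]) simp
  moreover have "degree (Phi (mon \<mu>)) \<le> m * Suc n"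
  proof -
    have "degree (Phi (mon \<mu>)) \<le> degree (g v) + degree (Phi (mon \<nu>))"
      by (simp add: mon Phi_hom degree_mult_le)
    then show ?thesis using g_props(2)[OF v(1)] IH by simp
  qed
  ultimately show ?case by blast
qed

lemma substitute:
  assumes "p \<in> P (\<lambda>_. d)"
  shows "p - at_l (Phi p) \<in> I (sys u) (\<lambda>_. d0 * (N * d + 1))" "degree (Phi p) \<le> m * (N * d)"
proof -
  have \<mu>: "mon \<mu> - at_l (Phi (mon \<mu>)) \<in> I (sys u) (\<lambda>_. d0 * (N * d + 1)) \<and>
      degree (Phi (mon \<mu>)) \<le> m * (N * d)" if "\<mu> \<in> keys p" for \<mu>
  proof -
    have M: "\<mu> \<in> Mon (\<lambda>_. 0) (\<lambda>_. d)" using assms that by (auto simp: P_def supp_in_def)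
    then have "keys \<mu> \<subseteq> V" by (auto simp: Mon_def slots_def)
    note * = substitute_monomial[OF this refl]
    have "(\<Sum>v\<in>V. lkp \<mu> v) = (\<Sum>q\<in>{1..N}. grade \<mu> q)"
      by (simp add: slots_def grade_def sum.Sigma)
    also have "\<dots> \<le> (\<Sum>q\<in>{1..N}. d)" using M by (intro sum_mono) (auto simp: Mon_def)
    finally have le: "(\<Sum>v\<in>V. lkp \<mu> v) \<le> N * d" by simp
    have "d0 * ((\<Sum>v\<in>V. lkp \<mu> v) + 1) \<le> d0 * (N * d + 1)"
      using le by (intro mult_le_mono2) simp
    moreover have "m * (\<Sum>v\<in>V. lkp \<mu> v) \<le> m * (N * d)" using le by (rule mult_le_mono2)
    ultimately show ?thesis using * I_le by (meson order_trans subsetD)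
  qed
  have p: "p = (\<Sum>\<mu>\<in>keys p. Const (lkp p \<mu>) * mon \<mu>)" by (rule mpoly_sum_mon)
  have Pp: "Phi p = (\<Sum>\<mu>\<in>keys p. smult (lkp p \<mu>) (Phi (mon \<mu>)))"
    by (subst p) (simp add: Phi_hom)
  have "p - at_l (Phi p) = (\<Sum>\<mu>\<in>keys p. Const (lkp p \<mu>) * (mon \<mu> - at_l (Phi (mon \<mu>))))"
    unfolding Pp at_l_sum at_l_smult right_diff_distrib sum_subtractf using p by simp
  also have "\<dots> \<in> I (sys u) (\<lambda>_. d0 * (N * d + 1))" using \<mu> by (intro I_sum I_scale) blast
  finally show "p - at_l (Phi p) \<in> I (sys u) (\<lambda>_. d0 * (N * d + 1))" .
  show "degree (Phi p) \<le> m * (N * d)"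
    unfolding Pp using \<mu> by (intro degree_sum_le) (auto intro: order_trans[OF degree_smult_le])
qed

text \<open>A nontrivial relation would make one of the \<open>m\<close> powers superfluous, so that the codimension would be
  less than \<open>m\<close>.\<close>

lemma at_l_independent:
  assumes r: "\<And>i. i \<ge> m \<Longrightarrow> coeff r i = 0" and "at_l r \<in> I (sys u) (\<lambda>_. d2)"
  shows "r = 0"
proof (rule ccontr)
  assume "r \<noteq> 0"
  then obtain j where cj: "coeff r j \<noteq> 0" by (auto simp: poly_eq_iff)
  then have j: "j < m" using r by (meson not_le)
  let ?D = "\<lambda>_::nat. d2"
  let ?W = "(\<lambda>j. l ^ j) ` ({..<m} - {j})"
  let ?V = "{p. \<exists>b\<in>mp.span ?W. p - b \<in> I (sys u) ?D}"
  have V: "mp.subspace ?V" by (rule subspace_plus_modulo[OF subspace_I])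
  have d2': "1 \<le> d2" using d2(2) d0 by linarith
  have "l ^ i \<in> ?V" if i: "i < m" for i
  proof (cases "i = j")
    case True
    define b where "b = (\<Sum>i\<in>{..<m} - {j}. Const (- coeff r i / coeff r j) * l ^ i)"
    have "at_l r = Const (coeff r j) * l ^ j + (\<Sum>i\<in>{..<m} - {j}. Const (coeff r i) * l ^ i)"
      using at_l_less[of m r] r j by (simp add: sum.remove[of _ j])
    moreover have "Const (inverse (coeff r j)) * (Const (coeff r j) * l ^ j) = l ^ j"
      unfolding mult.assoc[symmetric] Const_mult[symmetric] using cj by simp
    moreover have "Const (inverse (coeff r j)) * (\<Sum>i\<in>{..<m} - {j}. Const (coeff r i) * l ^ i) = - b"
      unfolding b_def sum_distrib_left sum_negf[symmetric]
    proof (intro sum.cong refl)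
      fix i
      have "- coeff r i / coeff r j = - (inverse (coeff r j) * coeff r i)" by (simp add: divide_inverse)
      then have c: "Const (- coeff r i / coeff r j) = - (Const (inverse (coeff r j)) * Const (coeff r i))"
        by (simp only: Const_uminus Const_mult)
      show "Const (inverse (coeff r j)) * (Const (coeff r i) * l ^ i) =
          - (Const (- coeff r i / coeff r j) * l ^ i)"
        unfolding c mult_minus_left minus_minus mult.assoc ..
    qed
    ultimately have "Const (inverse (coeff r j)) * at_l r = l ^ j - b"
      by (simp only: distrib_left) simp
    moreover have "Const (inverse (coeff r j)) * at_l r \<in> I (sys u) ?D" using assms(2) by (rule I_scale)
    moreover have "b \<in> mp.span ?W" unfolding b_def by (intro mp.span_sum mp.span_scale mp.span_base) auto
    ultimately show ?thesis using True by auto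
  next
    case False
    then have "l ^ i \<in> mp.span ?W" using i by (intro mp.span_base) auto
    then show ?thesis by (intro CollectI bexI[of _ "l ^ i"]) auto
  qed
  then have sp: "mp.span (pows l) \<subseteq> ?V" by (intro mp.span_minimal V) auto
  have IV: "I (sys u) ?D \<subseteq> ?V" by (intro subsetI CollectI bexI[of _ 0]) (auto intro: mp.span_zero)
  have "mp.dim (P ?D) \<le> card ?W + mp.dim (I (sys u) ?D)"
  proof (rule mp.dim_le_card_plus[OF _ order_trans[OF I_P[OF d2'] finite_dim_P(1)] finite_dim_P(2)])
    fix p assume "p \<in> P ?D"
    then obtain w where "w \<in> mp.span (pows l)" "p - w \<in> I (sys u) ?D" using span_d2 by blast
    then have "w + (p - w) \<in> ?V" using sp IV by (intro mp.subspace_add[OF V]) auto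
    then show "\<exists>b\<in>mp.span ?W. p - b \<in> I (sys u) ?D" by simp
  qed simp
  also have "card ?W \<le> card ({..<m} - {j})" by (rule card_image_le) simp
  also have "\<dots> = m - 1" using j by simp
  finally show False using dim_d2 j by linarith
qed

text \<open>The remainder of \<open>r\<close> modulo \<open>chi\<close> gives a relation between the powers of \<open>l\<close> below \<open>m\<close>. The bound
  on the degree of \<open>r\<close> keeps the quotient, evaluated at \<open>l\<close>, within the degrees that \<open>d2\<close> allows.\<close>

lemma chi_dvdI:
  assumes "degree r \<le> m * (N * d0) + 1" "at_l r \<in> I (sys u) (\<lambda>_. d2)"
  shows "chi dvd r"
proof -
  define s where "s = r div chi"
  define r' where "r' = r mod chi"
  let ?R = "m * (N * d0) + 1"
  have r: "r = s * chi + r'" by (simp add: s_def r'_def)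
  have "degree s \<le> degree r"
  proof (cases "degree r < m \<or> s = 0")
    case True
    then show ?thesis using div_poly_less[of r chi] chi_props(1) by (auto simp: s_def)
  next
    case False
    have "degree r' \<le> degree r"
      using False degree_mod_less[OF chi_props(3), of r] chi_props(1) by (auto simp: r'_def)
    moreover have "s * chi = r - r'" using r by simp
    ultimately have "degree (s * chi) \<le> degree r"
      using degree_diff_le_max[of r r'] by simp
    then show ?thesis using False chi_props(3) by (simp add: degree_mult_eq)
  qed
  then have "degree s \<le> ?R" using assms(1) by linarith
  then have "at_l s = (\<Sum>i\<le>?R. Const (coeff s i) * l ^ i)" by (rule at_l_le)
  also have "\<dots> \<in> P (\<lambda>_. ?R * d0)"
  proof (intro P_sum P_scale)
    fix i assume "i \<in> {..?R}"
    then have "P (\<lambda>_. i * d0) \<subseteq> P (\<lambda>_. ?R * d0)" by (intro P_mono mult_le_mono1) simp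
    then show "l ^ i \<in> P (\<lambda>_. ?R * d0)" using P_power[OF l, of i] by blast
  qed
  finally have "at_l s * at_l chi \<in> I (sys u) (\<lambda>_. d2)"
    by (rule I_mult[OF _ chi_props(4) dom[OF d0]]) (use d2(2) in simp)
  with assms(2) have "at_l r - at_l s * at_l chi \<in> I (sys u) (\<lambda>_. d2)" by (rule I_diff)
  then have "at_l r' \<in> I (sys u) (\<lambda>_. d2)" by (simp add: r at_l_add at_l_mult)
  moreover have "coeff r' i = 0" if "i \<ge> m" for i
  proof (cases "r' = 0")
    case False
    then have "degree r' < m" using degree_mod_less[OF chi_props(3), of r] chi_props(1) by (auto simp: r'_def)
    then show ?thesis using that by (intro coeff_eq_0) simp
  qed simp
  ultimately have "r' = 0" by (intro at_l_independent)
  then show ?thesis using r by simp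
qed

lemma chi_dvd_Phi_indiff:
  assumes "e \<in> V" shows "chi dvd Phi (indiff_poly E k u e)"
proof -
  let ?f = "indiff_poly E k u e"
  have "P (count_list (nb (fst e))) \<subseteq> P (\<lambda>_. d0)" by (rule P_mono) (use d0 in \<open>simp add: count_nb\<close>)
  then have f: "?f \<in> P (\<lambda>_. d0)" using indiff_poly_in_P by blast
  note s = substitute[OF f]
  have "(?f, nb (fst e)) \<in> set (sys u)" unfolding sysl_def set_map using assms eqs(1) by (intro imageI) simp
  then have "?f * 1 \<in> I (sys u) (\<lambda>_. d2)" by (rule I_memberI) simp
  moreover have "?f - at_l (Phi ?f) \<in> I (sys u) (\<lambda>_. d2)" using s(1) I_le[OF d2(1)] by blast
  ultimately have "?f * 1 - (?f - at_l (Phi ?f)) \<in> I (sys u) (\<lambda>_. d2)" by (rule I_diff)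
  then show ?thesis using s(2) by (intro chi_dvdI) simp_all
qed

lemma chi_dvd_Phi_l: "chi dvd Phi l - [:0, 1:]"
proof (rule chi_dvdI)
  note s = substitute[OF l]
  have "degree (Phi l - [:0, 1:]) \<le> max (degree (Phi l)) (degree [:0, 1::complex:])"
    by (rule degree_diff_le_max)
  then show "degree (Phi l - [:0, 1:]) \<le> m * (N * d0) + 1" using s(2) by simp
  have "at_l [:0, 1:] = l" by (simp add: at_l_pCons)
  then have "at_l (Phi l - [:0, 1:]) = - 1 * (l - at_l (Phi l))" by (simp add: at_l_diff)
  also have "- 1 = Const (- 1 :: complex)" by (simp add: Const_uminus)
  also have "Const (- 1) * (l - at_l (Phi l)) \<in> I (sys u) (\<lambda>_. d2)"
    using s(1) I_le[OF d2(1)] by (intro I_scale) blast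
  finally show "at_l (Phi l - [:0, 1:]) \<in> I (sys u) (\<lambda>_. d2)" .
qed

lemma chi_dvd_Phi_at_l: "chi dvd Phi (at_l r) - r"
proof (induction r)
  case (pCons a r)
  have "pCons a r = [:a:] + [:0, 1:] * r" by simp
  moreover have "Phi (at_l (pCons a r)) = [:a:] + Phi l * Phi (at_l r)"
    by (simp add: at_l_pCons Phi_hom)
  moreover have "([:a:] + Phi l * Phi (at_l r)) - ([:a:] + x * r) = Phi l * (Phi (at_l r) - r) + (Phi l - x) * r"
    for x by (simp add: algebra_simps)
  ultimately have "Phi (at_l (pCons a r)) - pCons a r = Phi l * (Phi (at_l r) - r) + (Phi l - [:0, 1:]) * r"
    by metis
  then show ?case using pCons.IH chi_dvd_Phi_l by (simp only: dvd_add dvd_mult dvd_mult2)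
qed simp

abbreviation J where "J \<equiv> gen_ideal V V (indiff_poly E k u)"

lemma J_add: "p \<in> J \<Longrightarrow> q \<in> J \<Longrightarrow> p + q \<in> J"
proof -
  assume "p \<in> J" "q \<in> J"
  then obtain h h' where "p = (\<Sum>i\<in>V. h i * indiff_poly E k u i)" "\<forall>i\<in>V. h i \<in> mpolys V"
    "q = (\<Sum>i\<in>V. h' i * indiff_poly E k u i)" "\<forall>i\<in>V. h' i \<in> mpolys V"
    unfolding gen_ideal_def by blast
  then show "p + q \<in> J" unfolding gen_ideal_def
    by (intro CollectI exI[of _ "\<lambda>i. h i + h' i"]) (auto simp: distrib_right sum.distrib mpolys_add)
qed

lemma J_mult: "a \<in> mpolys V \<Longrightarrow> p \<in> J \<Longrightarrow> a * p \<in> J"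
proof -
  assume a: "a \<in> mpolys V" and "p \<in> J"
  then obtain h where "p = (\<Sum>i\<in>V. h i * indiff_poly E k u i)" "\<forall>i\<in>V. h i \<in> mpolys V"
    unfolding gen_ideal_def by blast
  then show "a * p \<in> J" unfolding gen_ideal_def using a
    by (intro CollectI exI[of _ "\<lambda>i. a * h i"]) (auto simp: sum_distrib_left mult.assoc mpolys_mult)
qed

lemma zero_in_J: "0 \<in> J"
  unfolding gen_ideal_def by (intro CollectI exI[of _ "\<lambda>_. 0"]) auto

lemma I_in_J: "I (sys u) D \<subseteq> J"
proof (rule I_least)
  show "mp.subspace J" by (intro mp.subspaceI zero_in_J J_add J_mult mpolys_Const)
  fix f \<delta> h assume f: "(f, \<delta>) \<in> set (sys u)" "h \<in> P (degs \<delta> D)"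
  obtain e where e: "e \<in> V" "f = indiff_poly E k u e" using f(1) eqs(1) by (auto simp: sysl_def)
  have h: "h \<in> mpolys V" using f(2) P_le_mpolys by blast
  have "(\<Sum>i\<in>V. (if i = e then h else 0) * indiff_poly E k u i) = (\<Sum>i\<in>V. if i = e then h * f else 0)"
    by (intro sum.cong) (auto simp: e)
  also have "\<dots> = f * h" using e finite_slots by (simp add: mult.commute)
  finally have "f * h = (\<Sum>i\<in>V. (if i = e then h else 0) * indiff_poly E k u i)" by simp
  then show "f * h \<in> J" unfolding gen_ideal_def
    by (intro CollectI exI[of _ "\<lambda>i. if i = e then h else 0"]) (use h in auto)
qed

text \<open>\<open>Phi\<close> induces an isomorphism of the quotient by \<open>J\<close> with \<open>\<complex>[T]\<close> modulo \<open>chi\<close>: the equations go to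
  multiples of \<open>chi\<close>, and conversely a polynomial differs from the value of its image at \<open>l\<close> by an
  element of \<open>J\<close>.\<close>

lemma in_J_iff:
  assumes p: "p \<in> mpolys V" shows "p \<in> J \<longleftrightarrow> chi dvd Phi p"
proof
  assume "p \<in> J"
  then obtain h where h: "p = (\<Sum>i\<in>V. h i * indiff_poly E k u i)"
    unfolding gen_ideal_def by blast
  show "chi dvd Phi p" unfolding h Phi_hom by (intro dvd_sum dvd_mult chi_dvd_Phi_indiff)
next
  assume "chi dvd Phi p"
  then obtain s where s: "Phi p = s * chi" by (metis dvd_div_mult_self)
  obtain d where "p \<in> P (\<lambda>_. d)" using mpolys_in_P[OF p] by (metis order_refl)
  then have "p - at_l (Phi p) \<in> J" using substitute(1) I_in_J by blast
  moreover have "at_l (Phi p) \<in> J"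
    unfolding s at_l_mult using chi_props(4) I_in_J by (intro J_mult at_l_mpolys) blast
  ultimately have "p - at_l (Phi p) + at_l (Phi p) \<in> J" by (rule J_add)
  then show "p \<in> J" by simp
qed

definition sol :: "complex \<Rightarrow> nat \<times> nat \<Rightarrow> complex" where
  "sol \<tau> = (\<lambda>v\<in>V. poly (g v) \<tau>)"

lemma meval_sol:
  assumes "p \<in> mpolys V" shows "meval (sol \<tau>) p = poly (Phi p) \<tau>"
  unfolding Phi_def poly_peval by (rule meval_cong[OF assms]) (simp add: sol_def)

lemma indiff_mpolys: "indiff_poly E k u e \<in> mpolys V"
  using indiff_poly_in_P P_le_mpolys by blast

lemma meval_l_sol: "poly chi \<tau> = 0 \<Longrightarrow> meval (sol \<tau>) l = \<tau>"
proof -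
  assume \<tau>: "poly chi \<tau> = 0"
  obtain s where s: "Phi l - [:0, 1:] = chi * s" using chi_dvd_Phi_l by (rule dvdE)
  have "poly (Phi l - [:0, 1:]) \<tau> = 0" unfolding s using \<tau> by simp
  then show ?thesis by (simp add: meval_sol[OF l_mpolys])
qed

text \<open>A solution is determined by the value \<open>\<tau>\<close> of \<open>l\<close>, which is a root of \<open>chi\<close>. Conversely, a root yields a
  zero, and its coordinates do not vanish because the variables are units modulo the ideal.\<close>

lemma torus_solutions_eq: "torus_solutions N E k u = sol ` {\<tau>. poly chi \<tau> = 0}"
proof (intro equalityI subsetI)
  fix x assume x: "x \<in> torus_solutions N E k u"
  have van: "meval x p = 0" if "p \<in> I (sys u) (\<lambda>_. d0)" for p
    by (rule I_vanish[OF _ that]) (use x in \<open>auto simp: torus_solutions_def\<close>)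
  have at_l: "meval x (at_l r) = poly r (meval x l)" for r
    by (simp add: at_l_def meval_hom poly_altdef)
  have "x v = poly (g v) (meval x l)" if "v \<in> V" for v
    using van[OF g_props(1)[OF that]] unfolding meval_hom(6) at_l by simp
  then have "x = sol (meval x l)"
    using x by (auto simp: sol_def torus_solutions_def PiE_def extensional_def fun_eq_iff)
  moreover have "poly chi (meval x l) = 0" using van[OF chi_props(4)] by (simp add: at_l)
  ultimately show "x \<in> sol ` {\<tau>. poly chi \<tau> = 0}" by blast
next
  fix x assume "x \<in> sol ` {\<tau>. poly chi \<tau> = 0}"
  then obtain \<tau> where \<tau>: "poly chi \<tau> = 0" "x = sol \<tau>" by blast
  have zero: "meval x (indiff_poly E k u e) = 0" if e: "e \<in> V" for e
  proof -
    obtain s where s: "Phi (indiff_poly E k u e) = chi * s" using chi_dvd_Phi_indiff[OF e] by (rule dvdE)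
    show ?thesis unfolding \<tau>(2) meval_sol[OF indiff_mpolys] s using \<tau>(1) by simp
  qed
  have "x v \<noteq> 0" if v: "v \<in> V" for v
  proof
    assume xv: "x v = 0"
    obtain h where h: "1 - Var v * h \<in> I (sys u) (\<lambda>_. d0)" using unit_vars v by blast
    have "meval x (1 - Var v * h) = 0" by (rule I_vanish[OF _ h]) (rule zero)
    then show False unfolding meval_hom(6) meval_hom(2) using xv by simp
  qed
  then show "x \<in> torus_solutions N E k u"
    using zero \<tau>(2) by (auto simp: torus_solutions_def sol_def)
qed

lemma inj_sol: "inj_on sol {\<tau>. poly chi \<tau> = 0}"
  by (rule inj_onI) (metis meval_l_sol mem_Collect_eq)

lemma finite_roots: "finite {\<tau>. poly chi \<tau> = 0}" by (rule poly_roots_finite[OF chi_props(3)])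

lemma isolated_solutions_eq: "isolated_solutions N E k u = sol ` {\<tau>. poly chi \<tau> = 0}"
proof -
  let ?S = "sol ` {\<tau>. poly chi \<tau> = 0}"
  have "x isolated_in ?S \<longleftrightarrow> x \<in> ?S" for x
  proof
    assume x: "x \<in> ?S"
    have "closed (?S - {x})" using finite_roots by (intro finite_imp_closed) auto
    then have "open (- (?S - {x}))" by (rule open_Compl)
    moreover have "- (?S - {x}) \<inter> ?S = {x}" using x by blast
    ultimately show "x isolated_in ?S" using x unfolding isolated_in_def by blast
  qed (simp add: isolated_in_def)
  then show ?thesis by (auto simp: isolated_solutions_def torus_solutions_eq)
qed

text \<open>Localizing \<open>\<complex>[T]\<close> modulo \<open>chi\<close> at \<open>\<tau>\<close> leaves the factor of \<open>chi\<close> that is a power of \<open>T - \<tau>\<close>. The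
  complementary factor, evaluated at \<open>l\<close>, is the denominator.\<close>

lemma local_kernel_sol:
  assumes \<tau>: "poly chi \<tau> = 0"
  shows "local_kernel V J (sol \<tau>) = {p \<in> mpolys V. [:- \<tau>, 1:] ^ order \<tau> chi dvd Phi p}"
proof (intro equalityI subsetI)
  fix p assume "p \<in> local_kernel V J (sol \<tau>)"
  then obtain h where p: "p \<in> mpolys V" and h: "h \<in> mpolys V" "meval (sol \<tau>) h \<noteq> 0" "h * p \<in> J"
    unfolding local_kernel_def by blast
  have "chi dvd Phi h * Phi p" using in_J_iff[OF mpolys_mult[OF h(1) p]] h(3) by (simp add: Phi_hom)
  then have dvd: "[:- \<tau>, 1:] ^ order \<tau> chi dvd Phi h * Phi p" using order_1 dvd_trans by blast
  have h0: "poly (Phi h) \<tau> \<noteq> 0" using h meval_sol by simp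
  have "[:- \<tau>, 1:] ^ order \<tau> chi dvd Phi p"
  proof (cases "Phi p = 0")
    case False
    then have nz: "Phi h * Phi p \<noteq> 0" using h0 by auto
    then have "order \<tau> chi \<le> order \<tau> (Phi h * Phi p)" using dvd by (simp add: order_divides)
    also have "\<dots> = order \<tau> (Phi p)" using nz h0 by (simp add: order_mult order_0I)
    finally show ?thesis by (simp add: order_divides)
  qed simp
  then show "p \<in> {p \<in> mpolys V. [:- \<tau>, 1:] ^ order \<tau> chi dvd Phi p}" using p by simp
next
  fix p assume "p \<in> {p \<in> mpolys V. [:- \<tau>, 1:] ^ order \<tau> chi dvd Phi p}"
  then have p: "p \<in> mpolys V" "[:- \<tau>, 1:] ^ order \<tau> chi dvd Phi p" by auto
  obtain c where c: "chi = [:- \<tau>, 1:] ^ order \<tau> chi * c" "\<not> [:- \<tau>, 1:] dvd c"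
    using order_decomp[OF chi_props(3)] by blast
  have c\<tau>: "poly c \<tau> \<noteq> 0" using c(2) by (simp add: poly_eq_0_iff_dvd)
  obtain s where s: "Phi (at_l c) - c = chi * s" using chi_dvd_Phi_at_l by (rule dvdE)
  then have Pc: "Phi (at_l c) = c + chi * s" by (simp add: algebra_simps)
  have "meval (sol \<tau>) (at_l c) \<noteq> 0" using c\<tau> \<tau> by (simp add: meval_sol[OF at_l_mpolys] Pc)
  moreover have "chi dvd c * Phi p"
  proof -
    have "[:- \<tau>, 1:] ^ order \<tau> chi * c dvd Phi p * c" using p(2) by (rule mult_dvd_mono) simp
    then show ?thesis unfolding c(1)[symmetric] by (simp only: mult.commute)
  qed
  then have "chi dvd Phi (at_l c * p)"
    unfolding Phi_hom Pc by (simp add: distrib_right mult.assoc)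
  then have "at_l c * p \<in> J" using in_J_iff[OF mpolys_mult[OF at_l_mpolys p(1)]] by simp
  ultimately show "p \<in> local_kernel V J (sol \<tau>)"
    unfolding local_kernel_def using p(1) at_l_mpolys by blast
qed

text \<open>The powers of \<open>l\<close> below the order of the root are a basis of the local ring, as the powers of \<open>T\<close> are
  one of \<open>\<complex>[T]\<close> modulo the power of \<open>T - \<tau>\<close>.\<close>

lemma multiplicity_sol:
  assumes \<tau>: "poly chi \<tau> = 0"
  shows "multiplicity_at V V (indiff_poly E k u) (sol \<tau>) = order \<tau> chi"
proof -
  let ?o = "order \<tau> chi"
  let ?p = "[:- \<tau>, 1:] ^ ?o"
  let ?Q = "{p \<in> mpolys V. ?p dvd Phi p}"
  have o: "?o > 0" using \<tau> chi_props(3) by (simp add: order_gt_0_iff)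
  have degp: "degree ?p = ?o" by (rule degree_linear_power)
  have pchi: "?p dvd chi" by (rule order_1)
  have A: "mp.subspace (mpolys V)"
    by (intro mp.subspaceI mpolys_0 mpolys_add mpolys_mult mpolys_Const)
  have Q: "mp.subspace ?Q"
    by (intro mp.subspaceI) (auto simp: Phi_hom mpolys_add mpolys_mult intro: dvd_add dvd_smult)
  have "quot_dim (mpolys V) ?Q = ?o"
  proof (rule quot_dim_eqI[OF A Q, where w = "\<lambda>j. l ^ j"])
    show "l ^ j \<in> mpolys V" for j by (rule mpolys_power[OF l_mpolys])
  next
    fix p :: "gpoly" assume p: "p \<in> mpolys V"
    let ?r = "Phi p mod ?p"
    have "coeff ?r i = 0" if "i \<ge> ?o" for i
    proof (cases "?r = 0")
      case False
      then have "degree ?r < ?o" using degree_mod_less[of ?p "Phi p"] degp by auto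
      then show ?thesis using that by (intro coeff_eq_0) simp
    qed simp
    then have lr: "at_l ?r = (\<Sum>j<?o. Const (coeff ?r j) * l ^ j)" by (rule at_l_less)
    have "Phi (p - at_l ?r) = (Phi p - ?r) - (Phi (at_l ?r) - ?r)" by (simp add: Phi_hom)
    moreover have "?p dvd Phi p - ?r" by (simp add: dvd_minus_mod)
    moreover have "?p dvd Phi (at_l ?r) - ?r" using pchi chi_dvd_Phi_at_l by (rule dvd_trans)
    ultimately have "?p dvd Phi (p - at_l ?r)" by (simp only: dvd_diff)
    then have "p - at_l ?r \<in> ?Q" using p at_l_mpolys by (auto intro: mpolys_diff)
    then show "\<exists>c. p - (\<Sum>j<?o. Const (c j) * l ^ j) \<in> ?Q" unfolding lr by blast
  next
    fix c j assume s: "(\<Sum>j<?o. Const (c j) * l ^ j) \<in> ?Q" and j: "j < ?o"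
    let ?r = "\<Sum>j<?o. monom (c j) j"
    have cr: "coeff ?r i = (if i < ?o then c i else 0)" for i
      by (simp add: coeff_sum if_distrib sum.delta cong: if_cong)
    have "at_l ?r = (\<Sum>j<?o. Const (c j) * l ^ j)" by (simp add: at_l_sum at_l_monom)
    then have "?p dvd Phi (at_l ?r)" using s by simp
    moreover have "?p dvd Phi (at_l ?r) - ?r" using pchi chi_dvd_Phi_at_l by (rule dvd_trans)
    ultimately have "?p dvd Phi (at_l ?r) - (Phi (at_l ?r) - ?r)" by (rule dvd_diff)
    then have dvd: "?p dvd ?r" by simp
    have "?r = 0"
    proof (rule ccontr)
      assume nz: "?r \<noteq> 0"
      then have "coeff ?r (degree ?r) \<noteq> 0" by simp
      then have "degree ?r < ?o" unfolding cr by (metis (full_types))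
      then show False using dvd_imp_degree_le[OF dvd nz] degp by simp
    qed
    then have "coeff ?r j = 0" by simp
    then show "c j = 0" using cr[of j] j by simp
  qed
  then show ?thesis unfolding multiplicity_at_def local_kernel_sol[OF \<tau>] .
qed

theorem solution_count:
  "finite (isolated_solutions N E k u)"
  "solution_number u = m"
proof -
  show "finite (isolated_solutions N E k u)" using finite_roots by (simp add: isolated_solutions_eq)
  have "solution_number u =
      (\<Sum>\<tau>\<in>{\<tau>. poly chi \<tau> = 0}. order \<tau> chi)"
    unfolding isolated_solutions_eq sum.reindex[OF inj_sol] by (intro sum.cong) (auto simp: multiplicity_sol)
  also have "\<dots> = size (proots chi)"
    using chi_props(3) by (simp add: size_multiset_overloaded_eq)
  also have "\<dots> = m" by (simp add: size_proots_complex chi_props(1))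
  finally show "solution_number u = m" .
qed

end

section \<open>The algebraic degree\<close>

context game
begin

theorem algebraic_degree_eq: "algebraic_degree N E k = m"
proof -
  obtain l d0 where l: "l \<in> P (\<lambda>_. d0)" "d0 \<ge> 1" "l ^ m \<in> P (\<lambda>_. d0)"
    and sp: "\<And>d. d \<ge> d0 \<Longrightarrow> near T u0 (\<lambda>u. reduces l d u)"
    and dm: "\<And>d. d \<ge> d0 \<Longrightarrow> near T u0 (\<lambda>u. mp.dim (I (sys u) (\<lambda>_. d)) + m = mp.dim (P (\<lambda>_. d)))"
    and un: "near T u0 (\<lambda>u. \<forall>v\<in>V. \<exists>h. 1 - Var v * h \<in> I (sys u) (\<lambda>_. d0))"
    using generic_structure by blast
  \<comment> \<open>The sum of the two bounds in \<open>good_table\<close>.\<close>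
  define d2 where "d2 = d0 * (N * d0 + 1) + (d0 + (m * (N * d0) + 1) * d0)"
  have d2: "d2 \<ge> d0" by (simp add: d2_def)
  let ?ok = "\<lambda>u. finite (isolated_solutions N E k u) \<and>
      solution_number u = m"
  have nk: "near T u0 ?ok"
  proof (rule near_mono[OF near_conj[OF sp[OF order_refl] near_conj[OF sp[OF d2] near_conj[OF dm[OF d2] un]]]])
    fix u assume *: "reduces l d0 u \<and>
      reduces l d2 u \<and>
      mp.dim (I (sys u) (\<lambda>_. d2)) + m = mp.dim (P (\<lambda>_. d2)) \<and>
      (\<forall>v\<in>V. \<exists>h. 1 - Var v * h \<in> I (sys u) (\<lambda>_. d0))"
    interpret good_table N k E u l d0 d2
    proof
      show "d0 * (N * d0 + 1) \<le> d2" "d0 + (m * (N * d0) + 1) * d0 \<le> d2" unfolding d2_def by simp_all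
    qed (use l * in blast)+
    show "?ok u" using solution_count by blast
  qed
  have u0T: "u0 \<in> T \<rightarrow>\<^sub>E UNIV" by (simp add: u0_def)
  have "\<exists>U. zariski_open T U \<and> U \<noteq> {} \<and> (\<forall>u\<in>U. ?ok u)"
    by (rule near_zariski_open[OF nk u0T]) blast
  then obtain U where U: "zariski_open T U" "U \<noteq> {}" "\<And>u. u \<in> U \<Longrightarrow> ?ok u" by blast
  show ?thesis unfolding algebraic_degree_def
  proof (rule the_equality)
    show "\<exists>U. zariski_open T U \<and> U \<noteq> {} \<and> (\<forall>u\<in>U. ?ok u)" using U by blast
  next
    fix n assume "\<exists>U. zariski_open T U \<and> U \<noteq> {} \<and> (\<forall>u\<in>U. finite (isolated_solutions N E k u) \<and>
      solution_number u = n)"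
    then obtain U' where U': "zariski_open T U'" "U' \<noteq> {}"
      "\<forall>u\<in>U'. solution_number u = n"
      by blast
    obtain u where "u \<in> U" "u \<in> U'" using zariski_open_Int[OF U(1) U'(1) U(2) U'(2)] by blast
    then show "n = m" using U(3)[of u] U'(3) by auto
  qed
qed

lemma prod_of_sums:
  "prod_list (map (\<lambda>\<delta>. \<Sum>q\<in>set \<delta>. Var q) fs) =
    (\<Sum>c\<in>{c. list_all2 (\<lambda>q \<delta>. q \<in> set \<delta>) c fs}. mon (\<Sum>q\<leftarrow>c. single q 1) :: (nat, nat) mpoly)"
proof (induction fs)
  case (Cons \<delta> fs)
  let ?C = "\<lambda>fs. {c. list_all2 (\<lambda>q \<delta>. q \<in> set \<delta>) c fs}"
  have bij: "bij_betw (\<lambda>(q, c). q # c) (set \<delta> \<times> ?C fs) (?C (\<delta> # fs))"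
    by (auto simp: bij_betw_def inj_on_def list_all2_Cons2 image_iff)
  have "(\<Sum>c\<in>?C (\<delta> # fs). mon (\<Sum>q\<leftarrow>c. single q 1) :: (nat, nat) mpoly) =
      (\<Sum>(q, c)\<in>set \<delta> \<times> ?C fs. mon (single q 1 + (\<Sum>q\<leftarrow>c. single q 1)))"
    by (subst sum.reindex_bij_betw[OF bij, symmetric]) (simp add: case_prod_unfold)
  also have "\<dots> = (\<Sum>q\<in>set \<delta>. Var q) * (\<Sum>c\<in>?C fs. mon (\<Sum>q\<leftarrow>c. single q 1))"
    unfolding sum_product sum.cartesian_product by (intro sum.cong) (auto simp: Var_def mult_single)
  finally show ?case by (simp add: Cons.IH)
qed (simp del: One_nat_def)

text \<open>Each player contributes one linear factor for each of its equations, so the terms that multiply out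
  to the required monomial are the choices.\<close>

lemma m_eq_coefficient:
  "m = mcoeff (\<Prod>i\<in>{1..N}. (\<Sum>j\<in>in_nbrs E i. Var j) ^ k i) (\<Sum>i\<in>{1..N}. single i (k i))"
proof -
  let ?\<kappa> = "\<Sum>i\<in>{1..N}. single i (k i)"
  let ?C = "{c. list_all2 (\<lambda>q \<delta>. q \<in> set \<delta>) c (degl eqs)}"
  have "(\<Prod>i\<in>{1..N}. (\<Sum>j\<in>in_nbrs E i. Var j) ^ k i :: (nat, nat) mpoly) = (\<Prod>e\<in>V. \<Sum>j\<in>in_nbrs E (fst e). Var j)"
    using prod.Sigma[of "{1..N}" "\<lambda>i. {1..k i}" "\<lambda>i s. \<Sum>j\<in>in_nbrs E i. Var j :: (nat, nat) mpoly"]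
    by (simp add: slots_def case_prod_unfold)
  also have "\<dots> = prod_list (map (\<lambda>\<delta>. \<Sum>q\<in>set \<delta>. Var q) (degl eqs))"
    using prod.distinct_set_conv_list[OF eqs(2), of "\<lambda>e. \<Sum>j\<in>in_nbrs E (fst e). Var j :: (nat, nat) mpoly"] eqs(1)
    by (simp add: degl_def comp_def)
  finally have "mcoeff (\<Prod>i\<in>{1..N}. (\<Sum>j\<in>in_nbrs E i. Var j) ^ k i) ?\<kappa> =
      (\<Sum>c\<in>?C. if (\<Sum>q\<leftarrow>c. single q 1) = ?\<kappa> then 1 else 0 :: nat)"
    by (simp add: prod_of_sums mcoeff_def lookup_sum lookup_single when_def del: One_nat_def)
  also have "\<dots> = card {c \<in> ?C. (\<Sum>q\<leftarrow>c. single q 1) = ?\<kappa>}"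
  proof -
    have "finite ?C"
    proof (rule finite_subset)
      show "?C \<subseteq> {c. set c \<subseteq> set (concat (degl eqs)) \<and> length c = length (degl eqs)}"
        by (fastforce simp: list_all2_conv_all_nth in_set_conv_nth)
    qed (rule finite_lists_length_eq, simp)
    then show ?thesis by (simp add: sum.If_cases Int_def)
  qed
  also have "{c \<in> ?C. (\<Sum>q\<leftarrow>c. single q 1) = ?\<kappa>} = cs"
  proof -
    have lc: "lkp (\<Sum>q\<leftarrow>c. single q 1) q' = count_list c q'" for c and q' :: nat
      by (induction c) (auto simp: lookup_add lookup_single when_def)
    have lk: "lkp ?\<kappa> q = (if q \<in> {1..N} then k q else 0)" for q
      by (simp add: lookup_sum lookup_single when_def)
    have "(\<Sum>q\<leftarrow>c. single q 1) = ?\<kappa> \<longleftrightarrow> (\<forall>q\<in>{1..N}. count_list c q = k q)" if c: "c \<in> ?C" for c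
    proof -
      have "set c \<subseteq> {1..N}"
        using c set_degl[of eqs] by (fastforce simp: list_all2_conv_all_nth in_set_conv_nth)
      then have "count_list c q = 0" if "q \<notin> {1..N}" for q using that by (auto simp: count_list_0_iff)
      then show ?thesis unfolding poly_mapping_eq_iff fun_eq_iff lc lk by auto
    qed
    then show ?thesis by (auto simp: choices_def)
  qed
  finally show ?thesis by (simp add: m_def)
qed

end

theorem theorem4p5:
  fixes N :: nat and k :: "nat \<Rightarrow> nat"
  assumes "N \<ge> 2" and "\<And>i. i \<in> {1..N} \<Longrightarrow> k i > 0"
  shows "network_degree_poly N k =
           (\<Sum>a\<in>balanced_factors N k (arcs N).
              Const (factor_weight N k a) * (\<Prod>e\<in>arcs N. Var e ^ a e)) \<and>
         (\<forall>E. E \<subseteq> arcs N \<longrightarrow>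
           rat_of_nat (algebraic_degree N E k) =
             (\<Sum>a\<in>balanced_factors N k E. factor_weight N k a))"
proof (intro conjI allI impI)
  fix E assume E: "E \<subseteq> arcs N"
  interpret game N k E by unfold_locales (rule E)
  show "rat_of_nat (algebraic_degree N E k) = (\<Sum>a\<in>balanced_factors N k E. factor_weight N k a)"
    unfolding algebraic_degree_eq m_eq_coefficient by (rule digraph_coefficient[OF E])
qed (rule network_degree_poly_eq)

end
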